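(* Let $A$ be a connected finite dimensional algebra over a field $k$. The following are equivalent: (1) $A$ is brick-directed. (2) $\mathrm{tors}\,A$ is a left modular lattice. (3) $\mathrm{tors}\,A$ is an extremal lattice. (4) The brick quiver of $A$ has no oriented cycles.
   Context: $\mathrm{mod}\,A$ is the category of finite dimensional $A$-modules. A torsion class is a full subcategory of $\mathrm{mod}\,A$ closed under isomorphisms, quotients and extensions; $\mathrm{tors}\,A$ is the complete lattice of torsion classes ordered by inclusion. A brick is a module whose endomorphism algebra is a division algebra; $\mathrm{brick}\,A$ is the set of isomorphism classes of bricks. A brick-cycle is a sequence $X_0\xrightarrow{f_1}X_1\xrightarrow{f_2}\cdots\xrightarrow{f_m}X_m=X_0$ ($m\geq1$) in $\mathrm{mod}\,A$ with all $X_i$ bricks and all $f_i$ nonzero and non-invertible. $A$ is brick-directed if there is no brick-cycle in $\mathrm{mod}\,A$. The brick quiver of $A$ has vertex set $\mathrm{brick}\,A$ and, for distinct $X,Y\in\mathrm{brick}\,A$, an arrow $X\to Y$ if $\mathrm{Hom}_A(X,Y)\neq0$. For a complete lattice $L$: $x\in L$ is left modular if $(y\vee x)\wedge z=y\vee(x\wedge z)$ for all $y\leq z$; $L$ is left modular if it has an inclusion-maximal chain of left modular elements. $\mathrm{JI}^c(L)$ is the set of completely join-irreducible elements ($x\neq\bigvee\emptyset$ with $x\neq\bigvee S$ for all $S\subseteq\{y\mid y<x\}$), with $x_*:=\bigvee\{y\mid y<x\}$; $\mathrm{MI}^c(L)$ is the dual notion. The lattice $L=\mathrm{tors}\,A$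 is known to be weakly atomic, completely semidistributive, and a well-separated $\kappa$-lattice; in particular $\kappa:\mathrm{JI}^c(L)\to\mathrm{MI}^c(L)$, $\kappa(j)=\max\{x\mid x\wedge j=j_*\}$, is a well-defined bijection. $L$ is extremal if it has a maximal chain $\mathcal X$ such that: for all $x\in\mathcal X$ and $j\in\mathrm{JI}^c(L)$ with $j\not\leq x$ we have $x\leq\kappa(j)$; and whenever $x\lessdot y$ is a cover relation with $x,y\in\mathcal X$, there is a unique $j\in\mathrm{JI}^c(L)$ with $j\leq y$, $j\not\leq x$, a unique $m\in\mathrm{MI}^c(L)$ with $x\leq m$, $y\not\leq m$, and $\kappa(j)=m$. *)

theory Defs
  imports
    "HOL-Algebra.Module"
    "HOL-Algebra.Ideal"
    "HOL-Algebra.Complete_Lattice"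
begin

section \<open>Finite dimensional algebras and their modules\<close>

definition fin_dim :: "('k, 'r) ring_scheme \<Rightarrow> ('k, 'v, 's) module_scheme \<Rightarrow> bool" where
  "fin_dim k V \<longleftrightarrow>
    (\<exists>S. finite S \<and> S \<subseteq> carrier V \<and>
      (\<forall>x\<in>carrier V. \<exists>c\<in>S \<rightarrow> carrier k. x = (\<Oplus>\<^bsub>V\<^esub>s\<in>S. c s \<odot>\<^bsub>V\<^esub> s)))"

text \<open>The locale \<open>algebra\<close> of HOL-Algebra covers commutative algebras only.\<close>

locale fin_dim_algebra = field k + module k A + ring A
  for k :: "('k, 'r) ring_scheme" (structure) and A :: "('k, 'a) module" (structure) +
  assumes smult_mult_left:
      "\<lbrakk>c \<in> carrier k; a \<in> carrier A; b \<in> carrier A\<rbrakk>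
        \<Longrightarrow> (c \<odot>\<^bsub>A\<^esub> a) \<otimes>\<^bsub>A\<^esub> b = c \<odot>\<^bsub>A\<^esub> (a \<otimes>\<^bsub>A\<^esub> b)"
    and smult_mult_right:
      "\<lbrakk>c \<in> carrier k; a \<in> carrier A; b \<in> carrier A\<rbrakk>
        \<Longrightarrow> a \<otimes>\<^bsub>A\<^esub> (c \<odot>\<^bsub>A\<^esub> b) = c \<odot>\<^bsub>A\<^esub> (a \<otimes>\<^bsub>A\<^esub> b)"
    and fin_dim: "fin_dim k A"

text \<open>
  \<open>A\<close> is connected if it is not a direct product of two nonzero algebras; the factors of such a
  product are two-sided ideals of \<open>A\<close>.  The zero algebra is not excluded.
\<close>

definition connected_algebra :: "('a, 'r) ring_scheme \<Rightarrow> bool" where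
  "connected_algebra A \<longleftrightarrow>
    \<not> (\<exists>I J. ideal I A \<and> ideal J A \<and> I \<noteq> {\<zero>\<^bsub>A\<^esub>} \<and> J \<noteq> {\<zero>\<^bsub>A\<^esub>} \<and>
          I \<inter> J = {\<zero>\<^bsub>A\<^esub>} \<and> I <+>\<^bsub>A\<^esub> J = carrier A)"

text \<open>
  The locale \<open>module\<close> of HOL-Algebra requires a commutative ring of scalars.  As there, the fields
  \<open>mult\<close> and \<open>one\<close> of the module record are not used.
\<close>

locale left_module = R?: ring R + M?: abelian_group M
  for R :: "('a, 'r) ring_scheme" (structure) and M :: "('a, 'm, 's) module_scheme" (structure) +
  assumes smult_closed [simp, intro]:
      "\<lbrakk>a \<in> carrier R; x \<in> carrier M\<rbrakk> \<Longrightarrow> a \<odot>\<^bsub>M\<^esub> x \<in> carrier M"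
    and smult_l_distr:
      "\<lbrakk>a \<in> carrier R; b \<in> carrier R; x \<in> carrier M\<rbrakk>
        \<Longrightarrow> (a \<oplus> b) \<odot>\<^bsub>M\<^esub> x = a \<odot>\<^bsub>M\<^esub> x \<oplus>\<^bsub>M\<^esub> b \<odot>\<^bsub>M\<^esub> x"
    and smult_r_distr:
      "\<lbrakk>a \<in> carrier R; x \<in> carrier M; y \<in> carrier M\<rbrakk>
        \<Longrightarrow> a \<odot>\<^bsub>M\<^esub> (x \<oplus>\<^bsub>M\<^esub> y) = a \<odot>\<^bsub>M\<^esub> x \<oplus>\<^bsub>M\<^esub> a \<odot>\<^bsub>M\<^esub> y"
    and smult_assoc1:
      "\<lbrakk>a \<in> carrier R; b \<in> carrier R; x \<in> carrier M\<rbrakk>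
        \<Longrightarrow> (a \<otimes> b) \<odot>\<^bsub>M\<^esub> x = a \<odot>\<^bsub>M\<^esub> (b \<odot>\<^bsub>M\<^esub> x)"
    and smult_one [simp]: "x \<in> carrier M \<Longrightarrow> \<one> \<odot>\<^bsub>M\<^esub> x = x"

text \<open>The \<open>k\<close>-vector space underlying an \<open>A\<close>-module.\<close>

definition restrict_scalars :: "('k, 'a) module \<Rightarrow> ('a, 'm) module \<Rightarrow> ('k, 'm) module" where
  "restrict_scalars A M =
    \<lparr>carrier = carrier M, mult = mult M, one = one M, zero = zero M, add = add M,
     smult = (\<lambda>c x. (c \<odot>\<^bsub>A\<^esub> \<one>\<^bsub>A\<^esub>) \<odot>\<^bsub>M\<^esub> x)\<rparr>"

definition fin_dim_module ::
  "('k, 'r) ring_scheme \<Rightarrow> ('k, 'a) module \<Rightarrow> ('a, 'm) module \<Rightarrow> bool" where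
  "fin_dim_module k A M \<longleftrightarrow> left_module A M \<and> fin_dim k (restrict_scalars A M)"

text \<open>
  \<open>Hom_A(M, N)\<close>; the maps are \<open>undefined\<close> outside the carrier of \<open>M\<close>, so that equality in this set
  is equality of homomorphisms.
\<close>

definition mod_hom ::
  "('a, 'r) ring_scheme \<Rightarrow> ('a, 'm, 's) module_scheme \<Rightarrow> ('a, 'n, 't) module_scheme \<Rightarrow> ('m \<Rightarrow> 'n) set"
  where
  "mod_hom A M N = {f \<in> carrier M \<rightarrow>\<^sub>E carrier N.
      (\<forall>x\<in>carrier M. \<forall>y\<in>carrier M. f (x \<oplus>\<^bsub>M\<^esub> y) = f x \<oplus>\<^bsub>N\<^esub> f y) \<and>
      (\<forall>a\<in>carrier A. \<forall>x\<in>carrier M. f (a \<odot>\<^bsub>M\<^esub> x) = a \<odot>\<^bsub>N\<^esub> f x)}"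

definition zero_hom :: "('a, 'm, 's) module_scheme \<Rightarrow> ('a, 'n, 't) module_scheme \<Rightarrow> 'm \<Rightarrow> 'n" where
  "zero_hom M N = (\<lambda>x\<in>carrier M. \<zero>\<^bsub>N\<^esub>)"

definition mod_iso ::
  "('a, 'r) ring_scheme \<Rightarrow> ('a, 'm, 's) module_scheme \<Rightarrow> ('a, 'n, 't) module_scheme \<Rightarrow> ('m \<Rightarrow> 'n) set"
  where
  "mod_iso A M N = {f \<in> mod_hom A M N. bij_betw f (carrier M) (carrier N)}"

definition isomorphic ::
  "('a, 'r) ring_scheme \<Rightarrow> ('a, 'm, 's) module_scheme \<Rightarrow> ('a, 'n, 't) module_scheme \<Rightarrow> bool" where
  "isomorphic A M N \<longleftrightarrow> mod_iso A M N \<noteq> {}"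

definition short_exact ::
  "('a, 'r) ring_scheme \<Rightarrow> ('a, 'l, 's) module_scheme \<Rightarrow> ('a, 'm, 't) module_scheme \<Rightarrow>
    ('a, 'n, 'u) module_scheme \<Rightarrow> ('l \<Rightarrow> 'm) \<Rightarrow> ('m \<Rightarrow> 'n) \<Rightarrow> bool" where
  "short_exact A L M N f g \<longleftrightarrow>
    f \<in> mod_hom A L M \<and> g \<in> mod_hom A M N \<and>
    inj_on f (carrier L) \<and> f ` carrier L = {x \<in> carrier M. g x = \<zero>\<^bsub>N\<^esub>} \<and>
    g ` carrier M = carrier N"

text \<open>
  The objects of \<open>mod A\<close> are the finite dimensional left \<open>A\<close>-modules whose elements have type
  \<open>nat \<Rightarrow> 'k\<close>.  By \<open>fin_dim_module_has_copy\<close> below, this type is large enough to contain an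
  isomorphic copy of every finite dimensional \<open>A\<close>-module.
\<close>

type_synonym ('k, 'a) object = "('a, nat \<Rightarrow> 'k) module"

definition mod_cat :: "('k, 'r) ring_scheme \<Rightarrow> ('k, 'a) module \<Rightarrow> ('k, 'a) object set" where
  "mod_cat k A = {M. fin_dim_module k A M}"


section \<open>Bricks\<close>

definition End_ring :: "('a, 'r) ring_scheme \<Rightarrow> ('a, 'm, 's) module_scheme \<Rightarrow> ('m \<Rightarrow> 'm) ring" where
  "End_ring A M =
    \<lparr>carrier = mod_hom A M M,
     mult = (\<lambda>f g. compose (carrier M) f g),
     one = (\<lambda>x\<in>carrier M. x),
     zero = zero_hom M M,
     add = (\<lambda>f g. \<lambda>x\<in>carrier M. f x \<oplus>\<^bsub>M\<^esub> g x)\<rparr>"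

locale division_ring = ring +
  assumes one_not_zero [simp]: "\<one> \<noteq> \<zero>"
    and division_Units: "Units R = carrier R - {\<zero>}"

definition bricks :: "('k, 'r) ring_scheme \<Rightarrow> ('k, 'a) module \<Rightarrow> ('k, 'a) object set" where
  "bricks k A = {X \<in> mod_cat k A. division_ring (End_ring A X)}"

definition brick_cycle ::
  "('k, 'r) ring_scheme \<Rightarrow> ('k, 'a) module \<Rightarrow> nat \<Rightarrow> (nat \<Rightarrow> ('k, 'a) object) \<Rightarrow>
    (nat \<Rightarrow> (nat \<Rightarrow> 'k) \<Rightarrow> (nat \<Rightarrow> 'k)) \<Rightarrow> bool" where
  "brick_cycle k A m X f \<longleftrightarrow>
    m \<ge> 1 \<and> X m = X 0 \<and> (\<forall>i\<le>m. X i \<in> bricks k A) \<and>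
    (\<forall>i\<in>{1..m}. f i \<in> mod_hom A (X (i - 1)) (X i) \<and>
       f i \<noteq> zero_hom (X (i - 1)) (X i) \<and> f i \<notin> mod_iso A (X (i - 1)) (X i))"

definition brick_directed :: "('k, 'r) ring_scheme \<Rightarrow> ('k, 'a) module \<Rightarrow> bool" where
  "brick_directed k A \<longleftrightarrow> \<not> (\<exists>m X f. brick_cycle k A m X f)"

definition brick_classes :: "('k, 'r) ring_scheme \<Rightarrow> ('k, 'a) module \<Rightarrow> ('k, 'a) object set set" where
  "brick_classes k A =
    bricks k A // {(X, Y). X \<in> bricks k A \<and> Y \<in> bricks k A \<and> isomorphic A X Y}"

text \<open>
  There is at most one arrow between any two vertices, so the quiver is given by its arrow relation
  on the vertex set \<open>brick_classes k A\<close>; it has no oriented cycle iff this relation is \<open>acyclic\<close>.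
\<close>

definition brick_quiver ::
  "('k, 'r) ring_scheme \<Rightarrow> ('k, 'a) module \<Rightarrow> ('k, 'a) object set rel" where
  "brick_quiver k A =
    {(P, Q). P \<in> brick_classes k A \<and> Q \<in> brick_classes k A \<and> P \<noteq> Q \<and>
       (\<exists>X\<in>P. \<exists>Y\<in>Q. mod_hom A X Y \<noteq> {zero_hom X Y})}"


section \<open>Torsion classes\<close>

text \<open>
  The condition \<open>T \<noteq> {}\<close> (equivalently, \<open>T\<close> contains the zero modules) makes explicit that the
  empty subcategory is not a torsion class.
\<close>

definition torsion_class ::
  "('k, 'r) ring_scheme \<Rightarrow> ('k, 'a) module \<Rightarrow> ('k, 'a) object set \<Rightarrow> bool" where
  "torsion_class k A T \<longleftrightarrow>
    T \<subseteq> mod_cat k A \<and> T \<noteq> {} \<and>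
    (\<forall>M\<in>T. \<forall>N\<in>mod_cat k A. isomorphic A M N \<longrightarrow> N \<in> T) \<and>
    (\<forall>M\<in>T. \<forall>N\<in>mod_cat k A. (\<exists>g\<in>mod_hom A M N. g ` carrier M = carrier N) \<longrightarrow> N \<in> T) \<and>
    (\<forall>L\<in>T. \<forall>N\<in>T. \<forall>M\<in>mod_cat k A. (\<exists>f g. short_exact A L M N f g) \<longrightarrow> M \<in> T)"

definition tors :: "('k, 'r) ring_scheme \<Rightarrow> ('k, 'a) module \<Rightarrow> ('k, 'a) object set gorder" where
  "tors k A = \<lparr>carrier = {T. torsion_class k A T}, eq = (=), le = (\<subseteq>)\<rparr>"


section \<open>Left modular and extremal lattices\<close>

text \<open>
  These notions are meant for complete lattices \<open>L\<close>; a maximal chain is a maximal element among all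
  chains of \<open>L\<close>.
\<close>

definition left_modular :: "('b, 'c) gorder_scheme \<Rightarrow> 'b \<Rightarrow> bool" where
  "left_modular L x \<longleftrightarrow>
    (\<forall>y\<in>carrier L. \<forall>z\<in>carrier L. y \<sqsubseteq>\<^bsub>L\<^esub> z \<longrightarrow>
      (y \<squnion>\<^bsub>L\<^esub> x) \<sqinter>\<^bsub>L\<^esub> z = y \<squnion>\<^bsub>L\<^esub> (x \<sqinter>\<^bsub>L\<^esub> z))"

definition maximal_chain :: "('b, 'c) gorder_scheme \<Rightarrow> 'b set \<Rightarrow> bool" where
  "maximal_chain L C \<longleftrightarrow> pred_on.maxchain (carrier L) (\<sqsubseteq>\<^bsub>L\<^esub>) C"

definition left_modular_lattice :: "('b, 'c) gorder_scheme \<Rightarrow> bool" where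
  "left_modular_lattice L \<longleftrightarrow> (\<exists>C. maximal_chain L C \<and> (\<forall>x\<in>C. left_modular L x))"

definition JIc :: "('b, 'c) gorder_scheme \<Rightarrow> 'b set" where
  "JIc L = {x \<in> carrier L. x \<noteq> \<Squnion>\<^bsub>L\<^esub>{} \<and>
      (\<forall>S. S \<subseteq> {y \<in> carrier L. y \<sqsubset>\<^bsub>L\<^esub> x} \<longrightarrow> x \<noteq> \<Squnion>\<^bsub>L\<^esub>S)}"

definition MIc :: "('b, 'c) gorder_scheme \<Rightarrow> 'b set" where
  "MIc L = {x \<in> carrier L. x \<noteq> \<Sqinter>\<^bsub>L\<^esub>{} \<and>
      (\<forall>S. S \<subseteq> {y \<in> carrier L. x \<sqsubset>\<^bsub>L\<^esub> y} \<longrightarrow> x \<noteq> \<Sqinter>\<^bsub>L\<^esub>S)}"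

definition lower_star :: "('b, 'c) gorder_scheme \<Rightarrow> 'b \<Rightarrow> 'b" where
  "lower_star L x = \<Squnion>\<^bsub>L\<^esub>{y \<in> carrier L. y \<sqsubset>\<^bsub>L\<^esub> x}"

definition kappa :: "('b, 'c) gorder_scheme \<Rightarrow> 'b \<Rightarrow> 'b" where
  "kappa L j = (THE m. greatest L m {x \<in> carrier L. x \<sqinter>\<^bsub>L\<^esub> j = lower_star L j})"

definition covers :: "('b, 'c) gorder_scheme \<Rightarrow> 'b \<Rightarrow> 'b \<Rightarrow> bool" where
  "covers L x y \<longleftrightarrow> x \<sqsubset>\<^bsub>L\<^esub> y \<and> \<not> (\<exists>z\<in>carrier L. x \<sqsubset>\<^bsub>L\<^esub> z \<and> z \<sqsubset>\<^bsub>L\<^esub> y)"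

definition extremal_lattice :: "('b, 'c) gorder_scheme \<Rightarrow> bool" where
  "extremal_lattice L \<longleftrightarrow>
    (\<exists>C. maximal_chain L C \<and>
      (\<forall>x\<in>C. \<forall>j\<in>JIc L. \<not> j \<sqsubseteq>\<^bsub>L\<^esub> x \<longrightarrow> x \<sqsubseteq>\<^bsub>L\<^esub> kappa L j) \<and>
      (\<forall>x\<in>C. \<forall>y\<in>C. covers L x y \<longrightarrow>
        (\<exists>j m. {j' \<in> JIc L. j' \<sqsubseteq>\<^bsub>L\<^esub> y \<and> \<not> j' \<sqsubseteq>\<^bsub>L\<^esub> x} = {j} \<and>
               {m' \<in> MIc L. x \<sqsubseteq>\<^bsub>L\<^esub> m' \<and> \<not> y \<sqsubseteq>\<^bsub>L\<^esub> m'} = {m} \<and>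
               kappa L j = m)))"


section \<open>Well-definedness\<close>

lemma (in left_module) left_zero [simp]: "a \<in> carrier R \<Longrightarrow> a \<odot>\<^bsub>M\<^esub> \<zero>\<^bsub>M\<^esub> = \<zero>\<^bsub>M\<^esub>"
  by (metis M.add.r_cancel_one' M.l_zero M.zero_closed smult_closed smult_r_distr)

lemma finsum_restrict_scalars: "finsum (restrict_scalars A M) = finsum M"
  by (intro ext) (simp add: finsum_def finprod_def restrict_scalars_def)

lemma fin_dim_module_iff:
  "fin_dim_module k A M \<longleftrightarrow> left_module A M \<and>
    (\<exists>S. finite S \<and> S \<subseteq> carrier M \<and>
      (\<forall>x\<in>carrier M. \<exists>c\<in>S \<rightarrow> carrier k. x = (\<Oplus>\<^bsub>M\<^esub>s\<in>S. (c s \<odot>\<^bsub>A\<^esub> \<one>\<^bsub>A\<^esub>) \<odot>\<^bsub>M\<^esub> s)))"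
  unfolding fin_dim_module_def fin_dim_def finsum_restrict_scalars
  unfolding restrict_scalars_def partial_object.simps module.simps ..

lemma mod_hom_zero:
  assumes "left_module A M" "left_module A N" "f \<in> mod_hom A M N"
  shows "f \<zero>\<^bsub>M\<^esub> = \<zero>\<^bsub>N\<^esub>"
proof -
  interpret M: left_module A M by fact
  interpret N: left_module A N by fact
  have "f \<zero>\<^bsub>M\<^esub> \<in> carrier N" "f (\<zero>\<^bsub>M\<^esub> \<oplus>\<^bsub>M\<^esub> \<zero>\<^bsub>M\<^esub>) = f \<zero>\<^bsub>M\<^esub> \<oplus>\<^bsub>N\<^esub> f \<zero>\<^bsub>M\<^esub>"
    using assms(3) by (auto simp: mod_hom_def simp del: M.M.l_zero M.M.r_zero)
  then show ?thesis
    by (simp add: N.M.add.r_cancel_one')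
qed

lemma mod_hom_finsum:
  assumes "left_module A M" "left_module A N" "f \<in> mod_hom A M N" "finite S" "u \<in> S \<rightarrow> carrier M"
  shows "f (\<Oplus>\<^bsub>M\<^esub>s\<in>S. u s) = (\<Oplus>\<^bsub>N\<^esub>s\<in>S. f (u s))"
proof -
  interpret M: left_module A M by fact
  interpret N: left_module A N by fact
  show ?thesis
    using assms(4,5)
  proof (induction S rule: finite_induct)
    case empty
    then show ?case using mod_hom_zero[OF assms(1-3)] by simp
  next
    case (insert x S)
    have "f ` carrier M \<subseteq> carrier N" using assms(3) by (auto simp: mod_hom_def)
    then have fu: "(\<lambda>s. f (u s)) \<in> S \<rightarrow> carrier N" "f (u x) \<in> carrier N"
      using insert.prems by auto
    have "f (u x \<oplus>\<^bsub>M\<^esub> finsum M u S) = f (u x) \<oplus>\<^bsub>N\<^esub> f (finsum M u S)"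
      using assms(3) insert.prems by (auto simp: mod_hom_def)
    then show ?case
      using insert fu by auto
  qed
qed

lemma fin_dim_module_iso:
  fixes M :: "('a, 'm) module" and N :: "('a, 'n) module"
  assumes "fin_dim_algebra k A" "fin_dim_module k A M" "left_module A N" "f \<in> mod_iso A M N"
  shows "fin_dim_module k A N"
proof -
  interpret A: fin_dim_algebra k A by fact
  interpret M: left_module A M
    using assms(2) by (simp add: fin_dim_module_def)
  interpret N: left_module A N by fact
  have f: "f \<in> mod_hom A M N" "bij_betw f (carrier M) (carrier N)"
    using assms(4) by (auto simp: mod_iso_def)
  obtain S where S: "finite S" "S \<subseteq> carrier M"
    and span: "\<And>x. x \<in> carrier M \<Longrightarrow>
      \<exists>c\<in>S \<rightarrow> carrier k. x = (\<Oplus>\<^bsub>M\<^esub>s\<in>S. (c s \<odot>\<^bsub>A\<^esub> \<one>\<^bsub>A\<^esub>) \<odot>\<^bsub>M\<^esub> s)"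
    using assms(2) unfolding fin_dim_module_iff by blast
  have inj: "inj_on f S"
    using f(2) S(2) by (meson bij_betw_imp_inj_on inj_on_subset)
  have fS: "f ` S \<subseteq> carrier N"
    using f(2) S(2) by (auto simp: bij_betw_def)
  have "\<exists>d\<in>f ` S \<rightarrow> carrier k. y = (\<Oplus>\<^bsub>N\<^esub>t\<in>f ` S. (d t \<odot>\<^bsub>A\<^esub> \<one>\<^bsub>A\<^esub>) \<odot>\<^bsub>N\<^esub> t)"
    if "y \<in> carrier N" for y
  proof -
    obtain x where x: "x \<in> carrier M" "y = f x"
      using f(2) \<open>y \<in> carrier N\<close> by (auto simp: bij_betw_def)
    obtain c where c: "c \<in> S \<rightarrow> carrier k" "x = (\<Oplus>\<^bsub>M\<^esub>s\<in>S. (c s \<odot>\<^bsub>A\<^esub> \<one>\<^bsub>A\<^esub>) \<odot>\<^bsub>M\<^esub> s)"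
      using span[OF x(1)] by blast
    define d where "d t = c (inv_into S f t)" for t
    have d: "d (f s) = c s" if "s \<in> S" for s
      using inj that by (simp add: d_def)
    have cA: "c s \<odot>\<^bsub>A\<^esub> \<one>\<^bsub>A\<^esub> \<in> carrier A" if "s \<in> S" for s
      using c(1) that by auto
    have "y = (\<Oplus>\<^bsub>N\<^esub>s\<in>S. f ((c s \<odot>\<^bsub>A\<^esub> \<one>\<^bsub>A\<^esub>) \<odot>\<^bsub>M\<^esub> s))"
      unfolding x(2) by (subst c(2), rule mod_hom_finsum)
        (use assms(3) f(1) S cA M.left_module_axioms in auto)
    also have "\<dots> = (\<Oplus>\<^bsub>N\<^esub>s\<in>S. (d (f s) \<odot>\<^bsub>A\<^esub> \<one>\<^bsub>A\<^esub>) \<odot>\<^bsub>N\<^esub> f s)"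
    proof (rule N.M.finsum_cong')
      show "(\<lambda>s. (d (f s) \<odot>\<^bsub>A\<^esub> \<one>\<^bsub>A\<^esub>) \<odot>\<^bsub>N\<^esub> f s) \<in> S \<rightarrow> carrier N"
        using cA d fS by auto
      show "f ((c s \<odot>\<^bsub>A\<^esub> \<one>\<^bsub>A\<^esub>) \<odot>\<^bsub>M\<^esub> s) = (d (f s) \<odot>\<^bsub>A\<^esub> \<one>\<^bsub>A\<^esub>) \<odot>\<^bsub>N\<^esub> f s" if "s \<in> S" for s
        using f(1) cA[OF that] S(2) that d[OF that] by (auto simp: mod_hom_def)
    qed simp
    also have "\<dots> = (\<Oplus>\<^bsub>N\<^esub>t\<in>f ` S. (d t \<odot>\<^bsub>A\<^esub> \<one>\<^bsub>A\<^esub>) \<odot>\<^bsub>N\<^esub> t)"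
      by (subst N.M.finsum_reindex) (use inj cA d fS in auto)
    finally have "y = (\<Oplus>\<^bsub>N\<^esub>t\<in>f ` S. (d t \<odot>\<^bsub>A\<^esub> \<one>\<^bsub>A\<^esub>) \<odot>\<^bsub>N\<^esub> t)" .
    moreover have "d \<in> f ` S \<rightarrow> carrier k"
      using c(1) d by auto
    ultimately show ?thesis by blast
  qed
  then show ?thesis
    unfolding fin_dim_module_iff
    using S(1) fS assms(3) by (intro conjI exI[of _ "f ` S"] ballI finite_imageI) assumption+
qed

lemma transport_module:
  fixes M :: "('a, 'm) module" and h :: "'m \<Rightarrow> 'n"
  assumes "left_module A M" and inj: "inj_on h (carrier M)"
  shows "\<exists>N :: ('a, 'n) module. left_module A N \<and> isomorphic A M N"
proof -
  interpret M: left_module A M by fact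
  define g where "g = inv_into (carrier M) h"
  have g: "g (h x) = x" if "x \<in> carrier M" for x
    using inj that by (simp add: g_def)
  define N :: "('a, 'n) module" where
    "N = \<lparr>carrier = h ` carrier M, mult = undefined, one = undefined, zero = h \<zero>\<^bsub>M\<^esub>,
          add = (\<lambda>u v. h (g u \<oplus>\<^bsub>M\<^esub> g v)), smult = (\<lambda>a u. h (a \<odot>\<^bsub>M\<^esub> g u))\<rparr>"
  have grp: "abelian_group N"
  proof (rule abelian_groupI)
    fix u assume "u \<in> carrier N"
    then show "\<exists>v\<in>carrier N. v \<oplus>\<^bsub>N\<^esub> u = \<zero>\<^bsub>N\<^esub>"
      by (force simp: N_def g M.M.l_neg intro: bexI[of _ "\<ominus>\<^bsub>M\<^esub> (g u)"])
  qed (auto simp: N_def g M.M.a_assoc M.M.a_comm M.M.a_lcomm)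
  have "left_module A N"
    by (intro left_module.intro left_module_axioms.intro grp M.R.ring_axioms)
       (auto simp: N_def g M.smult_l_distr M.smult_r_distr M.smult_assoc1)
  moreover have "(\<lambda>x\<in>carrier M. h x) \<in> mod_iso A M N"
    using inj by (auto simp: mod_iso_def mod_hom_def N_def g bij_betw_def inj_on_def)
  ultimately show ?thesis
    unfolding isomorphic_def by blast
qed

theorem fin_dim_module_has_copy:
  fixes k :: "('k, 'r) ring_scheme" and A :: "('k, 'a) module" and M :: "('a, 'm) module"
  assumes "fin_dim_algebra k A" "fin_dim_module k A M"
  shows "\<exists>N \<in> mod_cat k A. isomorphic A M N"
proof -
  interpret A: fin_dim_algebra k A by fact
  interpret M: left_module A M
    using assms(2) by (simp add: fin_dim_module_def)
  obtain S where S: "finite S" "S \<subseteq> carrier M"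
    and span: "\<And>x. x \<in> carrier M \<Longrightarrow>
      \<exists>c\<in>S \<rightarrow> carrier k. x = (\<Oplus>\<^bsub>M\<^esub>s\<in>S. (c s \<odot>\<^bsub>A\<^esub> \<one>\<^bsub>A\<^esub>) \<odot>\<^bsub>M\<^esub> s)"
    using assms(2) unfolding fin_dim_module_iff by blast
  obtain e :: "'m \<Rightarrow> nat" where e: "inj_on e S"
    using S(1) finite_imp_inj_to_nat_seg by blast
  have "\<forall>x\<in>carrier M. \<exists>c. c \<in> S \<rightarrow> carrier k \<and> x = (\<Oplus>\<^bsub>M\<^esub>s\<in>S. (c s \<odot>\<^bsub>A\<^esub> \<one>\<^bsub>A\<^esub>) \<odot>\<^bsub>M\<^esub> s)"
    using span by blast
  from bchoice[OF this] obtain c where c: "\<And>x. x \<in> carrier M \<Longrightarrow> c x \<in> S \<rightarrow> carrier k"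
    "\<And>x. x \<in> carrier M \<Longrightarrow> x = (\<Oplus>\<^bsub>M\<^esub>s\<in>S. (c x s \<odot>\<^bsub>A\<^esub> \<one>\<^bsub>A\<^esub>) \<odot>\<^bsub>M\<^esub> s)"
    by blast
  define h :: "'m \<Rightarrow> nat \<Rightarrow> 'k" where "h x = (\<lambda>n. c x (inv_into S e n))" for x
  have h_c: "h x (e s) = c x s" if "s \<in> S" for x s
    using e that by (simp add: h_def)
  have "inj_on h (carrier M)"
  proof (rule inj_onI)
    fix x y assume xy: "x \<in> carrier M" "y \<in> carrier M" "h x = h y"
    have eq: "c x s = c y s" if "s \<in> S" for s
      using h_c[OF that, of x] h_c[OF that, of y] xy(3) by simp
    have "(\<lambda>s. (c y s \<odot>\<^bsub>A\<^esub> \<one>\<^bsub>A\<^esub>) \<odot>\<^bsub>M\<^esub> s) \<in> S \<rightarrow> carrier M"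
      using c(1)[OF xy(2)] S(2) by auto
    then have "(\<Oplus>\<^bsub>M\<^esub>s\<in>S. (c x s \<odot>\<^bsub>A\<^esub> \<one>\<^bsub>A\<^esub>) \<odot>\<^bsub>M\<^esub> s) = (\<Oplus>\<^bsub>M\<^esub>s\<in>S. (c y s \<odot>\<^bsub>A\<^esub> \<one>\<^bsub>A\<^esub>) \<odot>\<^bsub>M\<^esub> s)"
      using eq by (intro M.M.finsum_cong') auto
    then show "x = y"
      using c(2)[OF xy(1)] c(2)[OF xy(2)] by simp
  qed
  then obtain N :: "('a, nat \<Rightarrow> 'k) module" where N: "left_module A N" "isomorphic A M N"
    using transport_module M.left_module_axioms by blast
  then have "fin_dim_module k A N"
    using fin_dim_module_iso[OF assms] by (auto simp: isomorphic_def)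
  then show ?thesis
    using N(2) by (auto simp: mod_cat_def)
qed

lemma End_ring_is_ring:
  assumes "left_module A M"
  shows "ring (End_ring A M)"
proof -
  interpret M: left_module A M by fact
  let ?E = "End_ring A M"
  have E: "f x = undefined" if "f \<in> mod_hom A M M" "x \<notin> carrier M" for f x
    using that by (auto simp: mod_hom_def PiE_def extensional_def)
  have H1: "f x \<in> carrier M" if "f \<in> mod_hom A M M" "x \<in> carrier M" for f x
    using that by (auto simp: mod_hom_def)
  have H2: "f (x \<oplus>\<^bsub>M\<^esub> y) = f x \<oplus>\<^bsub>M\<^esub> f y"
    if "f \<in> mod_hom A M M" "x \<in> carrier M" "y \<in> carrier M" for f x y
    using that by (auto simp: mod_hom_def)
  have minus_smult: "\<ominus>\<^bsub>M\<^esub> (a \<odot>\<^bsub>M\<^esub> x) = a \<odot>\<^bsub>M\<^esub> (\<ominus>\<^bsub>M\<^esub> x)"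
    if "a \<in> carrier A" "x \<in> carrier M" for a x
  proof -
    have "a \<odot>\<^bsub>M\<^esub> (\<ominus>\<^bsub>M\<^esub> x) \<oplus>\<^bsub>M\<^esub> a \<odot>\<^bsub>M\<^esub> x = \<zero>\<^bsub>M\<^esub>"
      using that by (metis M.M.a_inv_closed M.M.l_neg M.left_zero M.smult_r_distr)
    then show ?thesis
      using that by (simp add: M.M.minus_equality)
  qed
  have grp: "abelian_group ?E"
  proof (rule abelian_groupI)
    fix f g assume "f \<in> carrier ?E" "g \<in> carrier ?E"
    then show "f \<oplus>\<^bsub>?E\<^esub> g \<in> carrier ?E"
      by (auto simp: End_ring_def mod_hom_def M.M.a_ac M.smult_r_distr PiE_iff)
  next
    show "\<zero>\<^bsub>?E\<^esub> \<in> carrier ?E"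
      by (auto simp: End_ring_def mod_hom_def zero_hom_def)
  next
    fix f g h assume "f \<in> carrier ?E" "g \<in> carrier ?E" "h \<in> carrier ?E"
    then show "f \<oplus>\<^bsub>?E\<^esub> g \<oplus>\<^bsub>?E\<^esub> h = f \<oplus>\<^bsub>?E\<^esub> (g \<oplus>\<^bsub>?E\<^esub> h)"
      by (auto simp: End_ring_def H1 M.M.a_assoc intro!: restrict_ext)
  next
    fix f g assume "f \<in> carrier ?E" "g \<in> carrier ?E"
    then show "f \<oplus>\<^bsub>?E\<^esub> g = g \<oplus>\<^bsub>?E\<^esub> f"
      by (auto simp: End_ring_def H1 M.M.a_comm intro!: restrict_ext)
  next
    fix f assume "f \<in> carrier ?E"
    then show "\<zero>\<^bsub>?E\<^esub> \<oplus>\<^bsub>?E\<^esub> f = f"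
      by (auto simp: End_ring_def H1 E zero_hom_def fun_eq_iff restrict_def)
  next
    fix f assume "f \<in> carrier ?E"
    then have f: "f \<in> mod_hom A M M" by (simp add: End_ring_def)
    let ?g = "\<lambda>x\<in>carrier M. \<ominus>\<^bsub>M\<^esub> (f x)"
    have "?g \<in> mod_hom A M M"
      using f by (auto simp: mod_hom_def M.M.minus_add minus_smult PiE_iff)
    moreover have "?g \<oplus>\<^bsub>?E\<^esub> f = \<zero>\<^bsub>?E\<^esub>"
      using f by (auto simp: End_ring_def zero_hom_def H1 M.M.l_neg intro!: restrict_ext)
    moreover have "carrier ?E = mod_hom A M M"
      by (simp add: End_ring_def)
    ultimately show "\<exists>g\<in>carrier ?E. g \<oplus>\<^bsub>?E\<^esub> f = \<zero>\<^bsub>?E\<^esub>"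
      by blast
  qed
  have mon: "monoid ?E"
  proof (rule monoidI)
    fix f g assume "f \<in> carrier ?E" "g \<in> carrier ?E"
    then show "f \<otimes>\<^bsub>?E\<^esub> g \<in> carrier ?E"
      by (auto simp: End_ring_def mod_hom_def compose_def PiE_iff)
  next
    show "\<one>\<^bsub>?E\<^esub> \<in> carrier ?E"
      by (auto simp: End_ring_def mod_hom_def)
  next
    fix f g h assume "f \<in> carrier ?E" "g \<in> carrier ?E" "h \<in> carrier ?E"
    then show "f \<otimes>\<^bsub>?E\<^esub> g \<otimes>\<^bsub>?E\<^esub> h = f \<otimes>\<^bsub>?E\<^esub> (g \<otimes>\<^bsub>?E\<^esub> h)"
      by (auto simp: End_ring_def compose_def H1 intro!: restrict_ext)
  next
    fix f assume "f \<in> carrier ?E"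
    then show "\<one>\<^bsub>?E\<^esub> \<otimes>\<^bsub>?E\<^esub> f = f" "f \<otimes>\<^bsub>?E\<^esub> \<one>\<^bsub>?E\<^esub> = f"
      by (auto simp: End_ring_def compose_def H1 E fun_eq_iff restrict_def)
  qed
  show ?thesis
  proof (rule ring.intro[OF grp mon], rule ring_axioms.intro)
    fix f g h assume "f \<in> carrier ?E" "g \<in> carrier ?E" "h \<in> carrier ?E"
    then show "(f \<oplus>\<^bsub>?E\<^esub> g) \<otimes>\<^bsub>?E\<^esub> h = f \<otimes>\<^bsub>?E\<^esub> h \<oplus>\<^bsub>?E\<^esub> g \<otimes>\<^bsub>?E\<^esub> h"
      "h \<otimes>\<^bsub>?E\<^esub> (f \<oplus>\<^bsub>?E\<^esub> g) = h \<otimes>\<^bsub>?E\<^esub> f \<oplus>\<^bsub>?E\<^esub> h \<otimes>\<^bsub>?E\<^esub> g"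
      by (auto simp: End_ring_def compose_def H1 H2 intro!: restrict_ext)
  qed
qed

lemma torsion_classD:
  assumes "torsion_class k A T"
  shows "\<lbrakk>M \<in> T; N \<in> mod_cat k A; isomorphic A M N\<rbrakk> \<Longrightarrow> N \<in> T"
    and "\<lbrakk>M \<in> T; N \<in> mod_cat k A; g \<in> mod_hom A M N; g ` carrier M = carrier N\<rbrakk> \<Longrightarrow> N \<in> T"
    and "\<lbrakk>L \<in> T; N \<in> T; M \<in> mod_cat k A; short_exact A L M N f h\<rbrakk> \<Longrightarrow> M \<in> T"
proof -
  have T: "\<forall>M\<in>T. \<forall>N\<in>mod_cat k A. isomorphic A M N \<longrightarrow> N \<in> T"
    "\<forall>M\<in>T. \<forall>N\<in>mod_cat k A. (\<exists>g\<in>mod_hom A M N. g ` carrier M = carrier N) \<longrightarrow> N \<in> T"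
    "\<forall>L\<in>T. \<forall>N\<in>T. \<forall>M\<in>mod_cat k A. (\<exists>f g. short_exact A L M N f g) \<longrightarrow> M \<in> T"
    by (fact assms[unfolded torsion_class_def, THEN conjunct2, THEN conjunct2, THEN conjunct1]
          assms[unfolded torsion_class_def, THEN conjunct2, THEN conjunct2, THEN conjunct2, THEN conjunct1]
          assms[unfolded torsion_class_def, THEN conjunct2, THEN conjunct2, THEN conjunct2, THEN conjunct2])+
  show "\<lbrakk>M \<in> T; N \<in> mod_cat k A; isomorphic A M N\<rbrakk> \<Longrightarrow> N \<in> T"
    by (rule T(1)[rule_format])
  show "\<lbrakk>M \<in> T; N \<in> mod_cat k A; g \<in> mod_hom A M N; g ` carrier M = carrier N\<rbrakk> \<Longrightarrow> N \<in> T"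
    by (rule T(2)[rule_format, OF _ _ bexI])
  show "\<lbrakk>L \<in> T; N \<in> T; M \<in> mod_cat k A; short_exact A L M N f h\<rbrakk> \<Longrightarrow> M \<in> T"
    by (rule T(3)[rule_format, OF _ _ _ exI[of _ f, OF exI[of _ h]]])
qed

lemma torsion_classI:
  assumes "T \<noteq> {}" and "T \<subseteq> mod_cat k A"
    and "\<And>M N. \<lbrakk>M \<in> T; N \<in> mod_cat k A; isomorphic A M N\<rbrakk> \<Longrightarrow> N \<in> T"
    and "\<And>M N g. \<lbrakk>M \<in> T; N \<in> mod_cat k A; g \<in> mod_hom A M N; g ` carrier M = carrier N\<rbrakk> \<Longrightarrow> N \<in> T"
    and "\<And>L N M f g. \<lbrakk>L \<in> T; N \<in> T; M \<in> mod_cat k A; short_exact A L M N f g\<rbrakk> \<Longrightarrow> M \<in> T"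
  shows "torsion_class k A T"
  unfolding torsion_class_def
proof (intro conjI ballI impI)
  show "N \<in> T" if "M \<in> T" "N \<in> mod_cat k A" "isomorphic A M N" for M N
    using that by (rule assms(3))
  show "N \<in> T" if "M \<in> T" "N \<in> mod_cat k A" "\<exists>g\<in>mod_hom A M N. g ` carrier M = carrier N" for M N
  proof -
    from that(3) obtain g where "g \<in> mod_hom A M N" "g ` carrier M = carrier N" ..
    then show ?thesis by (rule assms(4)[OF that(1,2)])
  qed
  show "M \<in> T" if "L \<in> T" "N \<in> T" "M \<in> mod_cat k A" "\<exists>f g. short_exact A L M N f g" for L N M
  proof -
    from that(4) obtain f g where "short_exact A L M N f g" by (elim exE)
    then show ?thesis by (rule assms(5)[OF that(1-3)])
  qed
qed (fact assms(1,2))+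

lemma zero_module_exists:
  assumes "ring A"
  shows "\<exists>Z \<in> mod_cat k A. carrier Z = {\<zero>\<^bsub>Z\<^esub>}"
proof -
  interpret A: ring A by fact
  define Z :: "('a, nat \<Rightarrow> 'b) module" where
    "Z = \<lparr>carrier = {undefined}, mult = undefined, one = undefined, zero = undefined,
          add = (\<lambda>_ _. undefined), smult = (\<lambda>_ _. undefined)\<rparr>"
  have grp: "abelian_group Z"
    by (rule abelian_groupI) (auto simp: Z_def)
  have "left_module A Z"
    by (intro left_module.intro left_module_axioms.intro grp A.ring_axioms) (auto simp: Z_def)
  moreover have "fin_dim k (restrict_scalars A Z)"
    unfolding fin_dim_def finsum_restrict_scalars
    by (rule exI[of _ "{}"]) (simp add: restrict_scalars_def Z_def finsum_def finprod_def)
  ultimately have "Z \<in> mod_cat k A"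
    by (simp add: mod_cat_def fin_dim_module_def)
  moreover have "carrier Z = {\<zero>\<^bsub>Z\<^esub>}"
    by (simp add: Z_def)
  ultimately show ?thesis by blast
qed

theorem tors_complete_lattice:
  assumes "ring A"
  shows "complete_lattice (tors k A)"
proof -
  obtain Z where Z: "Z \<in> mod_cat k A" "carrier Z = {\<zero>\<^bsub>Z\<^esub>}"
    using zero_module_exists[OF assms] by blast
  have lmZ: "left_module A Z"
    using Z(1) by (simp add: mod_cat_def fin_dim_module_def)
  interpret Z: left_module A Z by fact
  have Z_in: "Z \<in> T" if "torsion_class k A T" for T
  proof -
    obtain M where M: "M \<in> T" "M \<in> mod_cat k A"
      using \<open>torsion_class k A T\<close> unfolding torsion_class_def by blast
    then interpret M: left_module A M
      by (simp add: mod_cat_def fin_dim_module_def)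
    have "zero_hom M Z \<in> mod_hom A M Z" "zero_hom M Z ` carrier M = carrier Z"
      using Z(2) by (auto simp: mod_hom_def zero_hom_def)
    then show ?thesis
      using \<open>torsion_class k A T\<close> M Z(1) unfolding torsion_class_def by blast
  qed
  interpret partial_order "tors k A"
    by unfold_locales (auto simp: tors_def)
  show ?thesis
  proof (rule complete_lattice_criterion1)
    have "torsion_class k A (mod_cat k A)"
      using Z(1) unfolding torsion_class_def by blast
    moreover have "T \<subseteq> mod_cat k A" if "torsion_class k A T" for T
      using that unfolding torsion_class_def by blast
    ultimately have "greatest (tors k A) (mod_cat k A) (carrier (tors k A))"
      by (auto simp: greatest_def tors_def)
    then show "\<exists>g. greatest (tors k A) g (carrier (tors k A))" ..
  next
    fix \<T> assume T: "\<T> \<subseteq> carrier (tors k A)" "\<T> \<noteq> {}"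
    then have tc: "torsion_class k A T" if "T \<in> \<T>" for T
      using that by (auto simp: tors_def)
    have "Z \<in> \<Inter>\<T>"
      using tc Z_in by blast
    then have "\<Inter>\<T> \<noteq> {}" by blast
    moreover have "\<Inter>\<T> \<subseteq> mod_cat k A"
      using tc T(2) unfolding torsion_class_def by blast
    moreover have "N \<in> \<Inter>\<T>"
      if "M \<in> \<Inter>\<T>" "N \<in> mod_cat k A" "isomorphic A M N" for M N
    proof
      fix T assume "T \<in> \<T>"
      with that(1) show "N \<in> T"
        by (intro torsion_classD(1)[OF tc _ that(2,3)]) auto
    qed
    moreover have "N \<in> \<Inter>\<T>"
      if "M \<in> \<Inter>\<T>" "N \<in> mod_cat k A" "g \<in> mod_hom A M N" "g ` carrier M = carrier N" for M N g
    proof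
      fix T assume "T \<in> \<T>"
      with that(1) show "N \<in> T"
        by (intro torsion_classD(2)[OF tc _ that(2-4)]) auto
    qed
    moreover have "M \<in> \<Inter>\<T>"
      if "L \<in> \<Inter>\<T>" "N \<in> \<Inter>\<T>" "M \<in> mod_cat k A" "short_exact A L M N f g" for L M N f g
    proof
      fix T assume "T \<in> \<T>"
      with that(1,2) show "M \<in> T"
        by (intro torsion_classD(3)[OF tc _ _ that(3,4)]) auto
    qed
    ultimately have "torsion_class k A (\<Inter>\<T>)"
      by (rule torsion_classI)
    then have "greatest (tors k A) (\<Inter>\<T>) (Lower (tors k A) \<T>)"
      using T by (auto simp: greatest_def Lower_def tors_def)
    then show "\<exists>i. greatest (tors k A) i (Lower (tors k A) \<T>)" ..
  qed
qed

end

theory Submission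
  imports Defs
begin

text \<open>
  The four conditions all express that the relation ``\<open>X \<noteq> Y\<close> and \<open>Hom(X, Y) \<noteq> 0\<close>'' on
  isomorphism classes of bricks is acyclic.  For brick-directedness and for the brick quiver this is
  nearly the definition: a nonzero map between isomorphic bricks is invertible, so the maps of a
  brick-cycle connect non-isomorphic bricks.  For the two lattice conditions the link is the notion
  of a brick-splitting torsion class: a torsion class \<open>T\<close> such that every brick \<open>B\<close> lies in \<open>T\<close> or
  satisfies \<open>Hom(T, B) = 0\<close>.

  Everything about the lattice rests on one fact (\<open>separating_brick\<close>): if torsion classes satisfy
  \<open>\<not> S \<subseteq> T\<close>, then some brick \<open>B\<close> lies in \<open>S\<close> and satisfies \<open>Hom(T, B) = 0\<close>.  Such a brick is any
  module of least dimension in \<open>S\<close> but not in \<open>T\<close>.  Hence torsion classes are determined by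
  their bricks, and for a brick \<open>B\<close> the smallest torsion class \<open>T(B)\<close> containing \<open>B\<close> and the class
  \<open>P(B)\<close> of all \<open>M\<close> with \<open>Hom(M, B) = 0\<close> are the completely join-irreducible and completely
  meet-irreducible elements, with \<open>\<kappa>(T(B)) = P(B)\<close>.

  A torsion class is left modular iff it is brick-splitting.  If \<open>x\<close> is left modular and \<open>B \<notin> x\<close>, the
  modular law for the cover \<open>T(B)\<^sub>* < T(B)\<close> gives \<open>(T(B)\<^sub>* \<squnion> x) \<sqinter> T(B) = T(B)\<^sub>*\<close>, that is,
  \<open>x \<subseteq> \<kappa>(T(B))\<close>.  Conversely, a brick separating the two sides of the modular law could be neither in
  \<open>x\<close> nor orthogonal to it.  Likewise, the first clause of extremality says that the members of the
  chain are brick-splitting.  So both lattice conditions ask for a maximal chain of brick-splitting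
  torsion classes (the remaining clause of extremality being then automatic), and what remains is
  that such a chain exists iff the relation on bricks is acyclic.

  If the relation is acyclic, brick-splitting torsion classes correspond to sets of bricks closed
  under nonzero maps; between two such sets that differ by two non-isomorphic bricks there is a
  third one, so a chain that is maximal among brick-splitting classes is maximal among all torsion
  classes (\<open>splitting_maximal_chain_exists\<close>).  Conversely, members of a chain of brick-splitting
  classes contain all bricks of a cycle or none.  Two bricks \<open>X\<close> and \<open>Y\<close> that a maximal chain does not
  separate admit surjections \<open>X \<rightarrow> Y\<close> and \<open>Y \<rightarrow> X\<close>, and are therefore isomorphic
  (\<open>maximal_splitting_chain_separates\<close>, \<open>bricks_isomorphic_of_surj\<close>).
\<close>

section \<open>Homomorphisms, submodules and quotients\<close>

lemma (in abelian_group) minus_zero_iff: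
  "\<lbrakk>x \<in> carrier G; y \<in> carrier G\<rbrakk> \<Longrightarrow> x \<ominus> y = \<zero> \<longleftrightarrow> x = y"
  by (metis a_minus_def add.inv_closed minus_equality minus_minus r_neg)

lemma (in left_module) zero_smult: "x \<in> carrier M \<Longrightarrow> \<zero> \<odot>\<^bsub>M\<^esub> x = \<zero>\<^bsub>M\<^esub>"
  by (metis M.add.r_cancel_one' R.l_zero R.zero_closed smult_closed smult_l_distr)

lemma (in left_module) minus_eq_smult: "x \<in> carrier M \<Longrightarrow> \<ominus>\<^bsub>M\<^esub> x = (\<ominus> \<one>) \<odot>\<^bsub>M\<^esub> x"
proof -
  assume x: "x \<in> carrier M"
  have "(\<ominus> \<one>) \<odot>\<^bsub>M\<^esub> x \<oplus>\<^bsub>M\<^esub> x = ((\<ominus> \<one>) \<oplus> \<one>) \<odot>\<^bsub>M\<^esub> x"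
    using x by (simp add: smult_l_distr)
  also have "\<dots> = \<zero>\<^bsub>M\<^esub>"
    using x by (simp add: R.l_neg zero_smult)
  finally show ?thesis
    using x by (simp add: M.minus_equality)
qed

lemma mod_hom_closed: "\<lbrakk>f \<in> mod_hom A M N; x \<in> carrier M\<rbrakk> \<Longrightarrow> f x \<in> carrier N"
  by (auto simp: mod_hom_def)

lemma mod_hom_add:
  "\<lbrakk>f \<in> mod_hom A M N; x \<in> carrier M; y \<in> carrier M\<rbrakk> \<Longrightarrow> f (x \<oplus>\<^bsub>M\<^esub> y) = f x \<oplus>\<^bsub>N\<^esub> f y"
  by (auto simp: mod_hom_def)

lemma mod_hom_smult:
  "\<lbrakk>f \<in> mod_hom A M N; a \<in> carrier A; x \<in> carrier M\<rbrakk> \<Longrightarrow> f (a \<odot>\<^bsub>M\<^esub> x) = a \<odot>\<^bsub>N\<^esub> f x"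
  by (auto simp: mod_hom_def)

lemma mod_hom_minus:
  assumes "left_module A M" "left_module A N" "f \<in> mod_hom A M N" "x \<in> carrier M"
  shows "f (\<ominus>\<^bsub>M\<^esub> x) = \<ominus>\<^bsub>N\<^esub> f x"
proof -
  interpret M: left_module A M by fact
  interpret N: left_module A N by fact
  show ?thesis
    using assms(3,4) M.minus_eq_smult[of x] N.minus_eq_smult[of "f x"]
    by (simp add: mod_hom_smult mod_hom_closed)
qed

lemma mod_hom_eq_iff:
  assumes "left_module A M" "left_module A N" "f \<in> mod_hom A M N" "x \<in> carrier M" "y \<in> carrier M"
  shows "f x = f y \<longleftrightarrow> f (x \<ominus>\<^bsub>M\<^esub> y) = \<zero>\<^bsub>N\<^esub>"
proof -
  interpret M: left_module A M by fact
  interpret N: left_module A N by fact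
  have "f (x \<ominus>\<^bsub>M\<^esub> y) = f x \<ominus>\<^bsub>N\<^esub> f y"
    using assms by (simp add: a_minus_def mod_hom_add mod_hom_minus)
  then show ?thesis
    using assms by (simp add: mod_hom_closed N.M.minus_zero_iff)
qed

lemma mod_hom_inj_on_iff:
  assumes "left_module A M" "left_module A N" "f \<in> mod_hom A M N"
  shows "inj_on f (carrier M) \<longleftrightarrow> (\<forall>x\<in>carrier M. f x = \<zero>\<^bsub>N\<^esub> \<longrightarrow> x = \<zero>\<^bsub>M\<^esub>)"
proof -
  interpret M: left_module A M by fact
  show ?thesis
  proof
    assume "inj_on f (carrier M)"
    then show "\<forall>x\<in>carrier M. f x = \<zero>\<^bsub>N\<^esub> \<longrightarrow> x = \<zero>\<^bsub>M\<^esub>"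
      using mod_hom_zero[OF assms] by (metis M.M.zero_closed inj_onD)
  next
    assume "\<forall>x\<in>carrier M. f x = \<zero>\<^bsub>N\<^esub> \<longrightarrow> x = \<zero>\<^bsub>M\<^esub>"
    then show "inj_on f (carrier M)"
      using mod_hom_eq_iff[OF assms] by (intro inj_onI) (metis M.M.minus_closed M.M.minus_zero_iff)
  qed
qed

lemma eq_zero_hom_iff:
  "f \<in> mod_hom A M N \<Longrightarrow> f = zero_hom M N \<longleftrightarrow> (\<forall>x\<in>carrier M. f x = \<zero>\<^bsub>N\<^esub>)"
  by (auto simp: mod_hom_def zero_hom_def fun_eq_iff PiE_iff extensional_def)

lemma zero_hom_mod_hom:
  assumes "left_module A M" "left_module A N"
  shows "zero_hom M N \<in> mod_hom A M N"
proof -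
  interpret M: left_module A M by fact
  interpret N: left_module A N by fact
  show ?thesis by (auto simp: mod_hom_def zero_hom_def)
qed

lemma identity_mod_hom:
  assumes "left_module A M"
  shows "(\<lambda>x\<in>carrier M. x) \<in> mod_hom A M M"
proof -
  interpret M: left_module A M by fact
  show ?thesis by (auto simp: mod_hom_def)
qed

lemma compose_mod_hom:
  assumes "left_module A M" "f \<in> mod_hom A M N" "g \<in> mod_hom A N P"
  shows "compose (carrier M) g f \<in> mod_hom A M P"
proof -
  interpret M: left_module A M by fact
  show ?thesis
    using assms(2,3) by (auto simp: mod_hom_def compose_def PiE_iff)
qed

text \<open>
  A choice of preimages under \<open>q\<close> defines the factorisation; the kernel condition makes the choice
  irrelevant, which is also why the result is a homomorphism.
\<close>

lemma mod_hom_factor: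
  assumes M: "left_module A M" and N: "left_module A N" and P: "left_module A P"
    and q: "q \<in> mod_hom A M N" "q ` carrier M = carrier N"
    and f: "f \<in> mod_hom A M P"
    and ker: "\<And>x. \<lbrakk>x \<in> carrier M; q x = \<zero>\<^bsub>N\<^esub>\<rbrakk> \<Longrightarrow> f x = \<zero>\<^bsub>P\<^esub>"
  obtains h where "h \<in> mod_hom A N P" "\<And>x. x \<in> carrier M \<Longrightarrow> h (q x) = f x"
proof -
  interpret M: left_module A M by fact
  interpret N: left_module A N by fact
  define h where "h = (\<lambda>y\<in>carrier N. f (inv_into (carrier M) q y))"
  have h: "h (q x) = f x" if x: "x \<in> carrier M" for x
  proof -
    let ?y = "inv_into (carrier M) q (q x)"
    have y: "?y \<in> carrier M" "q ?y = q x"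
      using x by (auto intro: inv_into_into f_inv_into_f)
    then have "f ?y = f x"
      using mod_hom_eq_iff[OF M N q(1) y(1) x] mod_hom_eq_iff[OF M P f y(1) x] ker x
      by simp
    then show ?thesis
      using x q by (auto simp: h_def)
  qed
  have "h \<in> mod_hom A N P"
    unfolding mod_hom_def mem_Collect_eq
  proof (intro conjI ballI)
    have "inv_into (carrier M) q y \<in> carrier M" if "y \<in> carrier N" for y
      using that q(2) by (simp add: inv_into_into)
    then show "h \<in> carrier N \<rightarrow>\<^sub>E carrier P"
      using f by (auto simp: mod_hom_closed h_def)
  next
    fix u v assume "u \<in> carrier N" "v \<in> carrier N"
    then obtain x y where xy: "x \<in> carrier M" "y \<in> carrier M" "u = q x" "v = q y"
      using q(2) by blast
    have "h (q (x \<oplus>\<^bsub>M\<^esub> y)) = f x \<oplus>\<^bsub>P\<^esub> f y"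
      using xy f by (simp add: h mod_hom_add)
    then show "h (u \<oplus>\<^bsub>N\<^esub> v) = h u \<oplus>\<^bsub>P\<^esub> h v"
      using xy q(1) by (simp add: h mod_hom_add)
  next
    fix a u assume a: "a \<in> carrier A" and "u \<in> carrier N"
    then obtain x where x: "x \<in> carrier M" "u = q x"
      using q(2) by blast
    have "h (q (a \<odot>\<^bsub>M\<^esub> x)) = a \<odot>\<^bsub>P\<^esub> f x"
      using x a f by (simp add: h mod_hom_smult)
    then show "h (a \<odot>\<^bsub>N\<^esub> u) = a \<odot>\<^bsub>P\<^esub> h u"
      using x q(1) a by (simp add: h mod_hom_smult)
  qed
  with h show thesis by (rule that[rotated])
qed

text \<open>
  Factor the identity through \<open>f\<close>.
\<close>

lemma mod_iso_inverse:
  assumes M: "left_module A M" and N: "left_module A N" and f: "f \<in> mod_iso A M N"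
  obtains g where "g \<in> mod_iso A N M" "\<And>x. x \<in> carrier M \<Longrightarrow> g (f x) = x"
    "\<And>y. y \<in> carrier N \<Longrightarrow> f (g y) = y"
proof -
  have fh: "f \<in> mod_hom A M N" and im: "f ` carrier M = carrier N" and inj: "inj_on f (carrier M)"
    using f by (auto simp: mod_iso_def bij_betw_def)
  have ker: "(\<lambda>x\<in>carrier M. x) x = \<zero>\<^bsub>M\<^esub>" if "x \<in> carrier M" "f x = \<zero>\<^bsub>N\<^esub>" for x
    using that mod_hom_inj_on_iff[OF M N fh] inj by simp
  obtain g where g: "g \<in> mod_hom A N M" "\<And>x. x \<in> carrier M \<Longrightarrow> g (f x) = (\<lambda>x\<in>carrier M. x) x"
    using mod_hom_factor[OF M N M fh im identity_mod_hom[OF M] ker] by blast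
  then have gf: "\<And>x. x \<in> carrier M \<Longrightarrow> g (f x) = x" by simp
  have fg: "f (g y) = y" if "y \<in> carrier N" for y
    using that gf im by force
  have "bij_betw g (carrier N) (carrier M)"
    using gf fg g(1) fh by (intro bij_betw_byWitness[where f' = f]) (auto simp: mod_hom_closed)
  then show thesis
    using that g(1) gf fg by (simp add: mod_iso_def)
qed

lemma compose_mod_iso:
  assumes "left_module A M" "f \<in> mod_iso A M N" "g \<in> mod_iso A N P"
  shows "compose (carrier M) g f \<in> mod_iso A M P"
  using assms by (auto simp: mod_iso_def intro: compose_mod_hom bij_betw_compose)

lemma isomorphic_refl: "left_module A M \<Longrightarrow> isomorphic A M M"
  using identity_mod_hom[of A M]
  by (auto simp: isomorphic_def mod_iso_def bij_betw_def inj_on_def intro!: exI[of _ "\<lambda>x\<in>carrier M. x"])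

lemma isomorphic_sym: "\<lbrakk>left_module A M; left_module A N; isomorphic A M N\<rbrakk> \<Longrightarrow> isomorphic A N M"
  using mod_iso_inverse[of A M N] unfolding isomorphic_def by blast

lemma isomorphic_trans:
  "\<lbrakk>left_module A M; isomorphic A M N; isomorphic A N P\<rbrakk> \<Longrightarrow> isomorphic A M P"
  using compose_mod_iso[of A M] unfolding isomorphic_def by blast

text \<open>
  Closure under negatives follows by acting with \<open>- 1\<close>.
\<close>

definition submodule_of ::
  "('a, 'r) ring_scheme \<Rightarrow> ('a, 'm, 's) module_scheme \<Rightarrow> 'm set \<Rightarrow> bool" where
  "submodule_of A M I \<longleftrightarrow> I \<subseteq> carrier M \<and> \<zero>\<^bsub>M\<^esub> \<in> I \<and>
    (\<forall>x\<in>I. \<forall>y\<in>I. x \<oplus>\<^bsub>M\<^esub> y \<in> I) \<and> (\<forall>a\<in>carrier A. \<forall>x\<in>I. a \<odot>\<^bsub>M\<^esub> x \<in> I)"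

lemma submodule_ofD:
  assumes "submodule_of A M I"
  shows "x \<in> I \<Longrightarrow> x \<in> carrier M" "\<zero>\<^bsub>M\<^esub> \<in> I"
    "\<lbrakk>x \<in> I; y \<in> I\<rbrakk> \<Longrightarrow> x \<oplus>\<^bsub>M\<^esub> y \<in> I" "\<lbrakk>a \<in> carrier A; x \<in> I\<rbrakk> \<Longrightarrow> a \<odot>\<^bsub>M\<^esub> x \<in> I"
  using assms by (auto simp: submodule_of_def)

lemma submodule_of_minus:
  assumes "left_module A M" "submodule_of A M I" "x \<in> I"
  shows "\<ominus>\<^bsub>M\<^esub> x \<in> I"
proof -
  interpret M: left_module A M by fact
  show ?thesis
    using assms(3) submodule_ofD[OF assms(2)] by (simp add: M.minus_eq_smult)
qed

lemma carrier_submodule: "left_module A M \<Longrightarrow> submodule_of A M (carrier M)"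
proof -
  assume "left_module A M"
  then interpret M: left_module A M .
  show ?thesis by (auto simp: submodule_of_def)
qed

lemma zero_submodule: "left_module A M \<Longrightarrow> submodule_of A M {\<zero>\<^bsub>M\<^esub>}"
proof -
  assume "left_module A M"
  then interpret M: left_module A M .
  show ?thesis by (auto simp: submodule_of_def)
qed

lemma kernel_submodule:
  assumes "left_module A M" "left_module A N" "f \<in> mod_hom A M N"
  shows "submodule_of A M {x \<in> carrier M. f x = \<zero>\<^bsub>N\<^esub>}"
proof -
  interpret M: left_module A M by fact
  interpret N: left_module A N by fact
  show ?thesis
    using assms mod_hom_zero[OF assms] by (auto simp: submodule_of_def mod_hom_add mod_hom_smult)
qed

lemma image_submodule:
  assumes "left_module A M" "left_module A N" "f \<in> mod_hom A M N" "submodule_of A M I"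
  shows "submodule_of A N (f ` I)"
proof -
  interpret M: left_module A M by fact
  interpret N: left_module A N by fact
  note I = submodule_ofD[OF assms(4)]
  show ?thesis
    unfolding submodule_of_def
  proof (intro conjI ballI)
    show "f ` I \<subseteq> carrier N"
      using I assms(3) by (auto simp: mod_hom_closed)
    show "\<zero>\<^bsub>N\<^esub> \<in> f ` I"
      using I(2) mod_hom_zero[OF assms(1-3)] by (metis image_eqI)
  next
    fix u v assume "u \<in> f ` I" "v \<in> f ` I"
    then obtain x y where "x \<in> I" "y \<in> I" "u = f x" "v = f y" by blast
    then show "u \<oplus>\<^bsub>N\<^esub> v \<in> f ` I"
      using I assms(3) by (auto simp: mod_hom_add intro!: image_eqI[of _ _ "x \<oplus>\<^bsub>M\<^esub> y"])
  next
    fix a u assume "a \<in> carrier A" "u \<in> f ` I"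
    then obtain x where "a \<in> carrier A" "x \<in> I" "u = f x" by blast
    then show "a \<odot>\<^bsub>N\<^esub> u \<in> f ` I"
      using I assms(3) by (auto simp: mod_hom_smult intro!: image_eqI[of _ _ "a \<odot>\<^bsub>M\<^esub> x"])
  qed
qed

lemma submodule_left_module:
  assumes "left_module A M" "submodule_of A M I"
  shows "left_module A (M\<lparr>carrier := I\<rparr>)"
proof -
  interpret M: left_module A M by fact
  note I = submodule_ofD[OF assms(2)]
  have grp: "abelian_group (M\<lparr>carrier := I\<rparr>)"
  proof (rule abelian_groupI)
    fix x assume "x \<in> carrier (M\<lparr>carrier := I\<rparr>)"
    then show "\<exists>y\<in>carrier (M\<lparr>carrier := I\<rparr>). y \<oplus>\<^bsub>M\<lparr>carrier := I\<rparr>\<^esub> x = \<zero>\<^bsub>M\<lparr>carrier := I\<rparr>\<^esub>"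
      using submodule_of_minus[OF assms, of x] I by (auto simp: M.M.l_neg intro!: bexI[of _ "\<ominus>\<^bsub>M\<^esub> x"])
  qed (use I in \<open>auto simp: M.M.a_ac\<close>)
  show ?thesis
    by (intro left_module.intro left_module_axioms.intro grp M.R.ring_axioms)
       (use I in \<open>auto simp: M.smult_l_distr M.smult_r_distr M.smult_assoc1\<close>)
qed

text \<open>
  The quotient is realised on a set of coset representatives, so that its elements have the same
  type as those of \<open>M\<close>; a quotient of an object of \<open>mod_cat k A\<close> is then again one.
\<close>

lemma quotient_module_exists:
  fixes M :: "('a, 'm) module"
  assumes "left_module A M" "submodule_of A M I"
  obtains N :: "('a, 'm) module" and q where "left_module A N" "q \<in> mod_hom A M N"
    "q ` carrier M = carrier N" "{x \<in> carrier M. q x = \<zero>\<^bsub>N\<^esub>} = I"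
proof -
  interpret M: left_module A M by fact
  note I = submodule_ofD[OF assms(2)]
  note Im = submodule_of_minus[OF assms]
  define E where "E x y \<longleftrightarrow> x \<in> carrier M \<and> y \<in> carrier M \<and> x \<ominus>\<^bsub>M\<^esub> y \<in> I" for x y
  have E_refl: "E x x" if "x \<in> carrier M" for x
    using that I(2) by (simp add: E_def a_minus_def M.M.r_neg)
  have E_sym: "E y x" if "E x y" for x y
  proof -
    have xy: "x \<in> carrier M" "y \<in> carrier M" "x \<ominus>\<^bsub>M\<^esub> y \<in> I" using that by (auto simp: E_def)
    have "\<ominus>\<^bsub>M\<^esub> (x \<ominus>\<^bsub>M\<^esub> y) = y \<ominus>\<^bsub>M\<^esub> x"
      using xy by (simp add: a_minus_def M.M.minus_add M.M.a_comm)
    then show ?thesis using xy Im[OF xy(3)] by (simp add: E_def)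
  qed
  have E_trans: "E x z" if "E x y" "E y z" for x y z
  proof -
    have xy: "x \<in> carrier M" "y \<in> carrier M" "z \<in> carrier M" "x \<ominus>\<^bsub>M\<^esub> y \<in> I" "y \<ominus>\<^bsub>M\<^esub> z \<in> I"
      using that by (auto simp: E_def)
    have "(x \<ominus>\<^bsub>M\<^esub> y) \<oplus>\<^bsub>M\<^esub> (y \<ominus>\<^bsub>M\<^esub> z) = x \<ominus>\<^bsub>M\<^esub> z"
      using xy by (simp add: a_minus_def M.M.a_assoc M.M.r_neg1 M.M.r_neg2)
    then show ?thesis using xy I(3)[OF xy(4,5)] by (simp add: E_def)
  qed
  have E_add: "E (x \<oplus>\<^bsub>M\<^esub> x') (y \<oplus>\<^bsub>M\<^esub> y')" if "E x y" "E x' y'" for x y x' y'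
  proof -
    have xy: "x \<in> carrier M" "y \<in> carrier M" "x' \<in> carrier M" "y' \<in> carrier M"
      "x \<ominus>\<^bsub>M\<^esub> y \<in> I" "x' \<ominus>\<^bsub>M\<^esub> y' \<in> I"
      using that by (auto simp: E_def)
    have "(x \<ominus>\<^bsub>M\<^esub> y) \<oplus>\<^bsub>M\<^esub> (x' \<ominus>\<^bsub>M\<^esub> y') = (x \<oplus>\<^bsub>M\<^esub> x') \<ominus>\<^bsub>M\<^esub> (y \<oplus>\<^bsub>M\<^esub> y')"
      using xy by (simp add: a_minus_def M.M.minus_add M.M.a_ac)
    then show ?thesis using xy I(3)[OF xy(5,6)] by (simp add: E_def)
  qed
  have E_smult: "E (a \<odot>\<^bsub>M\<^esub> x) (a \<odot>\<^bsub>M\<^esub> y)" if "a \<in> carrier A" "E x y" for a x y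
  proof -
    have xy: "x \<in> carrier M" "y \<in> carrier M" "x \<ominus>\<^bsub>M\<^esub> y \<in> I"
      using that by (auto simp: E_def)
    have "a \<odot>\<^bsub>M\<^esub> (\<ominus>\<^bsub>M\<^esub> y) \<oplus>\<^bsub>M\<^esub> a \<odot>\<^bsub>M\<^esub> y = \<zero>\<^bsub>M\<^esub>"
      using that(1) xy M.smult_r_distr[of a "\<ominus>\<^bsub>M\<^esub> y" y] by (simp add: M.M.l_neg)
    then have "a \<odot>\<^bsub>M\<^esub> (\<ominus>\<^bsub>M\<^esub> y) = \<ominus>\<^bsub>M\<^esub> (a \<odot>\<^bsub>M\<^esub> y)"
      using that(1) xy by (simp add: M.M.minus_equality)
    then have "a \<odot>\<^bsub>M\<^esub> (x \<ominus>\<^bsub>M\<^esub> y) = (a \<odot>\<^bsub>M\<^esub> x) \<ominus>\<^bsub>M\<^esub> (a \<odot>\<^bsub>M\<^esub> y)"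
      using that(1) xy by (simp add: a_minus_def M.smult_r_distr)
    then show ?thesis using xy that(1) I(4)[OF that(1) xy(3)] by (simp add: E_def)
  qed
  define r where "r x = (SOME y. E x y)" for x
  have r: "E x (r x)" if "x \<in> carrier M" for x
    unfolding r_def using E_refl[OF that] by (rule someI)
  have r_closed: "r x \<in> carrier M" if "x \<in> carrier M" for x
    using r[OF that] by (simp add: E_def)
  have r_eq: "r x = r y" if "E x y" for x y
  proof -
    have "E x = E y" using that E_sym E_trans by blast
    then show ?thesis by (simp add: r_def)
  qed
  have r_iff: "r x = r y \<longleftrightarrow> E x y" if "x \<in> carrier M" "y \<in> carrier M" for x y
    using r_eq r[OF that(1)] r[OF that(2)] E_sym E_trans by metis
  define N :: "('a, 'm) module" where
    "N = \<lparr>carrier = r ` carrier M, mult = undefined, one = undefined, zero = r \<zero>\<^bsub>M\<^esub>,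
          add = (\<lambda>u v. r (u \<oplus>\<^bsub>M\<^esub> v)), smult = (\<lambda>a u. r (a \<odot>\<^bsub>M\<^esub> u))\<rparr>"
  have r_add: "r (r x \<oplus>\<^bsub>M\<^esub> r y) = r (x \<oplus>\<^bsub>M\<^esub> y)" if "x \<in> carrier M" "y \<in> carrier M" for x y
    by (rule r_eq[OF E_sym[OF E_add[OF r r]]]) fact+
  have r_smult: "r (a \<odot>\<^bsub>M\<^esub> r x) = r (a \<odot>\<^bsub>M\<^esub> x)" if "a \<in> carrier A" "x \<in> carrier M" for a x
    by (rule r_eq[OF E_sym[OF E_smult[OF _ r]]]) fact+
  have N: "carrier N = r ` carrier M" "\<zero>\<^bsub>N\<^esub> = r \<zero>\<^bsub>M\<^esub>"
    "\<And>x y. \<lbrakk>x \<in> carrier M; y \<in> carrier M\<rbrakk> \<Longrightarrow> r x \<oplus>\<^bsub>N\<^esub> r y = r (x \<oplus>\<^bsub>M\<^esub> y)"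
    "\<And>a x. \<lbrakk>a \<in> carrier A; x \<in> carrier M\<rbrakk> \<Longrightarrow> a \<odot>\<^bsub>N\<^esub> r x = r (a \<odot>\<^bsub>M\<^esub> x)"
    by (simp_all add: N_def r_add r_smult)
  have grp: "abelian_group N"
  proof (rule abelian_groupI)
    fix u assume "u \<in> carrier N"
    then obtain x where x: "x \<in> carrier M" "u = r x" by (auto simp: N)
    then have "r (\<ominus>\<^bsub>M\<^esub> x) \<oplus>\<^bsub>N\<^esub> u = \<zero>\<^bsub>N\<^esub>"
      by (simp add: N M.M.l_neg)
    then show "\<exists>v\<in>carrier N. v \<oplus>\<^bsub>N\<^esub> u = \<zero>\<^bsub>N\<^esub>"
      using x by (auto simp: N(1))
  qed (auto simp: N M.M.a_ac)
  have "left_module A N"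
    by (intro left_module.intro left_module_axioms.intro grp M.R.ring_axioms)
       (auto simp: N M.smult_l_distr M.smult_r_distr M.smult_assoc1)
  moreover have "(\<lambda>x\<in>carrier M. r x) \<in> mod_hom A M N"
    by (auto simp: mod_hom_def N)
  moreover have "(\<lambda>x\<in>carrier M. r x) ` carrier M = carrier N"
    by (auto simp: N)
  moreover have "{x \<in> carrier M. (\<lambda>x\<in>carrier M. r x) x = \<zero>\<^bsub>N\<^esub>} = I"
  proof -
    have "r x = r \<zero>\<^bsub>M\<^esub> \<longleftrightarrow> x \<in> I" if "x \<in> carrier M" for x
      using r_iff[OF that, of "\<zero>\<^bsub>M\<^esub>"] that by (simp add: E_def a_minus_def M.M.minus_equality[of "\<zero>\<^bsub>M\<^esub>"])
    then show ?thesis using I(1) by (auto simp: N)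
  qed
  ultimately show thesis by (rule that)
qed

section \<open>Finite dimension\<close>

lemma mod_cat_left_module: "M \<in> mod_cat k A \<Longrightarrow> left_module A M"
  by (simp add: mod_cat_def fin_dim_module_def)

context fin_dim_algebra
begin

abbreviation scal :: "'k \<Rightarrow> 'a" where
  "scal c \<equiv> c \<odot>\<^bsub>A\<^esub> \<one>\<^bsub>A\<^esub>"

lemma scal_mult: "\<lbrakk>c \<in> carrier k; d \<in> carrier k\<rbrakk> \<Longrightarrow> scal (c \<otimes>\<^bsub>k\<^esub> d) = scal c \<otimes>\<^bsub>A\<^esub> scal d"
  by (simp add: smult_mult_left smult_assoc1)

text \<open>
  The subspace \<open>I + k s\<^sub>1 + \<dots> + k s\<^sub>n\<close>.  Spanning over a subspace \<open>I\<close> lets a list of generators measure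
  the codimension of \<open>I\<close>, and recursion over a list, rather than a finite sum over a set, gives
  induction on the number of generators.
\<close>

primrec lin_span :: "('a, 'm) module \<Rightarrow> 'm set \<Rightarrow> 'm list \<Rightarrow> 'm set" where
  "lin_span M I [] = I"
| "lin_span M I (s # ss) =
    {scal c \<odot>\<^bsub>M\<^esub> s \<oplus>\<^bsub>M\<^esub> w | c w. c \<in> carrier k \<and> w \<in> lin_span M I ss}"

lemma lin_span_mono: "I \<subseteq> J \<Longrightarrow> lin_span M I ss \<subseteq> lin_span M J ss"
  by (induction ss) auto

lemma lin_span_mono_Cons:
  "lin_span M I ss \<subseteq> lin_span M J ts \<Longrightarrow> lin_span M I (s # ss) \<subseteq> lin_span M J (s # ts)"
  by auto

lemma lin_span_closed:
  assumes "left_module A M" "submodule_of A M I" "set ss \<subseteq> carrier M"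
  shows "lin_span M I ss \<subseteq> carrier M"
proof -
  interpret M: left_module A M by fact
  show ?thesis
    using assms(3) submodule_ofD(1)[OF assms(2)] by (induction ss) auto
qed

lemma lin_span_add:
  assumes "left_module A M" "submodule_of A M I" "set ss \<subseteq> carrier M"
    "x \<in> lin_span M I ss" "y \<in> lin_span M I ss"
  shows "x \<oplus>\<^bsub>M\<^esub> y \<in> lin_span M I ss"
  using assms(3-5)
proof (induction ss arbitrary: x y)
  case Nil
  then show ?case using submodule_ofD(3)[OF assms(2)] by simp
next
  case (Cons s ss)
  interpret M: left_module A M by fact
  obtain c w d v where cd: "c \<in> carrier k" "d \<in> carrier k" "w \<in> lin_span M I ss" "v \<in> lin_span M I ss"
    and xy: "x = scal c \<odot>\<^bsub>M\<^esub> s \<oplus>\<^bsub>M\<^esub> w" "y = scal d \<odot>\<^bsub>M\<^esub> s \<oplus>\<^bsub>M\<^esub> v"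
    using Cons.prems by auto
  have wv: "w \<in> carrier M" "v \<in> carrier M" "s \<in> carrier M"
    using lin_span_closed[OF assms(1,2)] Cons.prems(1) cd by auto
  have "x \<oplus>\<^bsub>M\<^esub> y = scal (c \<oplus>\<^bsub>k\<^esub> d) \<odot>\<^bsub>M\<^esub> s \<oplus>\<^bsub>M\<^esub> (w \<oplus>\<^bsub>M\<^esub> v)"
    unfolding xy using cd wv by (simp add: smult_l_distr M.smult_l_distr M.M.a_ac)
  moreover have "w \<oplus>\<^bsub>M\<^esub> v \<in> lin_span M I ss"
    using Cons cd by simp
  ultimately show ?case using cd by auto
qed

lemma lin_span_scal:
  assumes "left_module A M" "submodule_of A M I" "set ss \<subseteq> carrier M"
    "c \<in> carrier k" "x \<in> lin_span M I ss"
  shows "scal c \<odot>\<^bsub>M\<^esub> x \<in> lin_span M I ss"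
  using assms(3-5)
proof (induction ss arbitrary: x)
  case Nil
  then show ?case using submodule_ofD(4)[OF assms(2)] by simp
next
  case (Cons s ss)
  interpret M: left_module A M by fact
  obtain w d where d: "d \<in> carrier k" "w \<in> lin_span M I ss"
    and x: "x = scal d \<odot>\<^bsub>M\<^esub> s \<oplus>\<^bsub>M\<^esub> w"
    using Cons.prems by auto
  have w: "w \<in> carrier M" "s \<in> carrier M"
    using lin_span_closed[OF assms(1,2)] Cons.prems(1) d by auto
  have "scal c \<odot>\<^bsub>M\<^esub> x = scal (c \<otimes>\<^bsub>k\<^esub> d) \<odot>\<^bsub>M\<^esub> s \<oplus>\<^bsub>M\<^esub> scal c \<odot>\<^bsub>M\<^esub> w"
    unfolding x scal_mult[OF assms(4) d(1)]
    using d w assms(4) by (simp add: M.smult_r_distr M.smult_assoc1)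
  moreover have "scal c \<odot>\<^bsub>M\<^esub> w \<in> lin_span M I ss"
    using Cons d by simp
  ultimately show ?case using d assms(4) by auto
qed

lemma lin_span_superset:
  assumes "left_module A M" "submodule_of A M I" "set ss \<subseteq> carrier M"
  shows "I \<subseteq> lin_span M I ss"
  using assms(3)
proof (induction ss)
  case (Cons s ss)
  interpret M: left_module A M by fact
  show ?case
  proof
    fix x assume x: "x \<in> I"
    then have "x = scal \<zero>\<^bsub>k\<^esub> \<odot>\<^bsub>M\<^esub> s \<oplus>\<^bsub>M\<^esub> x"
      using Cons.prems submodule_ofD(1)[OF assms(2) x] by (simp add: M.zero_smult smult_l_null)
    moreover have "x \<in> lin_span M I ss"
      using x Cons by auto
    ultimately show "x \<in> lin_span M I (s # ss)"
      unfolding lin_span.simps by blast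
  qed
qed simp

text \<open>
  The exchange step of linear algebra: enlarging the subspace by a vector of the span makes one of the
  generators superfluous, namely the first one with a nonzero coefficient in that vector.
\<close>

lemma lin_span_exchange:
  assumes "left_module A M" "submodule_of A M I" "submodule_of A M J" "I \<subseteq> J"
    and "set ss \<subseteq> carrier M" "x \<in> J" "x \<notin> I" "x \<in> lin_span M I ss"
  shows "\<exists>ts. set ts \<subseteq> set ss \<and> length ts < length ss \<and> lin_span M I ss \<subseteq> lin_span M J ts"
  using assms(5-8)
proof (induction ss)
  case (Cons s ss)
  interpret M: left_module A M by fact
  obtain c w where c: "c \<in> carrier k" "w \<in> lin_span M I ss" and x: "x = scal c \<odot>\<^bsub>M\<^esub> s \<oplus>\<^bsub>M\<^esub> w"
    using Cons.prems by auto
  have ss: "set ss \<subseteq> carrier M" and s: "s \<in> carrier M"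
    using Cons.prems by auto
  have w: "w \<in> carrier M"
    using lin_span_closed[OF assms(1,2) ss] c by auto
  show ?case
  proof (cases "c = \<zero>\<^bsub>k\<^esub>")
    case True
    then have "x = w"
      using x w s by (simp add: M.zero_smult smult_l_null)
    then obtain ts where ts: "set ts \<subseteq> set ss" "length ts < length ss" "lin_span M I ss \<subseteq> lin_span M J ts"
      using Cons c by auto
    then show ?thesis
      using lin_span_mono_Cons[OF ts(3)] by (intro exI[of _ "s # ts"]) auto
  next
    case False
    let ?d = "inv\<^bsub>k\<^esub> c"
    have d: "?d \<in> carrier k" "?d \<otimes>\<^bsub>k\<^esub> c = \<one>\<^bsub>k\<^esub>"
      using False c(1) field_Units by auto
    note J = lin_span_add[OF assms(1,3) ss] lin_span_scal[OF assms(1,3) ss]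
    have wJ: "w \<in> lin_span M J ss"
      using c lin_span_mono[OF assms(4)] by blast
    have xJ: "x \<in> lin_span M J ss"
      using Cons.prems lin_span_superset[OF assms(1,3) ss] by blast
    have m: "\<ominus>\<^bsub>M\<^esub> w = scal (\<ominus>\<^bsub>k\<^esub> \<one>\<^bsub>k\<^esub>) \<odot>\<^bsub>M\<^esub> w"
      using w by (simp add: M.minus_eq_smult smult_l_minus)
    have "\<ominus>\<^bsub>M\<^esub> w \<in> lin_span M J ss"
      unfolding m using wJ by (intro J(2)) auto
    moreover have "x \<oplus>\<^bsub>M\<^esub> \<ominus>\<^bsub>M\<^esub> w = scal c \<odot>\<^bsub>M\<^esub> s"
      unfolding x using c s w by (simp add: M.M.a_assoc M.M.r_neg)
    ultimately have "scal c \<odot>\<^bsub>M\<^esub> s \<in> lin_span M J ss"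
      using J(1)[OF xJ] by metis
    then have "scal ?d \<odot>\<^bsub>M\<^esub> (scal c \<odot>\<^bsub>M\<^esub> s) \<in> lin_span M J ss"
      using J(2) d by blast
    moreover have "scal ?d \<odot>\<^bsub>M\<^esub> (scal c \<odot>\<^bsub>M\<^esub> s) = s"
      using scal_mult[OF d(1) c(1)] d c(1) s by (simp add: M.smult_assoc1[symmetric])
    ultimately have "s \<in> lin_span M J ss" by simp
    then have "lin_span M I (s # ss) \<subseteq> lin_span M J ss"
      using lin_span_mono[OF assms(4), of M ss] J by auto
    then show ?thesis by (intro exI[of _ ss]) auto
  qed
qed simp

lemma lin_span_image:
  assumes "left_module A M" "left_module A N" "f \<in> mod_hom A M N" "submodule_of A M I"
    "set ss \<subseteq> carrier M"
  shows "f ` lin_span M I ss = lin_span N (f ` I) (map f ss)"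
  using assms(5)
proof (induction ss)
  case (Cons s ss)
  interpret M: left_module A M by fact
  have eq: "f (scal c \<odot>\<^bsub>M\<^esub> s \<oplus>\<^bsub>M\<^esub> w) = scal c \<odot>\<^bsub>N\<^esub> f s \<oplus>\<^bsub>N\<^esub> f w"
    if "c \<in> carrier k" "w \<in> lin_span M I ss" for c w
  proof -
    have "w \<in> carrier M"
      using that Cons.prems lin_span_closed[OF assms(1,4)] by auto
    then show ?thesis
      using that assms(3) Cons.prems by (simp add: mod_hom_add mod_hom_smult)
  qed
  have IH: "f ` lin_span M I ss = lin_span N (f ` I) (map f ss)"
    using Cons by simp
  show ?case
  proof (intro equalityI subsetI)
    fix y assume "y \<in> f ` lin_span M I (s # ss)"
    then obtain c w where cw: "c \<in> carrier k" "w \<in> lin_span M I ss"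
        "y = f (scal c \<odot>\<^bsub>M\<^esub> s \<oplus>\<^bsub>M\<^esub> w)" by auto
    then show "y \<in> lin_span N (f ` I) (map f (s # ss))"
      using eq[OF cw(1,2)] IH by auto
  next
    fix y assume "y \<in> lin_span N (f ` I) (map f (s # ss))"
    then obtain c w where cw: "c \<in> carrier k" "w \<in> lin_span M I ss" "y = scal c \<odot>\<^bsub>N\<^esub> f s \<oplus>\<^bsub>N\<^esub> f w"
      using IH[symmetric] by auto
    then have "y = f (scal c \<odot>\<^bsub>M\<^esub> s \<oplus>\<^bsub>M\<^esub> w)"
      using eq by simp
    then show "y \<in> f ` lin_span M I (s # ss)"
      using cw by auto
  qed
qed simp

lemma lin_span_eq_lin_combs:
  assumes "left_module A M" "set ss \<subseteq> carrier M" "x \<in> lin_span M {\<zero>\<^bsub>M\<^esub>} ss"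
  shows "\<exists>c\<in>set ss \<rightarrow> carrier k. x = (\<Oplus>\<^bsub>M\<^esub>s\<in>set ss. scal (c s) \<odot>\<^bsub>M\<^esub> s)"
  using assms(2,3)
proof (induction ss arbitrary: x)
  case Nil
  interpret M: left_module A M by fact
  show ?case using Nil by simp
next
  case (Cons s ss)
  interpret M: left_module A M by fact
  obtain a w where a: "a \<in> carrier k" "w \<in> lin_span M {\<zero>\<^bsub>M\<^esub>} ss" and x: "x = scal a \<odot>\<^bsub>M\<^esub> s \<oplus>\<^bsub>M\<^esub> w"
    using Cons.prems by auto
  obtain c where c: "c \<in> set ss \<rightarrow> carrier k" "w = (\<Oplus>\<^bsub>M\<^esub>s\<in>set ss. scal (c s) \<odot>\<^bsub>M\<^esub> s)"
    using Cons.IH[OF _ a(2)] Cons.prems(1) by auto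
  have s: "s \<in> carrier M" and ss: "set ss \<subseteq> carrier M"
    using Cons.prems by auto
  define b where "b = (if s \<in> set ss then c s else \<zero>\<^bsub>k\<^esub>)"
  let ?R = "\<Oplus>\<^bsub>M\<^esub>t\<in>set ss - {s}. scal (c t) \<odot>\<^bsub>M\<^esub> t"
  have b: "b \<in> carrier k" using c(1) by (auto simp: b_def)
  have terms: "scal (c t) \<odot>\<^bsub>M\<^esub> t \<in> carrier M" if "t \<in> set ss" for t
    using c(1) ss that by auto
  then have R: "?R \<in> carrier M"
    by (intro M.M.finsum_closed) auto
  have w: "w = scal b \<odot>\<^bsub>M\<^esub> s \<oplus>\<^bsub>M\<^esub> ?R"
  proof (cases "s \<in> set ss")
    case True
    then have "set ss = insert s (set ss - {s})" by blast
    then have "w = (\<Oplus>\<^bsub>M\<^esub>t\<in>insert s (set ss - {s}). scal (c t) \<odot>\<^bsub>M\<^esub> t)"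
      using c(2) by simp
    also have "\<dots> = scal (c s) \<odot>\<^bsub>M\<^esub> s \<oplus>\<^bsub>M\<^esub> ?R"
      using terms True by (intro M.M.finsum_insert) auto
    finally show ?thesis using True by (simp add: b_def)
  next
    case False
    then show ?thesis
      using c s R by (simp add: b_def smult_l_null M.zero_smult)
  qed
  let ?d = "c(s := a \<oplus>\<^bsub>k\<^esub> b)"
  have "(\<Oplus>\<^bsub>M\<^esub>t\<in>insert s (set ss - {s}). scal (?d t) \<odot>\<^bsub>M\<^esub> t)
      = scal (?d s) \<odot>\<^bsub>M\<^esub> s \<oplus>\<^bsub>M\<^esub> (\<Oplus>\<^bsub>M\<^esub>t\<in>set ss - {s}. scal (?d t) \<odot>\<^bsub>M\<^esub> t)"
    using terms a b s by (intro M.M.finsum_insert) auto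
  also have "(\<Oplus>\<^bsub>M\<^esub>t\<in>set ss - {s}. scal (?d t) \<odot>\<^bsub>M\<^esub> t) = ?R"
    using terms by (intro M.M.finsum_cong') auto
  also have "scal (?d s) \<odot>\<^bsub>M\<^esub> s \<oplus>\<^bsub>M\<^esub> ?R = x"
    unfolding x w using a b s R by (simp add: smult_l_distr M.smult_l_distr M.M.a_assoc)
  finally have "x = (\<Oplus>\<^bsub>M\<^esub>t\<in>set (s # ss). scal (?d t) \<odot>\<^bsub>M\<^esub> t)"
    by (simp add: insert_Diff_single)
  moreover have "?d \<in> set (s # ss) \<rightarrow> carrier k"
    using c(1) a b by auto
  ultimately show ?case by blast
qed

text \<open>
  In this form finite generation passes along homomorphisms without any reindexing of finite sums.
\<close>

lemma fin_dim_module_iff_lin_span: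
  "fin_dim_module k A M \<longleftrightarrow> left_module A M \<and>
    (\<exists>ss. set ss \<subseteq> carrier M \<and> carrier M = lin_span M {\<zero>\<^bsub>M\<^esub>} ss)" (is "?L \<longleftrightarrow> ?R")
proof
  assume ?L
  then obtain S where M: "left_module A M" and S: "finite S" "S \<subseteq> carrier M"
    and span: "\<And>x. x \<in> carrier M \<Longrightarrow> \<exists>c\<in>S \<rightarrow> carrier k. x = (\<Oplus>\<^bsub>M\<^esub>s\<in>S. scal (c s) \<odot>\<^bsub>M\<^esub> s)"
    unfolding fin_dim_module_iff by blast
  interpret M: left_module A M by fact
  obtain ss where ss: "set ss = S" "distinct ss"
    using finite_distinct_list[OF S(1)] by blast
  have *: "(\<Oplus>\<^bsub>M\<^esub>s\<in>set ts. scal (c s) \<odot>\<^bsub>M\<^esub> s) \<in> lin_span M {\<zero>\<^bsub>M\<^esub>} ts"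
    if "distinct ts" "set ts \<subseteq> carrier M" "c \<in> set ts \<rightarrow> carrier k" for c ts
    using that
  proof (induction ts)
    case (Cons t ts)
    have "(\<Oplus>\<^bsub>M\<^esub>s\<in>set (t # ts). scal (c s) \<odot>\<^bsub>M\<^esub> s)
        = scal (c t) \<odot>\<^bsub>M\<^esub> t \<oplus>\<^bsub>M\<^esub> (\<Oplus>\<^bsub>M\<^esub>s\<in>set ts. scal (c s) \<odot>\<^bsub>M\<^esub> s)"
      unfolding list.set using Cons.prems by (intro M.M.finsum_insert) auto
    then show ?case using Cons by auto
  qed simp
  have "carrier M \<subseteq> lin_span M {\<zero>\<^bsub>M\<^esub>} ss"
    using span *[OF ss(2)] ss(1) S(2) by fastforce
  moreover have "lin_span M {\<zero>\<^bsub>M\<^esub>} ss \<subseteq> carrier M"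
    using lin_span_closed[OF M zero_submodule[OF M]] ss S by simp
  ultimately show ?R
    using M ss S by blast
next
  assume ?R
  then obtain ss where M: "left_module A M" and ss: "set ss \<subseteq> carrier M"
    "carrier M = lin_span M {\<zero>\<^bsub>M\<^esub>} ss" by blast
  have "\<exists>c\<in>set ss \<rightarrow> carrier k. x = (\<Oplus>\<^bsub>M\<^esub>s\<in>set ss. scal (c s) \<odot>\<^bsub>M\<^esub> s)" if "x \<in> carrier M" for x
    using lin_span_eq_lin_combs[OF M ss(1)] that ss(2) by blast
  then show ?L
    unfolding fin_dim_module_iff using M ss(1) by blast
qed

lemma mod_cat_surj:
  assumes "M \<in> mod_cat k A" "left_module A N" "f \<in> mod_hom A M N" "f ` carrier M = carrier N"
  shows "N \<in> mod_cat k A"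
proof -
  have M: "left_module A M" by (rule mod_cat_left_module) fact
  obtain ss where ss: "set ss \<subseteq> carrier M" "carrier M = lin_span M {\<zero>\<^bsub>M\<^esub>} ss"
    using assms(1) by (auto simp: mod_cat_def fin_dim_module_iff_lin_span)
  have "carrier N = lin_span N {\<zero>\<^bsub>N\<^esub>} (map f ss)"
    using lin_span_image[OF M assms(2,3) zero_submodule[OF M] ss(1)] ss(2) assms(4)
      mod_hom_zero[OF M assms(2,3)] by simp
  moreover have "set (map f ss) \<subseteq> carrier N"
    using ss(1) assms(3) by (auto simp: mod_hom_closed)
  ultimately show ?thesis
    using assms(2) unfolding mod_cat_def fin_dim_module_iff_lin_span by blast
qed

text \<open>
  The dimension over \<open>k\<close>.
\<close>

definition span_size :: "('a, 'm) module \<Rightarrow> nat" where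
  "span_size M = (LEAST n. \<exists>ss. length ss = n \<and> set ss \<subseteq> carrier M \<and>
    carrier M = lin_span M {\<zero>\<^bsub>M\<^esub>} ss)"

text \<open>
  By the exchange step, a spanning list of \<open>M\<close> can be shortened modulo the nonzero kernel.
\<close>

lemma span_size_quotient_less:
  assumes "M \<in> mod_cat k A" "left_module A N" "f \<in> mod_hom A M N" "f ` carrier M = carrier N"
    and "\<not> inj_on f (carrier M)"
  shows "span_size N < span_size M"
proof -
  have M: "left_module A M" by (rule mod_cat_left_module) fact
  have "\<exists>n. \<exists>ss. length ss = n \<and> set ss \<subseteq> carrier M \<and> carrier M = lin_span M {\<zero>\<^bsub>M\<^esub>} ss"
    using assms(1) by (auto simp: mod_cat_def fin_dim_module_iff_lin_span)
  from LeastI_ex[OF this] obtain ss where ss: "length ss = span_size M" "set ss \<subseteq> carrier M"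
    "carrier M = lin_span M {\<zero>\<^bsub>M\<^esub>} ss"
    unfolding span_size_def by blast
  let ?K = "{x \<in> carrier M. f x = \<zero>\<^bsub>N\<^esub>}"
  obtain x where x: "x \<in> ?K" "x \<notin> {\<zero>\<^bsub>M\<^esub>}"
    using assms(5) mod_hom_inj_on_iff[OF M assms(2,3)] by auto
  have K: "submodule_of A M ?K"
    by (rule kernel_submodule[OF M assms(2,3)])
  have "{\<zero>\<^bsub>M\<^esub>} \<subseteq> ?K"
    using submodule_ofD(2)[OF K] by simp
  then obtain ts where ts: "set ts \<subseteq> set ss" "length ts < length ss"
    "lin_span M {\<zero>\<^bsub>M\<^esub>} ss \<subseteq> lin_span M ?K ts"
    using lin_span_exchange[OF M zero_submodule[OF M] K _ ss(2) x] x ss(3) by blast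
  have t: "set ts \<subseteq> carrier M" using ts ss by blast
  have "carrier M = lin_span M ?K ts"
    using ts ss lin_span_closed[OF M K t] by blast
  moreover have "f ` ?K = {\<zero>\<^bsub>N\<^esub>}"
    using submodule_ofD(2)[OF K] by auto
  ultimately have "carrier N = lin_span N {\<zero>\<^bsub>N\<^esub>} (map f ts)"
    using lin_span_image[OF M assms(2,3) K t] assms(4) by simp
  moreover have "set (map f ts) \<subseteq> carrier N"
    using t assms(3) by (auto simp: mod_hom_closed)
  ultimately have "span_size N \<le> length ts"
    unfolding span_size_def by (intro Least_le exI[of _ "map f ts"]) auto
  then show ?thesis using ts ss by simp
qed

text \<open>
  Starting from \<open>length ss + 1\<close> steps down the chain and climbing back up, each step removes a generator,
  by the exchange step; there are not enough generators to reach the top.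
\<close>

lemma submodule_chain_bound:
  assumes M: "left_module A M" and I: "\<And>i. submodule_of A M (I i)"
    and dec: "\<And>i. I (Suc i) \<subset> I i"
    and ss: "set ss \<subseteq> carrier M" "carrier M = lin_span M {\<zero>\<^bsub>M\<^esub>} ss"
  shows False
proof -
  (* ?n steps are one more than there are generators, so that the length bound below fails at j = ?n *)
  let ?n = "Suc (length ss)"
  have "\<exists>ts. set ts \<subseteq> carrier M \<and> length ts + j \<le> length ss \<and> carrier M \<subseteq> lin_span M (I (?n - j)) ts"
    if "j \<le> ?n" for j
    using that
  proof (induction j)
    case 0
    have "{\<zero>\<^bsub>M\<^esub>} \<subseteq> I ?n" using submodule_ofD(2)[OF I] by simp
    then show ?case
      using ss lin_span_mono[of "{\<zero>\<^bsub>M\<^esub>}" "I ?n" M ss] by (intro exI[of _ ss]) auto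
  next
    case (Suc j)
    then obtain ts where ts: "set ts \<subseteq> carrier M" "length ts + j \<le> length ss"
      "carrier M \<subseteq> lin_span M (I (?n - j)) ts" by auto
    have S: "?n - j = Suc (?n - Suc j)" using Suc.prems by simp
    obtain x where x: "x \<in> I (?n - Suc j)" "x \<notin> I (?n - j)"
      using dec[of "?n - Suc j"] unfolding S[symmetric] by blast
    have "x \<in> lin_span M (I (?n - j)) ts"
      using submodule_ofD(1)[OF I x(1)] ts by blast
    moreover have "I (?n - j) \<subseteq> I (?n - Suc j)"
      using dec[of "?n - Suc j"] unfolding S[symmetric] by blast
    ultimately obtain us where "set us \<subseteq> set ts" "length us < length ts"
      "lin_span M (I (?n - j)) ts \<subseteq> lin_span M (I (?n - Suc j)) us"
      using lin_span_exchange[OF M I I _ ts(1) x] by blast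
    then show ?case using ts by (intro exI[of _ us]) auto
  qed
  from this[of ?n] show False by auto
qed

text \<open>
  Otherwise the images of the powers of \<open>f\<close> form an infinite descending chain.
\<close>

lemma injective_endomorphism_surj:
  assumes "M \<in> mod_cat k A" "f \<in> mod_hom A M M" "inj_on f (carrier M)"
  shows "f ` carrier M = carrier M"
proof (rule ccontr)
  assume ne: "f ` carrier M \<noteq> carrier M"
  have M: "left_module A M" by (rule mod_cat_left_module) fact
  obtain ss where ss: "set ss \<subseteq> carrier M" "carrier M = lin_span M {\<zero>\<^bsub>M\<^esub>} ss"
    using assms(1) by (auto simp: mod_cat_def fin_dim_module_iff_lin_span)
  define I where "I i = ((`) f ^^ i) (carrier M)" for i
  have I: "submodule_of A M (I i)" for i
    by (induction i)
       (use carrier_submodule[OF M] image_submodule[OF M M assms(2)] in \<open>simp_all add: I_def\<close>)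
  have "I (Suc i) \<subset> I i" for i
  proof (induction i)
    case 0
    have "f ` carrier M \<subseteq> carrier M" using assms(2) by (auto simp: mod_hom_closed)
    then show ?case using ne by (auto simp: I_def)
  next
    case (Suc i)
    have "I i \<subseteq> carrier M" "I (Suc i) \<subseteq> carrier M"
      using submodule_ofD(1)[OF I] by blast+
    then have "f ` I (Suc i) \<subset> f ` I i"
      using Suc assms(3) inj_on_image_eq_iff by (metis image_mono psubset_eq)
    then show ?case by (simp add: I_def)
  qed
  then show False
    by (rule submodule_chain_bound[OF M I _ ss])
qed

end

section \<open>Vanishing of homomorphisms\<close>

definition hom_zero :: "('a, 'r) ring_scheme \<Rightarrow> ('a, 'm, 's) module_scheme \<Rightarrow> ('a, 'n, 't) module_scheme \<Rightarrow> bool" where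
  "hom_zero A M N \<longleftrightarrow> (\<forall>f\<in>mod_hom A M N. \<forall>x\<in>carrier M. f x = \<zero>\<^bsub>N\<^esub>)"

lemma hom_zero_surj:
  assumes "left_module A M" "g \<in> mod_hom A M N" "g ` carrier M = carrier N" "hom_zero A M X"
  shows "hom_zero A N X"
  unfolding hom_zero_def
proof (intro ballI)
  fix f y assume f: "f \<in> mod_hom A N X" and "y \<in> carrier N"
  then obtain x where x: "x \<in> carrier M" "y = g x" using assms(3) by blast
  have "compose (carrier M) f g x = \<zero>\<^bsub>X\<^esub>"
    using compose_mod_hom[OF assms(1,2) f] assms(4) x by (auto simp: hom_zero_def)
  then show "f y = \<zero>\<^bsub>X\<^esub>" using x by (simp add: compose_eq)
qed

lemma hom_zero_isomorphic_left:
  assumes "left_module A X" "isomorphic A X Y" "hom_zero A X Z"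
  shows "hom_zero A Y Z"
proof -
  obtain h where "h \<in> mod_hom A X Y" "h ` carrier X = carrier Y"
    using assms(2) by (auto simp: isomorphic_def mod_iso_def bij_betw_def)
  then show ?thesis by (rule hom_zero_surj[OF assms(1) _ _ assms(3)])
qed

lemma hom_zero_isomorphic_right:
  assumes "left_module A X" "left_module A Y" "left_module A Z" "isomorphic A Y Z" "hom_zero A X Y"
  shows "hom_zero A X Z"
  unfolding hom_zero_def
proof (intro ballI)
  fix f x assume f: "f \<in> mod_hom A X Z" and x: "x \<in> carrier X"
  obtain h where "h \<in> mod_iso A Y Z" using assms(4) by (auto simp: isomorphic_def)
  then obtain g where g: "g \<in> mod_iso A Z Y" "\<And>z. z \<in> carrier Z \<Longrightarrow> h (g z) = z" "h \<in> mod_iso A Y Z"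
    using mod_iso_inverse[OF assms(2,3)] by metis
  have "compose (carrier X) g f \<in> mod_hom A X Y"
    using compose_mod_hom[OF assms(1) f, of g Y] g(1) by (simp add: mod_iso_def)
  then have "compose (carrier X) g f x = \<zero>\<^bsub>Y\<^esub>"
    using assms(5) x by (simp add: hom_zero_def)
  then have "g (f x) = \<zero>\<^bsub>Y\<^esub>" using x by (simp add: compose_eq)
  then have "h \<zero>\<^bsub>Y\<^esub> = f x" using g(2) mod_hom_closed[OF f x] by metis
  then show "f x = \<zero>\<^bsub>Z\<^esub>"
    using mod_hom_zero[OF assms(2,3), of h] g(3) by (simp add: mod_iso_def)
qed

lemma zero_module_hom: 
  assumes "Z \<in> mod_cat k A" "carrier Z = {\<zero>\<^bsub>Z\<^esub>}" "X \<in> mod_cat k A" "f \<in> mod_hom A Z X" "x \<in> carrier Z"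
  shows "f x = \<zero>\<^bsub>X\<^esub>"
  using assms mod_hom_zero[of A Z X f] by (auto simp: mod_cat_left_module[of _ k])

text \<open>
  Restrict \<open>f\<close> to \<open>L\<close>; if the restriction vanishes, then \<open>f\<close> factors through \<open>N\<close>.  Closure under
  extensions of all torsion classes below reduces to this dichotomy.
\<close>

lemma short_exact_hom_cases:
  assumes "left_module A L" "left_module A M" "left_module A N" "left_module A X"
    and ex: "short_exact A L M N i q" and f: "f \<in> mod_hom A M X"
  shows "(\<exists>g\<in>mod_hom A L X. (\<exists>x\<in>carrier L. g x \<noteq> \<zero>\<^bsub>X\<^esub>) \<and> g ` carrier L \<subseteq> f ` carrier M) \<or>
    (\<exists>g\<in>mod_hom A N X. g ` carrier N = f ` carrier M)"
proof (cases "\<forall>x\<in>carrier L. f (i x) = \<zero>\<^bsub>X\<^esub>")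
  case True
  have q: "q \<in> mod_hom A M N" "q ` carrier M = carrier N"
    using ex by (auto simp: short_exact_def)
  have "f x = \<zero>\<^bsub>X\<^esub>" if "x \<in> carrier M" "q x = \<zero>\<^bsub>N\<^esub>" for x
  proof -
    have "x \<in> i ` carrier L" using that ex by (auto simp: short_exact_def)
    then show ?thesis using True by auto
  qed
  then obtain h where h: "h \<in> mod_hom A N X" "\<And>x. x \<in> carrier M \<Longrightarrow> h (q x) = f x"
    using mod_hom_factor[OF assms(2-4) q f] by blast
  have "h ` carrier N = f ` carrier M"
    unfolding q(2)[symmetric] image_image using h(2) by auto
  then show ?thesis using h(1) by blast
next
  case False
  have i: "i \<in> mod_hom A L M" using ex by (auto simp: short_exact_def)
  have "compose (carrier L) f i \<in> mod_hom A L X"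
    by (rule compose_mod_hom[OF assms(1) i f])
  moreover have "compose (carrier L) f i ` carrier L \<subseteq> f ` carrier M"
    using i by (auto simp: compose_eq mod_hom_closed)
  moreover have "\<exists>x\<in>carrier L. compose (carrier L) f i x \<noteq> \<zero>\<^bsub>X\<^esub>"
    using False by (auto simp: compose_eq)
  ultimately show ?thesis by blast
qed

section \<open>Bricks\<close>

lemma brick_mod_cat: "B \<in> bricks k A \<Longrightarrow> B \<in> mod_cat k A"
  by (simp add: bricks_def)

lemma brick_left_module: "B \<in> bricks k A \<Longrightarrow> left_module A B"
  by (simp add: brick_mod_cat mod_cat_left_module[of _ k])

lemma brick_nonzero:
  assumes "B \<in> bricks k A"
  obtains x where "x \<in> carrier B" "x \<noteq> \<zero>\<^bsub>B\<^esub>"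
proof -
  interpret E: division_ring "End_ring A B" using assms by (simp add: bricks_def)
  have "\<not> (\<forall>x\<in>carrier B. x = \<zero>\<^bsub>B\<^esub>)"
    using E.one_not_zero by (auto simp: End_ring_def zero_hom_def simp del: E.one_not_zero intro: restrict_ext)
  then show thesis using that by blast
qed

lemma brick_endomorphism_bij:
  assumes "B \<in> bricks k A" "f \<in> mod_hom A B B" "x \<in> carrier B" "f x \<noteq> \<zero>\<^bsub>B\<^esub>"
  shows "bij_betw f (carrier B) (carrier B)"
proof -
  interpret E: division_ring "End_ring A B" using assms by (simp add: bricks_def)
  have "f \<noteq> zero_hom B B" using assms(2-4) eq_zero_hom_iff by blast
  then have "f \<in> Units (End_ring A B)"
    unfolding E.division_Units using assms(2) by (simp add: End_ring_def)
  then obtain g where g: "g \<in> mod_hom A B B" "compose (carrier B) g f = (\<lambda>x\<in>carrier B. x)"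
    "compose (carrier B) f g = (\<lambda>x\<in>carrier B. x)"
    by (auto simp: Units_def End_ring_def)
  have "g (f x) = x" "f (g x) = x" if "x \<in> carrier B" for x
    using fun_cong[OF g(2), of x] fun_cong[OF g(3), of x] that by (simp_all add: compose_eq)
  then show ?thesis
    using g(1) assms(2) by (intro bij_betw_byWitness[where f' = g]) (auto simp: mod_hom_closed)
qed

lemma brickI:
  assumes B: "B \<in> mod_cat k A" and x: "x \<in> carrier B" "x \<noteq> \<zero>\<^bsub>B\<^esub>"
    and bij: "\<And>f x. \<lbrakk>f \<in> mod_hom A B B; x \<in> carrier B; f x \<noteq> \<zero>\<^bsub>B\<^esub>\<rbrakk> \<Longrightarrow> bij_betw f (carrier B) (carrier B)"
  shows "B \<in> bricks k A"
proof -
  note lm = mod_cat_left_module[OF B]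
  interpret E: ring "End_ring A B" by (rule End_ring_is_ring[OF lm])
  have ne: "\<one>\<^bsub>End_ring A B\<^esub> \<noteq> \<zero>\<^bsub>End_ring A B\<^esub>"
    using x by (auto simp: End_ring_def zero_hom_def fun_eq_iff)
  have "f \<in> Units (End_ring A B)" if "f \<in> carrier (End_ring A B) - {\<zero>\<^bsub>End_ring A B\<^esub>}" for f
  proof -
    have f: "f \<in> mod_hom A B B" "f \<noteq> zero_hom B B"
      using that by (auto simp: End_ring_def)
    then have "f \<in> mod_iso A B B"
      using bij eq_zero_hom_iff[OF f(1)] by (auto simp: mod_iso_def)
    then obtain g where g: "g \<in> mod_iso A B B" "\<And>x. x \<in> carrier B \<Longrightarrow> g (f x) = x"
      "\<And>x. x \<in> carrier B \<Longrightarrow> f (g x) = x"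
      using mod_iso_inverse[OF lm lm] by blast
    then have "compose (carrier B) g f = (\<lambda>x\<in>carrier B. x)" "compose (carrier B) f g = (\<lambda>x\<in>carrier B. x)"
      "g \<in> mod_hom A B B"
      by (auto simp: compose_def mod_iso_def intro: restrict_ext)
    then show ?thesis
      using f(1) unfolding Units_def End_ring_def by auto
  qed
  moreover have "Units (End_ring A B) \<subseteq> carrier (End_ring A B) - {\<zero>\<^bsub>End_ring A B\<^esub>}"
    using ne by (auto simp: Units_def)
  ultimately have "Units (End_ring A B) = carrier (End_ring A B) - {\<zero>\<^bsub>End_ring A B\<^esub>}"
    by blast
  then show ?thesis
    using B ne E.ring_axioms by (simp add: bricks_def division_ring_def division_ring_axioms_def)
qed

lemma brick_not_hom_zero_self:
  assumes "B \<in> bricks k A"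
  shows "\<not> hom_zero A B B"
proof -
  obtain x where "x \<in> carrier B" "x \<noteq> \<zero>\<^bsub>B\<^esub>" using assms by (rule brick_nonzero)
  then show ?thesis
    using identity_mod_hom[OF brick_left_module[OF assms]] unfolding hom_zero_def
    by (metis restrict_apply')
qed

text \<open>
  A nonzero map from the quotient back to \<open>B\<close> would give a nonzero endomorphism of \<open>B\<close> with nonzero
  kernel.
\<close>

lemma brick_proper_quotient_hom_zero:
  assumes B: "B \<in> bricks k A" and q: "q \<in> mod_hom A B N" "q ` carrier B = carrier N"
    and x: "x \<in> carrier B" "x \<noteq> \<zero>\<^bsub>B\<^esub>" "q x = \<zero>\<^bsub>N\<^esub>" and N: "left_module A N"
  shows "hom_zero A N B"
  unfolding hom_zero_def
proof (intro ballI, rule ccontr)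
  fix f y assume f: "f \<in> mod_hom A N B" and y: "y \<in> carrier N" "f y \<noteq> \<zero>\<^bsub>B\<^esub>"
  note lm = brick_left_module[OF B]
  let ?h = "compose (carrier B) f q"
  have h: "?h \<in> mod_hom A B B" by (rule compose_mod_hom[OF lm q(1) f])
  from y(1) have "y \<in> q ` carrier B" by (simp only: q(2))
  then obtain z where "z \<in> carrier B" "q z = y" by (elim imageE) simp
  then have "bij_betw ?h (carrier B) (carrier B)"
    using y by (intro brick_endomorphism_bij[OF B h, of z]) (auto simp: compose_eq)
  moreover have "?h x = \<zero>\<^bsub>B\<^esub>"
    using x mod_hom_zero[OF N lm f] by (simp add: compose_eq)
  ultimately show False
    using x mod_hom_inj_on_iff[OF lm lm h] by (auto simp: bij_betw_def)
qed

text \<open>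
  The composite is a surjective, hence nonzero, endomorphism of \<open>X\<close>, so it is injective, and then so is
  \<open>f\<close>.
\<close>

lemma bricks_isomorphic_of_surj:
  assumes "X \<in> bricks k A" "Y \<in> bricks k A"
    and f: "f \<in> mod_hom A X Y" "f ` carrier X = carrier Y"
    and g: "g \<in> mod_hom A Y X" "g ` carrier Y = carrier X"
  shows "isomorphic A X Y"
proof -
  note lm = brick_left_module[OF assms(1)]
  let ?h = "compose (carrier X) g f"
  have h: "?h \<in> mod_hom A X X" by (rule compose_mod_hom[OF lm f(1) g(1)])
  have im: "?h ` carrier X = carrier X"
  proof -
    have "?h ` carrier X = g ` f ` carrier X"
      unfolding image_image by (rule image_cong) (simp_all add: compose_eq)
    then show ?thesis by (simp only: f(2) g(2))
  qed
  obtain x where x: "x \<in> carrier X" "x \<noteq> \<zero>\<^bsub>X\<^esub>" by (rule brick_nonzero[OF assms(1)])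
  then have "x \<in> ?h ` carrier X" by (simp only: im)
  then obtain z where "z \<in> carrier X" "?h z \<noteq> \<zero>\<^bsub>X\<^esub>" using x(2) by (elim imageE) simp
  then have "bij_betw ?h (carrier X) (carrier X)"
    by (rule brick_endomorphism_bij[OF assms(1) h])
  then have "inj_on f (carrier X)"
    by (auto simp: bij_betw_def inj_on_def compose_eq)
  then have "f \<in> mod_iso A X Y"
    using f by (simp add: mod_iso_def bij_betw_def)
  then show ?thesis by (auto simp: isomorphic_def)
qed

lemma isomorphic_equiv:
  "equiv (bricks k A) {(X, Y). X \<in> bricks k A \<and> Y \<in> bricks k A \<and> isomorphic A X Y}"
proof (rule equivI)
  show "refl_on (bricks k A) {(X, Y). X \<in> bricks k A \<and> Y \<in> bricks k A \<and> isomorphic A X Y}"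
    by (auto intro!: refl_onI isomorphic_refl brick_left_module)
  show "sym {(X, Y). X \<in> bricks k A \<and> Y \<in> bricks k A \<and> isomorphic A X Y}"
    by (auto intro!: symI dest: isomorphic_sym[rotated 2] brick_left_module)
  show "trans {(X, Y). X \<in> bricks k A \<and> Y \<in> bricks k A \<and> isomorphic A X Y}"
    by (auto intro!: transI dest: isomorphic_trans[OF brick_left_module])
qed auto

text \<open>
  The arrow relation of the brick quiver, lifted from isomorphism classes to bricks.
\<close>

definition brick_arrows ::
  "('k, 'r) ring_scheme \<Rightarrow> ('k, 'a) module \<Rightarrow> ('k, 'a) object rel" where
  "brick_arrows k A = {(X, Y). X \<in> bricks k A \<and> Y \<in> bricks k A \<and>
    \<not> hom_zero A X Y \<and> \<not> isomorphic A X Y}"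

lemma brick_arrows_iso:
  assumes "(X, Y) \<in> brick_arrows k A" "X' \<in> bricks k A" "Y' \<in> bricks k A"
    "isomorphic A X X'" "isomorphic A Y Y'"
  shows "(X', Y') \<in> brick_arrows k A"
proof -
  have XY: "X \<in> bricks k A" "Y \<in> bricks k A" "\<not> hom_zero A X Y" "\<not> isomorphic A X Y"
    using assms(1) by (auto simp: brick_arrows_def)
  note lm = XY(1,2)[THEN brick_left_module] assms(2,3)[THEN brick_left_module]
  have sym: "isomorphic A X' X" "isomorphic A Y' Y"
    using isomorphic_sym lm assms(4,5) by blast+
  have "\<not> hom_zero A X' Y'"
    using hom_zero_isomorphic_left[OF lm(3) sym(1)] hom_zero_isomorphic_right[OF lm(1,4,2) sym(2)] XY(3)
    by blast
  moreover have "\<not> isomorphic A X' Y'"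
    using isomorphic_trans[OF lm(1) assms(4)] isomorphic_trans[OF lm(1) _ sym(2)] XY(4) by blast
  ultimately show ?thesis using assms(2,3) by (simp add: brick_arrows_def)
qed

text \<open>
  A nonzero non-invertible map cannot go between isomorphic bricks \<open>X\<close> and \<open>Y\<close>: followed by an
  isomorphism \<open>Y \<rightarrow> X\<close> it would be a nonzero, hence invertible, endomorphism.
\<close>

lemma brick_cycle_iff: "(\<exists>m X f. brick_cycle k A m X f) \<longleftrightarrow> \<not> acyclic (brick_arrows k A)"
proof
  assume "\<exists>m X f. brick_cycle k A m X f"
  then obtain m X f where c: "brick_cycle k A m X f" by blast
  have step: "(X i, X (Suc i)) \<in> brick_arrows k A" if "i < m" for i
  proof -
    have X: "X i \<in> bricks k A" "X (Suc i) \<in> bricks k A"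
      using c that by (auto simp: brick_cycle_def)
    have "Suc i \<in> {1..m}" using that by simp
    then have f: "f (Suc i) \<in> mod_hom A (X i) (X (Suc i))" "f (Suc i) \<noteq> zero_hom (X i) (X (Suc i))"
      "f (Suc i) \<notin> mod_iso A (X i) (X (Suc i))"
      using c unfolding brick_cycle_def by (metis diff_Suc_1)+
    obtain x where x: "x \<in> carrier (X i)" "f (Suc i) x \<noteq> \<zero>\<^bsub>X (Suc i)\<^esub>"
      using f(2) eq_zero_hom_iff[OF f(1)] by blast
    have "\<not> isomorphic A (X i) (X (Suc i))"
    proof
      assume "isomorphic A (X i) (X (Suc i))"
      note lm = brick_left_module[OF X(1)] brick_left_module[OF X(2)]
      obtain h where "h \<in> mod_iso A (X i) (X (Suc i))"
        using \<open>isomorphic _ _ _\<close> by (auto simp: isomorphic_def)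
      then obtain g where g: "g \<in> mod_iso A (X (Suc i)) (X i)"
        using mod_iso_inverse[OF lm] by metis
      then have gh: "g \<in> mod_hom A (X (Suc i)) (X i)" and gb: "bij_betw g (carrier (X (Suc i))) (carrier (X i))"
        by (auto simp: mod_iso_def)
      let ?e = "compose (carrier (X i)) g (f (Suc i))"
      have e: "?e \<in> mod_hom A (X i) (X i)" by (rule compose_mod_hom[OF lm(1) f(1) gh])
      have "g (f (Suc i) x) \<noteq> \<zero>\<^bsub>X i\<^esub>"
        using x mod_hom_inj_on_iff[OF lm(2,1) gh] gb mod_hom_closed[OF f(1) x(1)]
        by (auto simp: bij_betw_def)
      then have "bij_betw ?e (carrier (X i)) (carrier (X i))"
        using x by (intro brick_endomorphism_bij[OF X(1) e x(1)]) (simp add: compose_eq)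
      then have "bij_betw (g \<circ> f (Suc i)) (carrier (X i)) (carrier (X i))"
        by (rule bij_betw_cong[THEN iffD1, rotated]) (simp add: compose_eq)
      moreover have "f (Suc i) ` carrier (X i) \<subseteq> carrier (X (Suc i))"
        using f(1) by (auto simp: mod_hom_closed)
      ultimately have "bij_betw (f (Suc i)) (carrier (X i)) (carrier (X (Suc i)))"
        using bij_betw_comp_iff2[OF gb] by blast
      then show False using f by (simp add: mod_iso_def)
    qed
    then show ?thesis
      using X f(1) x by (auto simp: brick_arrows_def hom_zero_def)
  qed
  then have "(X 0, X m) \<in> brick_arrows k A ^^ m"
    by (auto simp: relpow_fun_conv intro!: exI[of _ X])
  moreover have "m > 0" "X m = X 0" using c by (auto simp: brick_cycle_def)
  ultimately have "(X 0, X 0) \<in> (brick_arrows k A)\<^sup>+"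
    by (auto simp: trancl_power)
  then show "\<not> acyclic (brick_arrows k A)" by (auto simp: acyclic_def)
next
  assume "\<not> acyclic (brick_arrows k A)"
  then obtain Y m where "m > 0" "(Y, Y) \<in> brick_arrows k A ^^ m"
    by (auto simp: acyclic_def trancl_power)
  then obtain X where X: "X 0 = Y" "X m = Y" "\<And>i. i < m \<Longrightarrow> (X i, X (Suc i)) \<in> brick_arrows k A"
    by (auto simp: relpow_fun_conv)
  have "\<exists>f. f \<in> mod_hom A (X (i - 1)) (X i) \<and> f \<noteq> zero_hom (X (i - 1)) (X i) \<and>
      f \<notin> mod_iso A (X (i - 1)) (X i)" if "i \<in> {1..m}" for i
  proof -
    have a: "(X (i - 1), X i) \<in> brick_arrows k A" using X(3)[of "i - 1"] that by force
    then obtain f x where f: "f \<in> mod_hom A (X (i - 1)) (X i)" "x \<in> carrier (X (i - 1))" "f x \<noteq> \<zero>\<^bsub>X i\<^esub>"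
      by (auto simp: brick_arrows_def hom_zero_def)
    then have "f \<noteq> zero_hom (X (i - 1)) (X i)" using eq_zero_hom_iff by blast
    then show ?thesis using f(1) a by (auto simp: brick_arrows_def isomorphic_def)
  qed
  then obtain f where f: "\<And>i. i \<in> {1..m} \<Longrightarrow> f i \<in> mod_hom A (X (i - 1)) (X i) \<and>
      f i \<noteq> zero_hom (X (i - 1)) (X i) \<and> f i \<notin> mod_iso A (X (i - 1)) (X i)"
    by metis
  have "X i \<in> bricks k A" if "i \<le> m" for i
  proof (cases "i < m")
    case True
    then show ?thesis using X(3)[of i] by (simp add: brick_arrows_def)
  next
    case False
    then show ?thesis using X(3)[of "m - 1"] that \<open>m > 0\<close> by (auto simp: brick_arrows_def)
  qed
  then have "brick_cycle k A m X f"
    unfolding brick_cycle_def using \<open>m > 0\<close> X(1,2) f by auto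
  then show "\<exists>m X f. brick_cycle k A m X f" by blast
qed

text \<open>
  Passing to isomorphism classes neither creates nor destroys cycles, since \<open>brick_arrows\<close> is invariant
  under isomorphism on both sides.
\<close>

lemma acyclic_brick_quiver_iff: "acyclic (brick_quiver k A) \<longleftrightarrow> acyclic (brick_arrows k A)"
proof -
  let ?r = "{(X, Y). X \<in> bricks k A \<and> Y \<in> bricks k A \<and> isomorphic A X Y}"
  have class_mem: "X \<in> bricks k A" if "P \<in> brick_classes k A" "X \<in> P" for P X
    using that by (auto simp: brick_classes_def quotient_def)
  have class_iso: "isomorphic A X Y" if "P \<in> brick_classes k A" "X \<in> P" "Y \<in> P" for P X Y
    using quotient_eq_iff[OF isomorphic_equiv[of k A], of P P X Y] that by (simp add: brick_classes_def)
  have hom_iff: "mod_hom A X Y \<noteq> {zero_hom X Y} \<longleftrightarrow> \<not> hom_zero A X Y"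
    if "X \<in> bricks k A" "Y \<in> bricks k A" for X Y
  proof -
    have "zero_hom X Y \<in> mod_hom A X Y"
      by (rule zero_hom_mod_hom[OF that[THEN brick_left_module]])
    then show ?thesis
      unfolding hom_zero_def using eq_zero_hom_iff[of _ A X Y] by blast
  qed
  have arrow: "(X, Y) \<in> brick_arrows k A" if PQ: "(P, Q) \<in> brick_quiver k A" and XY: "X \<in> P" "Y \<in> Q" for P Q X Y
  proof -
    have cl: "P \<in> brick_classes k A" "Q \<in> brick_classes k A" "P \<noteq> Q"
      using PQ by (auto simp: brick_quiver_def)
    obtain X' Y' where XY': "X' \<in> P" "Y' \<in> Q" "mod_hom A X' Y' \<noteq> {zero_hom X' Y'}"
      using PQ by (auto simp: brick_quiver_def)
    note br = class_mem[OF cl(1) XY'(1)] class_mem[OF cl(2) XY'(2)]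
    have "\<not> isomorphic A X' Y'"
      using cl XY' br quotient_eq_iff[OF isomorphic_equiv[of k A], of P Q X' Y'] by (auto simp: brick_classes_def)
    then have "(X', Y') \<in> brick_arrows k A"
      using br XY'(3) hom_iff[OF br] by (simp add: brick_arrows_def)
    then show ?thesis
      using XY class_iso cl XY' class_mem by (intro brick_arrows_iso[of X' Y' k A X Y]) auto
  qed
  have class_ne: "P \<noteq> {}" if "P \<in> brick_classes k A" for P
    using that in_quotient_imp_non_empty[OF isomorphic_equiv] by (auto simp: brick_classes_def)
  have "(X, Y) \<in> (brick_arrows k A)\<^sup>+" if "(P, Q) \<in> (brick_quiver k A)\<^sup>+" "X \<in> P" "Y \<in> Q" for P Q X Y
    using that
  proof (induction arbitrary: Y rule: trancl_induct)
    case (base Q)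
    then show ?case using arrow by blast
  next
    case (step Q R)
    obtain Z where "Z \<in> Q" using class_ne step.hyps(2) by (auto simp: brick_quiver_def)
    then show ?case using step arrow by (meson trancl.trancl_into_trancl)
  qed
  note quiver_trancl = this
  have class_arrow: "(?r `` {X}, ?r `` {Y}) \<in> brick_quiver k A" if "(X, Y) \<in> brick_arrows k A" for X Y
  proof -
    from that have br: "X \<in> bricks k A" "Y \<in> bricks k A" "\<not> hom_zero A X Y" "\<not> isomorphic A X Y"
      by (auto simp: brick_arrows_def)
    have cl: "?r `` {X} \<in> brick_classes k A" "?r `` {Y} \<in> brick_classes k A"
      unfolding brick_classes_def by (rule quotientI[OF br(1)], rule quotientI[OF br(2)])
    have self: "X \<in> ?r `` {X}" "Y \<in> ?r `` {Y}"
      using br equiv_class_self[OF isomorphic_equiv] by blast+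
    have "?r `` {X} \<noteq> ?r `` {Y}"
      using eq_equiv_class_iff[OF isomorphic_equiv br(1,2)] br(4) by simp
    then show "(?r `` {X}, ?r `` {Y}) \<in> brick_quiver k A"
      unfolding brick_quiver_def using cl self br hom_iff by blast
  qed
  have "(?r `` {X}, ?r `` {Y}) \<in> (brick_quiver k A)\<^sup>+" if "(X, Y) \<in> (brick_arrows k A)\<^sup>+" for X Y
    using that by (induction rule: trancl_induct) (auto dest: class_arrow intro: trancl_into_trancl)
  note arrows_trancl = this
  show ?thesis
  proof
    assume "acyclic (brick_quiver k A)"
    then show "acyclic (brick_arrows k A)" using arrows_trancl unfolding acyclic_def by blast
  next
    assume *: "acyclic (brick_arrows k A)"
    show "acyclic (brick_quiver k A)"
      unfolding acyclic_def
    proof (intro allI notI)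
      fix P assume P: "(P, P) \<in> (brick_quiver k A)\<^sup>+"
      then obtain X where "X \<in> P"
        using class_ne by (auto simp: brick_quiver_def dest: tranclD)
      then show False using quiver_trancl[OF P] * by (auto simp: acyclic_def)
    qed
  qed
qed

text \<open>
  A path of nonzero maps may run through isomorphisms; these are absorbed into the neighbouring
  arrows, unless the whole path consists of them.
\<close>

lemma nonzero_hom_path_cases:
  assumes "(X, Y) \<in> {(X, Y). X \<in> bricks k A \<and> Y \<in> bricks k A \<and> \<not> hom_zero A X Y}\<^sup>*" "X \<in> bricks k A"
  shows "Y \<in> bricks k A \<and> (isomorphic A X Y \<or> (X, Y) \<in> (brick_arrows k A)\<^sup>+)"
  using assms(1)
proof (induction rule: rtrancl_induct)
  case base
  then show ?case using assms(2) isomorphic_refl brick_left_module by blast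
next
  case (step Y Z)
  then have YZ: "Y \<in> bricks k A" "Z \<in> bricks k A" "\<not> hom_zero A Y Z" by auto
  note lm = assms(2)[THEN brick_left_module] YZ(1,2)[THEN brick_left_module]
  show ?case
  proof (cases "isomorphic A Y Z")
    case True
    have "(X, Z) \<in> (brick_arrows k A)\<^sup>+" if XY: "(X, Y) \<in> (brick_arrows k A)\<^sup>+"
    proof -
      obtain W where W: "(X, W) \<in> (brick_arrows k A)\<^sup>*" "(W, Y) \<in> brick_arrows k A"
        using tranclD2[OF XY] by blast
      have Wb: "W \<in> bricks k A" using W(2) by (simp add: brick_arrows_def)
      have "(W, Z) \<in> brick_arrows k A"
        by (rule brick_arrows_iso[OF W(2) Wb YZ(2) isomorphic_refl[OF brick_left_module[OF Wb]] True])
      then show ?thesis using W(1) by (rule rtrancl_into_trancl1[rotated])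
    qed
    moreover have "isomorphic A X Z" if "isomorphic A X Y"
      by (rule isomorphic_trans[OF lm(1) that True])
    ultimately show ?thesis using step.IH YZ(2) by blast
  next
    case False
    then have YZa: "(Y, Z) \<in> brick_arrows k A" using YZ by (simp add: brick_arrows_def)
    have "(X, Z) \<in> brick_arrows k A" if "isomorphic A X Y"
      by (rule brick_arrows_iso[OF YZa assms(2) YZ(2) isomorphic_sym[OF lm(1,2) that] isomorphic_refl[OF lm(3)]])
    then show ?thesis using step.IH YZ(2) YZa by (blast intro: trancl_into_trancl)
  qed
qed

section \<open>Torsion classes and bricks\<close>

text \<open>
  The torsion class cogenerated by \<open>D\<close>.
\<close>

definition left_perp ::
  "('k, 'r) ring_scheme \<Rightarrow> ('k, 'a) module \<Rightarrow> ('k, 'a) object set \<Rightarrow> ('k, 'a) object set" where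
  "left_perp k A D = {M \<in> mod_cat k A. \<forall>X\<in>D. hom_zero A M X}"

text \<open>
  For a brick \<open>X\<close>, this torsion class contains both \<open>X\<close> and every module without nonzero maps to \<open>X\<close>, so
  it bounds from above the torsion class that they generate together.
\<close>

definition zero_or_surj ::
  "('k, 'r) ring_scheme \<Rightarrow> ('k, 'a) module \<Rightarrow> ('k, 'a) object \<Rightarrow> ('k, 'a) object set" where
  "zero_or_surj k A X = {M \<in> mod_cat k A. \<forall>f\<in>mod_hom A M X.
    (\<forall>x\<in>carrier M. f x = \<zero>\<^bsub>X\<^esub>) \<or> f ` carrier M = carrier X}"

definition gen_torsion_class ::
  "('k, 'r) ring_scheme \<Rightarrow> ('k, 'a) module \<Rightarrow> ('k, 'a) object \<Rightarrow> ('k, 'a) object set" where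
  "gen_torsion_class k A B = \<Inter>{T. torsion_class k A T \<and> B \<in> T}"

lemma torsion_class_subset: "torsion_class k A T \<Longrightarrow> T \<subseteq> mod_cat k A"
  unfolding torsion_class_def by (elim conjE)

lemma torsion_class_nonempty: "torsion_class k A T \<Longrightarrow> T \<noteq> {}"
  unfolding torsion_class_def by (elim conjE)

lemma torsion_class_criterion:
  assumes "T \<noteq> {}" and "T \<subseteq> mod_cat k A"
    and quot: "\<And>M N g. \<lbrakk>M \<in> T; N \<in> mod_cat k A; g \<in> mod_hom A M N; g ` carrier M = carrier N\<rbrakk> \<Longrightarrow> N \<in> T"
    and "\<And>L N M f g. \<lbrakk>L \<in> T; N \<in> T; M \<in> mod_cat k A; short_exact A L M N f g\<rbrakk> \<Longrightarrow> M \<in> T"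
  shows "torsion_class k A T"
proof (rule torsion_classI[OF assms(1,2) _ quot assms(4)])
  fix M N assume "M \<in> T" "N \<in> mod_cat k A" "isomorphic A M N"
  then show "N \<in> T"
    using quot[of M N] by (auto simp: isomorphic_def mod_iso_def bij_betw_def)
qed

lemma mem_gen_torsion_class: "B \<in> gen_torsion_class k A B"
  by (simp add: gen_torsion_class_def)

lemma gen_torsion_class_subset_iff:
  assumes "torsion_class k A T"
  shows "gen_torsion_class k A B \<subseteq> T \<longleftrightarrow> B \<in> T"
  using assms by (auto simp: gen_torsion_class_def)

lemma brick_in_zero_or_surj: "B \<in> bricks k A \<Longrightarrow> B \<in> zero_or_surj k A B"
  using brick_endomorphism_bij[of B] unfolding zero_or_surj_def bij_betw_def
  by (blast intro: brick_mod_cat)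

lemma brick_not_in_left_perp: "B \<in> bricks k A \<Longrightarrow> B \<notin> left_perp k A {B}"
  using brick_not_hom_zero_self by (auto simp: left_perp_def)

lemma isomorphic_bricks_same_classes:
  assumes "B \<in> bricks k A" "B' \<in> bricks k A" "isomorphic A B B'"
  shows "gen_torsion_class k A B = gen_torsion_class k A B'" "left_perp k A {B} = left_perp k A {B'}"
proof -
  note lm = assms(1,2)[THEN brick_left_module]
  have iso: "isomorphic A B' B" by (rule isomorphic_sym[OF lm assms(3)])
  have "B \<in> T \<longleftrightarrow> B' \<in> T" if "torsion_class k A T" for T
    using torsion_classD(1)[OF that _ brick_mod_cat] assms iso by blast
  then show "gen_torsion_class k A B = gen_torsion_class k A B'"
    unfolding gen_torsion_class_def by (intro arg_cong[where f = Inter]) blast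
  have "hom_zero A M B \<longleftrightarrow> hom_zero A M B'" if "M \<in> mod_cat k A" for M
    using hom_zero_isomorphic_right[OF mod_cat_left_module[OF that]] lm assms(3) iso by blast
  then show "left_perp k A {B} = left_perp k A {B'}" by (auto simp: left_perp_def)
qed

text \<open>
  For the torsion pair \<open>(T, F)\<close> this says that every brick lies in \<open>T\<close> or in \<open>F\<close>.
\<close>

definition brick_splitting ::
  "('k, 'r) ring_scheme \<Rightarrow> ('k, 'a) module \<Rightarrow> ('k, 'a) object set \<Rightarrow> bool" where
  "brick_splitting k A T \<longleftrightarrow> (\<forall>B\<in>bricks k A. B \<in> T \<or> T \<subseteq> left_perp k A {B})"

lemma brick_splittingD:
  assumes "brick_splitting k A T" "X \<in> T" "Y \<in> bricks k A" "\<not> hom_zero A X Y"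
  shows "Y \<in> T"
  using assms by (auto simp: brick_splitting_def left_perp_def)

context
  fixes k :: "('k, 'r) ring_scheme" and A :: "('k, 'a) module"
  assumes alg: "fin_dim_algebra k A"
begin

lemmas mod_cat_surj = fin_dim_algebra.mod_cat_surj[OF alg]
  and span_size_quotient_less = fin_dim_algebra.span_size_quotient_less[OF alg]
  and injective_endomorphism_surj = fin_dim_algebra.injective_endomorphism_surj[OF alg]

lemma ring_A: "ring A"
  using alg by (simp add: fin_dim_algebra_def)

text \<open>
  The image is taken as a submodule of \<open>N\<close>; it is finite dimensional because it is a quotient of \<open>M\<close>.
\<close>

lemma image_cokernel:
  assumes "M \<in> mod_cat k A" "N \<in> mod_cat k A" "f \<in> mod_hom A M N"
  obtains I C p i q where "I \<in> mod_cat k A" "C \<in> mod_cat k A"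
    "p \<in> mod_hom A M I" "p ` carrier M = carrier I" "short_exact A I N C i q"
    "\<And>x. x \<in> carrier M \<Longrightarrow> i (p x) = f x" "i ` carrier I = f ` carrier M"
proof -
  note M = mod_cat_left_module[OF assms(1)] and N = mod_cat_left_module[OF assms(2)]
  let ?I = "N\<lparr>carrier := f ` carrier M\<rparr>"
  have sub: "submodule_of A N (f ` carrier M)"
    by (rule image_submodule[OF M N assms(3) carrier_submodule[OF M]])
  have I: "left_module A ?I" by (rule submodule_left_module[OF N sub])
  have p: "f \<in> mod_hom A M ?I" "f ` carrier M = carrier ?I"
    using assms(3) by (auto simp: mod_hom_def)
  obtain C :: "('k, 'a) object" and q where C: "left_module A C" "q \<in> mod_hom A N C" "q ` carrier N = carrier C"
    "{x \<in> carrier N. q x = \<zero>\<^bsub>C\<^esub>} = f ` carrier M"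
    using quotient_module_exists[OF N sub] by blast
  have i: "(\<lambda>x\<in>f ` carrier M. x) \<in> mod_hom A ?I N"
    using submodule_ofD[OF sub] by (auto simp: mod_hom_def)
  show thesis
  proof (rule that)
    show "?I \<in> mod_cat k A" by (rule mod_cat_surj[OF assms(1) I p])
    show "C \<in> mod_cat k A" by (rule mod_cat_surj[OF assms(2) C(1-3)])
    show "short_exact A ?I N C (\<lambda>x\<in>f ` carrier M. x) q"
      using i C by (auto simp: short_exact_def inj_on_def)
  qed (use p in auto)
qed

lemma zero_module:
  obtains Z where "Z \<in> mod_cat k A" "carrier Z = {\<zero>\<^bsub>Z\<^esub>}"
  using zero_module_exists[OF ring_A] by metis

lemma left_perp_torsion_class:
  assumes "D \<subseteq> mod_cat k A"
  shows "torsion_class k A (left_perp k A D)"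
proof (rule torsion_class_criterion)
  obtain Z where Z: "Z \<in> mod_cat k A" "carrier Z = {\<zero>\<^bsub>Z\<^esub>}" by (rule zero_module)
  then have "Z \<in> left_perp k A D"
    using assms zero_module_hom[OF Z] by (auto simp: left_perp_def hom_zero_def)
  then show "left_perp k A D \<noteq> {}" by blast
next
  fix L M N f g
  assume *: "L \<in> left_perp k A D" "N \<in> left_perp k A D" "M \<in> mod_cat k A" "short_exact A L M N f g"
  have "hom_zero A M X" if X: "X \<in> D" for X
    unfolding hom_zero_def
  proof (intro ballI)
    fix h x assume h: "h \<in> mod_hom A M X" and x: "x \<in> carrier M"
    have LN: "hom_zero A L X" "hom_zero A N X" "left_module A L" "left_module A N"
      using * X by (auto simp: left_perp_def mod_cat_left_module[of _ k])
    have "left_module A M" "left_module A X"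
      using *(3) X assms by (auto simp: mod_cat_left_module[of _ k])
    from short_exact_hom_cases[OF LN(3) this(1) LN(4) this(2) *(4) h]
    obtain u where "u \<in> mod_hom A N X" "u ` carrier N = h ` carrier M"
      using LN by (auto simp: hom_zero_def)
    moreover from this(2) obtain y where "y \<in> carrier N" "u y = h x"
      using x by (metis (no_types, lifting) imageE imageI)
    ultimately show "h x = \<zero>\<^bsub>X\<^esub>"
      using LN(2) unfolding hom_zero_def by metis
  qed
  then show "M \<in> left_perp k A D" using *(3) by (simp add: left_perp_def)
qed (auto simp: left_perp_def intro: hom_zero_surj mod_cat_left_module[of _ k])

lemma left_perp_brick_torsion_class: "B \<in> bricks k A \<Longrightarrow> torsion_class k A (left_perp k A {B})"
  by (intro left_perp_torsion_class) (simp add: brick_mod_cat)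

lemma zero_or_surj_torsion_class:
  assumes X: "X \<in> mod_cat k A"
  shows "torsion_class k A (zero_or_surj k A X)"
proof (rule torsion_class_criterion)
  obtain Z where Z: "Z \<in> mod_cat k A" "carrier Z = {\<zero>\<^bsub>Z\<^esub>}" by (rule zero_module)
  then have "Z \<in> zero_or_surj k A X"
    using zero_module_hom[OF Z X] by (auto simp: zero_or_surj_def)
  then show "zero_or_surj k A X \<noteq> {}" by blast
next
  fix M N g
  assume *: "M \<in> zero_or_surj k A X" "N \<in> mod_cat k A" "g \<in> mod_hom A M N" "g ` carrier M = carrier N"
  have "(\<forall>x\<in>carrier N. f x = \<zero>\<^bsub>X\<^esub>) \<or> f ` carrier N = carrier X" if f: "f \<in> mod_hom A N X" for f
  proof -
    have "left_module A M" using *(1) by (simp add: zero_or_surj_def mod_cat_left_module[of _ k])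
    then have "compose (carrier M) f g \<in> mod_hom A M X"
      by (rule compose_mod_hom) fact+
    then have "(\<forall>x\<in>carrier M. compose (carrier M) f g x = \<zero>\<^bsub>X\<^esub>) \<or>
        compose (carrier M) f g ` carrier M = carrier X"
      using *(1) by (simp add: zero_or_surj_def)
    moreover have "compose (carrier M) f g ` carrier M = f ` carrier N"
      unfolding *(4)[symmetric] image_image by (auto simp: compose_eq)
    ultimately show ?thesis
      unfolding *(4)[symmetric] by (auto simp: compose_eq)
  qed
  then show "N \<in> zero_or_surj k A X" using *(2) by (simp add: zero_or_surj_def)
next
  fix L M N f g
  assume *: "L \<in> zero_or_surj k A X" "N \<in> zero_or_surj k A X" "M \<in> mod_cat k A" "short_exact A L M N f g"
  have "(\<forall>x\<in>carrier M. h x = \<zero>\<^bsub>X\<^esub>) \<or> h ` carrier M = carrier X" if h: "h \<in> mod_hom A M X" for h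
  proof -
    have lm: "left_module A L" "left_module A M" "left_module A N" "left_module A X"
      using * X by (auto simp: zero_or_surj_def mod_cat_left_module[of _ k])
    have hX: "h ` carrier M \<subseteq> carrier X" using h by (auto simp: mod_hom_closed)
    from short_exact_hom_cases[OF lm *(4) h] show ?thesis
    proof (elim disjE bexE conjE)
      fix u x assume "u \<in> mod_hom A L X" "x \<in> carrier L" "u x \<noteq> \<zero>\<^bsub>X\<^esub>" "u ` carrier L \<subseteq> h ` carrier M"
      moreover from this have "u ` carrier L = carrier X"
        using *(1) unfolding zero_or_surj_def by blast
      ultimately show ?thesis using hX by blast
    next
      fix u assume u: "u \<in> mod_hom A N X" "u ` carrier N = h ` carrier M"
      then have "(\<forall>x\<in>carrier N. u x = \<zero>\<^bsub>X\<^esub>) \<or> u ` carrier N = carrier X"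
        using *(2) unfolding zero_or_surj_def by blast
      moreover have "\<exists>y\<in>carrier N. u y = h x" if "x \<in> carrier M" for x
        using that u(2) by (metis (no_types, lifting) imageE imageI)
      ultimately show ?thesis using u(2) by fastforce
    qed
  qed
  then show "M \<in> zero_or_surj k A X" using *(3) by (simp add: zero_or_surj_def)
qed (auto simp: zero_or_surj_def)

lemma zero_module_mem:
  assumes "torsion_class k A T" "Z \<in> mod_cat k A" "carrier Z = {\<zero>\<^bsub>Z\<^esub>}"
  shows "Z \<in> T"
proof -
  obtain M where M: "M \<in> T" using torsion_class_nonempty[OF assms(1)] by blast
  then have lm: "left_module A M"
    using torsion_class_subset[OF assms(1)] by (auto intro: mod_cat_left_module)
  interpret M: left_module A M by (rule lm)
  have "zero_hom M Z \<in> mod_hom A M Z"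
    by (rule zero_hom_mod_hom[OF lm mod_cat_left_module[OF assms(2)]])
  moreover have "zero_hom M Z ` carrier M = carrier Z"
    using assms(3) M.M.zero_closed by (auto simp: zero_hom_def)
  ultimately show ?thesis by (rule torsion_classD(2)[OF assms(1) M assms(2)])
qed

lemma torsion_class_Inter:
  assumes "\<T> \<noteq> {}" and tc: "\<And>T. T \<in> \<T> \<Longrightarrow> torsion_class k A T"
  shows "torsion_class k A (\<Inter>\<T>)"
proof (rule torsion_class_criterion)
  obtain Z where "Z \<in> mod_cat k A" "carrier Z = {\<zero>\<^bsub>Z\<^esub>}" by (rule zero_module)
  then have "Z \<in> \<Inter>\<T>" using zero_module_mem[OF tc] by blast
  then show "\<Inter>\<T> \<noteq> {}" by blast
  show "\<Inter>\<T> \<subseteq> mod_cat k A"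
    using assms(1) torsion_class_subset[OF tc] by blast
next
  fix M N g
  assume *: "M \<in> \<Inter>\<T>" "N \<in> mod_cat k A" "g \<in> mod_hom A M N" "g ` carrier M = carrier N"
  show "N \<in> \<Inter>\<T>"
  proof
    fix T assume "T \<in> \<T>"
    then show "N \<in> T" using *(1) by (intro torsion_classD(2)[OF tc _ *(2-4)]) auto
  qed
next
  fix L N M f g
  assume *: "L \<in> \<Inter>\<T>" "N \<in> \<Inter>\<T>" "M \<in> mod_cat k A" "short_exact A L M N f g"
  show "M \<in> \<Inter>\<T>"
  proof
    fix T assume "T \<in> \<T>"
    then show "M \<in> T" using *(1,2) by (intro torsion_classD(3)[OF tc _ _ *(3,4)]) auto
  qed
qed

lemma torsion_class_Int:
  "\<lbrakk>torsion_class k A S; torsion_class k A T\<rbrakk> \<Longrightarrow> torsion_class k A (S \<inter> T)"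
  using torsion_class_Inter[of "{S, T}"] by auto

lemma torsion_class_mod_cat: "torsion_class k A (mod_cat k A)"
  using left_perp_torsion_class[of "{}"] by (simp add: left_perp_def)

lemma torsion_class_gen:
  assumes "B \<in> mod_cat k A"
  shows "torsion_class k A (gen_torsion_class k A B)"
  unfolding gen_torsion_class_def using assms torsion_class_mod_cat
  by (intro torsion_class_Inter) auto

text \<open>
  \<open>B\<close> is an extension of the cokernel of a nonzero map \<open>M \<rightarrow> B\<close> by its image.  The image is a quotient
  of \<open>M\<close>, and the cokernel, a proper quotient of the brick \<open>B\<close>, has no nonzero maps to \<open>B\<close>.
\<close>

lemma brick_mem_of_nonzero_hom:
  assumes B: "B \<in> bricks k A" and T: "torsion_class k A T" and M: "M \<in> T" "\<not> hom_zero A M B"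
    and quot: "\<And>C q. \<lbrakk>C \<in> mod_cat k A; q \<in> mod_hom A B C; q ` carrier B = carrier C; hom_zero A C B\<rbrakk> \<Longrightarrow> C \<in> T"
  shows "B \<in> T"
proof -
  have Bm: "B \<in> mod_cat k A" and Mm: "M \<in> mod_cat k A"
    using brick_mod_cat[OF B] subsetD[OF torsion_class_subset[OF T] M(1)] .
  obtain f x where f: "f \<in> mod_hom A M B" "x \<in> carrier M" "f x \<noteq> \<zero>\<^bsub>B\<^esub>"
    using M(2) by (auto simp: hom_zero_def)
  obtain I C p i q where I: "I \<in> mod_cat k A" "C \<in> mod_cat k A"
    "p \<in> mod_hom A M I" "p ` carrier M = carrier I" "short_exact A I B C i q"
    "\<And>x. x \<in> carrier M \<Longrightarrow> i (p x) = f x" "i ` carrier I = f ` carrier M"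
    by (rule image_cokernel[OF Mm Bm f(1)]) blast
  have "I \<in> T" by (rule torsion_classD(2)[OF T M(1) I(1,3,4)])
  have q: "q \<in> mod_hom A B C" "q ` carrier B = carrier C"
    "{x \<in> carrier B. q x = \<zero>\<^bsub>C\<^esub>} = f ` carrier M"
    using I(5,7) by (simp_all add: short_exact_def)
  have "f x \<in> carrier B" "q (f x) = \<zero>\<^bsub>C\<^esub>" using q(3) f(2) by auto
  then have "hom_zero A C B"
    using brick_proper_quotient_hom_zero[OF B q(1,2) _ f(3)] I(2) by (simp add: mod_cat_left_module[of _ k])
  then have "C \<in> T" using quot I(2) q by blast
  with \<open>I \<in> T\<close> show ?thesis using torsion_classD(3)[OF T _ _ Bm I(5)] by blast
qed

text \<open>
  Every member of the torsion class generated by \<open>B\<close> maps to \<open>B\<close> by zero or surjectively, and a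
  surjection from \<open>T\<close> would put \<open>B\<close> into \<open>T\<close>.  So \<open>T(B)\<close> has a largest proper subclass.
\<close>

lemma proper_subclass_in_left_perp:
  assumes B: "B \<in> bricks k A" and T: "torsion_class k A T" "T \<subset> gen_torsion_class k A B"
  shows "T \<subseteq> left_perp k A {B}"
proof
  fix M assume M: "M \<in> T"
  have "B \<notin> T" using T gen_torsion_class_subset_iff[OF T(1)] by blast
  have Mm: "M \<in> mod_cat k A" using M torsion_class_subset[OF T(1)] by blast
  have "gen_torsion_class k A B \<subseteq> zero_or_surj k A B"
    using gen_torsion_class_subset_iff[OF zero_or_surj_torsion_class[OF brick_mod_cat[OF B]]]
      brick_in_zero_or_surj[OF B] by blast
  then have Mz: "M \<in> zero_or_surj k A B" using M T by blast
  have "hom_zero A M B"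
    unfolding hom_zero_def
  proof (rule ballI)
    fix f assume f: "f \<in> mod_hom A M B"
    have "f ` carrier M \<noteq> carrier B"
      using torsion_classD(2)[OF T(1) M brick_mod_cat[OF B] f] \<open>B \<notin> T\<close> by blast
    then show "\<forall>x\<in>carrier M. f x = \<zero>\<^bsub>B\<^esub>" using Mz f unfolding zero_or_surj_def by blast
  qed
  then show "M \<in> left_perp k A {B}" using Mm by (simp add: left_perp_def)
qed

text \<open>
  The cokernel in \<open>brick_mem_of_nonzero_hom\<close> lies in \<open>left_perp k A {B}\<close>, hence in \<open>T\<close>.  So the intersection
  of all torsion classes strictly above \<open>left_perp k A {B}\<close> still contains \<open>B\<close>, and \<open>left_perp k A {B}\<close> is
  completely meet-irreducible.
\<close>

lemma proper_superclass_contains_brick: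
  assumes B: "B \<in> bricks k A" and T: "torsion_class k A T" "left_perp k A {B} \<subset> T"
  shows "B \<in> T"
proof -
  obtain M where M: "M \<in> T" "M \<notin> left_perp k A {B}" using T by blast
  then have "\<not> hom_zero A M B" using torsion_class_subset[OF T(1)] by (auto simp: left_perp_def)
  moreover have "C \<in> T" if "C \<in> mod_cat k A" "hom_zero A C B" for C
    using that T(2) by (auto simp: left_perp_def)
  ultimately show ?thesis by (rule brick_mem_of_nonzero_hom[OF B T(1) M(1)])
qed

text \<open>
  Take \<open>M\<close> of least dimension in \<open>S - T\<close>.  All proper quotients of \<open>M\<close> lie in \<open>T\<close>.  A nonzero map \<open>N \<rightarrow> M\<close>
  with \<open>N \<in> T\<close> would exhibit \<open>M\<close> as an extension of two members of \<open>T\<close>, its image and its cokernel; so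
  \<open>Hom(T, M) = 0\<close>.  The image of a nonzero endomorphism of \<open>M\<close> is therefore not in \<open>T\<close>, so it is not a
  proper quotient of \<open>M\<close>: the endomorphism is injective, hence bijective.
\<close>

theorem separating_brick:
  assumes S: "torsion_class k A S" and T: "torsion_class k A T" and "\<not> S \<subseteq> T"
  obtains B where "B \<in> bricks k A" "B \<in> S" "T \<subseteq> left_perp k A {B}"
proof -
  have Sm: "S \<subseteq> mod_cat k A" and Tm: "T \<subseteq> mod_cat k A"
    using S T by (simp_all add: torsion_class_subset)
  obtain M where "M \<in> S - T" using assms(3) by blast
  from ex_has_least_nat[of "\<lambda>M. M \<in> S - T", OF this, of "fin_dim_algebra.span_size k A"]
  obtain M where M: "M \<in> S" "M \<notin> T" and min: "\<And>N. N \<in> S - T \<Longrightarrow> fin_dim_algebra.span_size k A M \<le> fin_dim_algebra.span_size k A N"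
    by blast
  have Mm: "M \<in> mod_cat k A" using M Sm by blast
  note lm = mod_cat_left_module[OF Mm]
  have quot: "N \<in> T" if "N \<in> mod_cat k A" "q \<in> mod_hom A M N" "q ` carrier M = carrier N"
    "\<not> inj_on q (carrier M)" for N q
  proof -
    have "N \<in> S" by (rule torsion_classD(2)[OF S M(1) that(1-3)])
    then show ?thesis
      using span_size_quotient_less[OF Mm _ that(2-4)] min[of N] that(1) by (force simp: mod_cat_left_module[of _ k])
  qed
  have perp: "hom_zero A N M" if N: "N \<in> T" for N
    unfolding hom_zero_def
  proof (intro ballI, rule ccontr)
    fix f x assume f: "f \<in> mod_hom A N M" "x \<in> carrier N" "f x \<noteq> \<zero>\<^bsub>M\<^esub>"
    have Nm: "N \<in> mod_cat k A" using N Tm by blast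
    obtain I C p i q where I: "I \<in> mod_cat k A" "C \<in> mod_cat k A"
      "p \<in> mod_hom A N I" "p ` carrier N = carrier I" "short_exact A I M C i q"
      "\<And>x. x \<in> carrier N \<Longrightarrow> i (p x) = f x" "i ` carrier I = f ` carrier N"
      by (rule image_cokernel[OF Nm Mm f(1)]) blast
    have "I \<in> T" by (rule torsion_classD(2)[OF T N(1) I(1,3,4)])
    have q: "q \<in> mod_hom A M C" "q ` carrier M = carrier C"
      "{x \<in> carrier M. q x = \<zero>\<^bsub>C\<^esub>} = f ` carrier N"
      using I(5,7) by (simp_all add: short_exact_def)
    have "f x \<in> carrier M" "q (f x) = \<zero>\<^bsub>C\<^esub>" using q(3) f(2) by auto
    then have "\<not> inj_on q (carrier M)"
      using f(3) mod_hom_inj_on_iff[OF lm mod_cat_left_module[OF I(2)] q(1)] by blast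
    then have "C \<in> T" using quot I(2) q by blast
    with \<open>I \<in> T\<close> have "M \<in> T" using torsion_classD(3)[OF T _ _ Mm I(5)] by blast
    with M show False by blast
  qed
  have "M \<in> bricks k A"
  proof -
    have bij: "bij_betw f (carrier M) (carrier M)"
      if f: "f \<in> mod_hom A M M" "x \<in> carrier M" "f x \<noteq> \<zero>\<^bsub>M\<^esub>" for f x
    proof -
      obtain I C p i q where I: "I \<in> mod_cat k A" "C \<in> mod_cat k A"
        "p \<in> mod_hom A M I" "p ` carrier M = carrier I" "short_exact A I M C i q"
        "\<And>x. x \<in> carrier M \<Longrightarrow> i (p x) = f x" "i ` carrier I = f ` carrier M"
        by (rule image_cokernel[OF Mm Mm f(1)]) blast
      have i: "i \<in> mod_hom A I M" "inj_on i (carrier I)" using I(5) by (simp_all add: short_exact_def)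
      have "p x \<in> carrier I" "i (p x) \<noteq> \<zero>\<^bsub>M\<^esub>" using I(3,6) f by (auto simp: mod_hom_closed)
      then have "I \<notin> T" using perp[of I] i unfolding hom_zero_def by metis
      then have "inj_on p (carrier M)" using quot[OF I(1,3,4)] by metis
      then have "inj_on f (carrier M)"
        using i(2) I(3,6) unfolding inj_on_def by (metis mod_hom_closed)
      then show ?thesis
        using injective_endomorphism_surj[OF Mm f(1)] by (simp add: bij_betw_def)
    qed
    have "\<exists>x\<in>carrier M. x \<noteq> \<zero>\<^bsub>M\<^esub>"
    proof (rule ccontr)
      interpret left_module A M by (rule lm)
      assume "\<not> (\<exists>x\<in>carrier M. x \<noteq> \<zero>\<^bsub>M\<^esub>)"
      then have 0: "x = \<zero>\<^bsub>M\<^esub>" if "x \<in> carrier M" for x using that by blast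
      obtain N where N: "N \<in> T" using torsion_class_nonempty[OF T] by blast
      then have "left_module A N" using Tm by (auto intro: mod_cat_left_module)
      then interpret N: left_module A N .
      have "zero_hom N M \<in> mod_hom A N M" by (intro zero_hom_mod_hom) fact+
      moreover have "zero_hom N M ` carrier N = carrier M"
        using 0 N.M.zero_closed by (auto simp: zero_hom_def)
      ultimately show False using torsion_classD(2)[OF T N Mm] M by blast
    qed
    then obtain x where "x \<in> carrier M" "x \<noteq> \<zero>\<^bsub>M\<^esub>" by blast
    then show ?thesis by (rule brickI[OF Mm _ _ bij])
  qed
  moreover have "T \<subseteq> left_perp k A {M}"
    using perp Tm by (auto simp: left_perp_def)
  ultimately show thesis using that M by blast
qed

lemma subset_iff_bricks:
  assumes "torsion_class k A S" "torsion_class k A T"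
  shows "S \<subseteq> T \<longleftrightarrow> (\<forall>B\<in>bricks k A. B \<in> S \<longrightarrow> B \<in> T)"
proof
  assume *: "\<forall>B\<in>bricks k A. B \<in> S \<longrightarrow> B \<in> T"
  show "S \<subseteq> T"
  proof (rule ccontr)
    assume "\<not> S \<subseteq> T"
    then obtain B where "B \<in> bricks k A" "B \<in> S" "T \<subseteq> left_perp k A {B}"
      by (rule separating_brick[OF assms])
    then show False using * brick_not_in_left_perp by blast
  qed
qed blast

section \<open>Maximal chains of brick-splitting torsion classes\<close>

lemma maximal_chain_tors:
  "maximal_chain (tors k A) C \<longleftrightarrow>
    (\<forall>x\<in>C. torsion_class k A x) \<and> (\<forall>x\<in>C. \<forall>y\<in>C. x \<subseteq> y \<or> y \<subseteq> x) \<and>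
    (\<forall>T. torsion_class k A T \<longrightarrow> (\<forall>x\<in>C. x \<subseteq> T \<or> T \<subseteq> x) \<longrightarrow> T \<in> C)" (is "_ \<longleftrightarrow> ?R")
proof -
  interpret P: pred_on "carrier (tors k A)" "(\<sqsubseteq>\<^bsub>tors k A\<^esub>)" .
  show ?thesis
  proof
    assume m: "maximal_chain (tors k A) C"
    then have ch: "P.chain C" and mx: "\<And>S. P.chain S \<Longrightarrow> \<not> C \<subset> S"
      unfolding maximal_chain_def P.maxchain_def by blast+
    have C: "\<forall>x\<in>C. torsion_class k A x" "\<forall>x\<in>C. \<forall>y\<in>C. x \<subseteq> y \<or> y \<subseteq> x"
      using ch unfolding P.chain_def by (auto simp: tors_def)
    moreover have "T \<in> C" if T: "torsion_class k A T" "\<forall>x\<in>C. x \<subseteq> T \<or> T \<subseteq> x" for T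
    proof -
      have "P.chain (insert T C)"
        using C T unfolding P.chain_def by (auto simp: tors_def)
      then show ?thesis using mx by blast
    qed
    ultimately show ?R by blast
  next
    assume R: ?R
    show "maximal_chain (tors k A) C"
      unfolding maximal_chain_def P.maxchain_def
    proof (intro conjI notI)
      show "P.chain C" using R unfolding P.chain_def by (auto simp: tors_def)
      assume "\<exists>S. P.chain S \<and> C \<subset> S"
      then obtain S T where S: "P.chain S" "C \<subset> S" "T \<in> S" "T \<notin> C" by blast
      have "S \<subseteq> {T. torsion_class k A T}" and cmp: "\<forall>x\<in>S. \<forall>y\<in>S. x \<subseteq> y \<or> y \<subseteq> x"
        using S(1) unfolding P.chain_def by (simp_all add: tors_def)
      moreover have "\<forall>x\<in>C. x \<subseteq> T \<or> T \<subseteq> x"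
        using cmp S(2,3) by (meson psubsetD)
      moreover have "torsion_class k A T" using calculation(1) S(3) by blast
      ultimately show False using R S(4) by metis
    qed
  qed
qed

text \<open>
  The class cogenerated by the bricks outside \<open>U\<close> contains the bricks of \<open>U\<close>, because no nonzero map leaves
  \<open>U\<close>, and no other brick, because a brick is not orthogonal to itself.
\<close>

lemma brick_upset_splitting:
  assumes up: "\<forall>X\<in>bricks k A. \<forall>Y\<in>bricks k A. X \<in> U \<longrightarrow> \<not> hom_zero A X Y \<longrightarrow> Y \<in> U"
  shows "torsion_class k A (left_perp k A (bricks k A - U))"
    and "brick_splitting k A (left_perp k A (bricks k A - U))"
    and "B \<in> bricks k A \<Longrightarrow> B \<in> left_perp k A (bricks k A - U) \<longleftrightarrow> B \<in> U"
proof -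
  show "torsion_class k A (left_perp k A (bricks k A - U))"
    by (rule left_perp_torsion_class) (auto intro: brick_mod_cat)
  show mem: "B \<in> left_perp k A (bricks k A - U) \<longleftrightarrow> B \<in> U" if "B \<in> bricks k A" for B
  proof
    assume "B \<in> left_perp k A (bricks k A - U)"
    then show "B \<in> U" using that brick_not_hom_zero_self[OF that] by (auto simp: left_perp_def)
  next
    assume "B \<in> U"
    then have "hom_zero A B X" if "X \<in> bricks k A - U" for X
      using up \<open>B \<in> bricks k A\<close> that by blast
    then show "B \<in> left_perp k A (bricks k A - U)"
      using brick_mod_cat[OF that] by (simp add: left_perp_def)
  qed
  show "brick_splitting k A (left_perp k A (bricks k A - U))"
    unfolding brick_splitting_def
  proof
    fix B assume B: "B \<in> bricks k A"
    show "B \<in> left_perp k A (bricks k A - U) \<or> left_perp k A (bricks k A - U) \<subseteq> left_perp k A {B}"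
    proof (cases "B \<in> U")
      case False
      then show ?thesis using B by (auto simp: left_perp_def)
    qed (use mem[OF B] in simp)
  qed
qed

text \<open>
  By acyclicity, one of the two bricks, say \<open>W\<close>, cannot be reached by nonzero maps from the other one,
  \<open>V\<close>.  Adding to \<open>a\<close> the bricks of \<open>b\<close> reachable from \<open>V\<close> gives the class \<open>c\<close>, which contains \<open>V\<close> but
  not \<open>W\<close>.
\<close>

lemma splitting_strictly_between:
  assumes ac: "acyclic (brick_arrows k A)"
    and a: "torsion_class k A a" "brick_splitting k A a" and b: "torsion_class k A b" "brick_splitting k A b"
    and "a \<subseteq> b" and X: "X \<in> bricks k A" "X \<in> b" "X \<notin> a" and Y: "Y \<in> bricks k A" "Y \<in> b" "Y \<notin> a"
    and "\<not> isomorphic A X Y"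
  obtains c where "torsion_class k A c" "brick_splitting k A c" "a \<subset> c" "c \<subset> b"
proof -
  note found = that
  let ?N = "{(X, Y). X \<in> bricks k A \<and> Y \<in> bricks k A \<and> \<not> hom_zero A X Y}"
  have main: thesis if V: "V \<in> bricks k A" "V \<in> b" "V \<notin> a" and W: "W \<in> bricks k A" "W \<in> b" "W \<notin> a"
    and n: "(V, W) \<notin> ?N\<^sup>*" for V W
  proof -
    define U where "U = {Z \<in> bricks k A. Z \<in> a \<or> (Z \<in> b \<and> (V, Z) \<in> ?N\<^sup>*)}"
    have up: "Z' \<in> U" if "Z \<in> U" "Z \<in> bricks k A" "Z' \<in> bricks k A" "\<not> hom_zero A Z Z'" for Z Z'
    proof (cases "Z \<in> a")
      case True
      then show ?thesis using brick_splittingD[OF a(2)] that by (simp add: U_def)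
    next
      case False
      then have "Z \<in> b" "(V, Z) \<in> ?N\<^sup>*" using that(1) by (auto simp: U_def)
      moreover have "(Z, Z') \<in> ?N" using that by simp
      ultimately show ?thesis
        using brick_splittingD[OF b(2) _ that(3,4)] that(3) by (simp add: U_def rtrancl.rtrancl_into_rtrancl)
    qed
    let ?c = "left_perp k A (bricks k A - U)"
    have "\<forall>X\<in>bricks k A. \<forall>Y\<in>bricks k A. X \<in> U \<longrightarrow> \<not> hom_zero A X Y \<longrightarrow> Y \<in> U"
      using up by blast
    note c = brick_upset_splitting[OF this]
    have mem: "B \<in> ?c \<longleftrightarrow> B \<in> U" if "B \<in> bricks k A" for B using c(3) that by blast
    have "a \<subseteq> ?c"
      using subset_iff_bricks[OF a(1) c(1)] mem by (auto simp: U_def)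
    moreover have "?c \<subseteq> b"
      using subset_iff_bricks[OF c(1) b(1)] mem \<open>a \<subseteq> b\<close> by (auto simp: U_def)
    moreover have "V \<in> ?c" "W \<notin> ?c"
      using mem V W n by (auto simp: U_def)
    ultimately show thesis
      using found[OF c(1,2)] V W by blast
  qed
  have "\<not> ((X, Y) \<in> ?N\<^sup>* \<and> (Y, X) \<in> ?N\<^sup>*)"
  proof
    assume "(X, Y) \<in> ?N\<^sup>* \<and> (Y, X) \<in> ?N\<^sup>*"
    then have "isomorphic A X Y \<or> (X, Y) \<in> (brick_arrows k A)\<^sup>+"
      "isomorphic A Y X \<or> (Y, X) \<in> (brick_arrows k A)\<^sup>+"
      using nonzero_hom_path_cases X(1) Y(1) by blast+
    then have "(X, X) \<in> (brick_arrows k A)\<^sup>+"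
      using assms(13) isomorphic_sym[OF brick_left_module[OF Y(1)] brick_left_module[OF X(1)]]
      by (blast intro: trancl_trans)
    then show False using ac by (simp add: acyclic_def)
  qed
  then show thesis using main[OF X Y] main[OF Y X] by blast
qed

text \<open>
  Hausdorff's principle gives a chain maximal among brick-splitting classes.  A torsion class \<open>T\<close>
  comparable to all its members lies between the join \<open>a\<close> of the members below it and the meet \<open>b\<close> of
  those above it, formed as brick-splitting classes; both belong to the chain.  If \<open>T\<close> were neither of
  them, bricks \<open>X\<close> in \<open>T\<close> but not in \<open>a\<close>, and \<open>Y\<close> in \<open>b\<close> but not in \<open>T\<close>, would allow a brick-splitting
  class strictly between \<open>a\<close> and \<open>b\<close>.
\<close>

lemma splitting_maximal_chain_exists:
  assumes ac: "acyclic (brick_arrows k A)"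
  obtains C where "maximal_chain (tors k A) C" "\<And>x. x \<in> C \<Longrightarrow> brick_splitting k A x"
proof -
  let ?S = "{T. torsion_class k A T \<and> brick_splitting k A T}"
  interpret P: pred_on ?S "(\<subseteq>)" .
  obtain C where "P.maxchain C" using P.Hausdorff by blast
  then have ch: "P.chain C" and mx: "\<And>S. P.chain S \<Longrightarrow> \<not> C \<subset> S"
    unfolding P.maxchain_def by blast+
  have C: "torsion_class k A x" "brick_splitting k A x" if "x \<in> C" for x
    using ch that by (auto simp: P.chain_def)
  have cmp: "x \<subseteq> y \<or> y \<subseteq> x" if "x \<in> C" "y \<in> C" for x y
    using ch that by (auto simp: P.chain_def)
  have in_C: "c \<in> C" if "torsion_class k A c" "brick_splitting k A c" "\<And>x. x \<in> C \<Longrightarrow> x \<subseteq> c \<or> c \<subseteq> x" for c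
  proof -
    have "P.chain (insert c C)"
      unfolding P.chain_def using C cmp that by blast
    then show ?thesis using mx by blast
  qed
  have "T \<in> C" if T: "torsion_class k A T" and Tc: "\<forall>x\<in>C. x \<subseteq> T \<or> T \<subseteq> x" for T
  proof -
    define U where "U = \<Union>{x \<in> C. x \<subseteq> T}"
    define V where "V = bricks k A \<inter> \<Inter>{x \<in> C. T \<subseteq> x}"
    let ?a = "left_perp k A (bricks k A - U)" and ?b = "left_perp k A (bricks k A - V)"
    have "\<forall>X\<in>bricks k A. \<forall>Y\<in>bricks k A. X \<in> U \<longrightarrow> \<not> hom_zero A X Y \<longrightarrow> Y \<in> U"
      using brick_splittingD[OF C(2)] unfolding U_def by blast
    note a = brick_upset_splitting[OF this]
    have "\<forall>X\<in>bricks k A. \<forall>Y\<in>bricks k A. X \<in> V \<longrightarrow> \<not> hom_zero A X Y \<longrightarrow> Y \<in> V"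
      using brick_splittingD[OF C(2)] unfolding V_def by blast
    note b = brick_upset_splitting[OF this]
    have amem: "B \<in> ?a \<longleftrightarrow> B \<in> U" and bmem: "B \<in> ?b \<longleftrightarrow> B \<in> V" if "B \<in> bricks k A" for B
      using a(3) b(3) that by blast+
    have aT: "?a \<subseteq> T" using subset_iff_bricks[OF a(1) T] amem unfolding U_def by blast
    have Tb: "T \<subseteq> ?b" using subset_iff_bricks[OF T b(1)] bmem unfolding V_def by blast
    have xa: "x \<subseteq> ?a" if "x \<in> C" "x \<subseteq> T" for x
      using subset_iff_bricks[OF C(1)[OF that(1)] a(1)] amem that unfolding U_def by blast
    have bx: "?b \<subseteq> x" if "x \<in> C" "T \<subseteq> x" for x
      using subset_iff_bricks[OF b(1) C(1)[OF that(1)]] bmem that unfolding V_def by blast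
    have aC: "?a \<in> C"
    proof (rule in_C[OF a(1,2)])
      fix x assume "x \<in> C"
      then show "x \<subseteq> ?a \<or> ?a \<subseteq> x" using Tc xa aT by (meson subset_trans)
    qed
    have bC: "?b \<in> C"
    proof (rule in_C[OF b(1,2)])
      fix x assume "x \<in> C"
      then show "x \<subseteq> ?b \<or> ?b \<subseteq> x" using Tc bx Tb by (meson subset_trans)
    qed
    show "T \<in> C"
    proof (rule ccontr)
      assume "T \<notin> C"
      with aC bC aT Tb have ne: "\<not> T \<subseteq> ?a" "\<not> ?b \<subseteq> T" by (metis subset_antisym)+
      obtain X where X: "X \<in> bricks k A" "X \<in> T" "X \<notin> ?a"
        using subset_iff_bricks[OF T a(1)] ne(1) by blast
      obtain Y where Y: "Y \<in> bricks k A" "Y \<in> ?b" "Y \<notin> T"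
        using subset_iff_bricks[OF b(1) T] ne(2) by blast
      have "\<not> isomorphic A X Y"
        using torsion_classD(1)[OF T X(2) brick_mod_cat[OF Y(1)]] Y(3) by blast
      then obtain c where c: "torsion_class k A c" "brick_splitting k A c" "?a \<subset> c" "c \<subset> ?b"
        using splitting_strictly_between[OF ac a(1,2) b(1,2) _ X(1) _ X(3) Y(1,2)] aT Tb X(2) Y(3) by blast
      have "c \<in> C"
      proof (rule in_C[OF c(1,2)])
        fix x assume "x \<in> C"
        then show "x \<subseteq> c \<or> c \<subseteq> x" using Tc xa bx c(3,4) by (meson psubset_imp_subset subset_trans)
      qed
      then show False using Tc xa[of c] bx[of c] c(3,4) by blast
    qed
  qed
  then have "maximal_chain (tors k A) C"
    unfolding maximal_chain_tors using C(1) cmp by blast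
  then show thesis using that C(2) by blast
qed

text \<open>
  Let \<open>b\<close> be the intersection of the members of the chain that contain \<open>X\<close>; the members that do not
  contain \<open>X\<close> lie in \<open>b\<close> and admit no nonzero map to \<open>X\<close>.  Hence the intersections of \<open>b\<close> with
  \<open>left_perp k A {X}\<close> and with \<open>zero_or_surj k A X\<close> are comparable to all members of the chain and belong
  to it.  The first does not contain \<open>X\<close>, hence not \<open>Y\<close>, which gives a nonzero map \<open>Y \<rightarrow> X\<close>; the second
  contains \<open>X\<close>, hence \<open>Y\<close>, which makes this map surjective.
\<close>

lemma maximal_splitting_chain_separates:
  assumes C: "maximal_chain (tors k A) C" and sp: "\<And>x. x \<in> C \<Longrightarrow> brick_splitting k A x"
    and X: "X \<in> bricks k A" and Y: "Y \<in> bricks k A" and XY: "\<And>x. x \<in> C \<Longrightarrow> X \<in> x \<longleftrightarrow> Y \<in> x"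
  shows "\<exists>f\<in>mod_hom A Y X. f ` carrier Y = carrier X"
proof -
  have tc: "torsion_class k A x" if "x \<in> C" for x using C that by (simp add: maximal_chain_tors)
  have cmp: "x \<subseteq> y \<or> y \<subseteq> x" if "x \<in> C" "y \<in> C" for x y using C that by (simp add: maximal_chain_tors)
  have in_C: "T \<in> C" if "torsion_class k A T" "\<And>x. x \<in> C \<Longrightarrow> x \<subseteq> T \<or> T \<subseteq> x" for T
    using C that by (simp add: maximal_chain_tors)
  (* the extra member keeps b inside mod_cat k A in case no member of the chain contains X *)
  define b where "b = \<Inter>({mod_cat k A} \<union> {x \<in> C. X \<in> x})"
  have b: "torsion_class k A b"
    unfolding b_def using tc torsion_class_mod_cat by (intro torsion_class_Inter) auto
  have Xb: "X \<in> b" and Yb: "Y \<in> b"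
    using X Y XY brick_mod_cat by (auto simp: b_def)
  have above: "b \<subseteq> x" if "x \<in> C" "X \<in> x" for x using that by (auto simp: b_def)
  have below: "x \<subseteq> b" if "x \<in> C" "X \<notin> x" for x
    unfolding b_def using that cmp torsion_class_subset[OF tc] by blast
  have below_perp: "x \<subseteq> left_perp k A {X}" if "x \<in> C" "X \<notin> x" for x
    using sp[OF that(1)] that(2) X by (auto simp: brick_splitting_def)
  have perp_zs: "left_perp k A {X} \<subseteq> zero_or_surj k A X"
    by (auto simp: left_perp_def zero_or_surj_def hom_zero_def)
  have "b \<inter> left_perp k A {X} \<in> C"
    using above below below_perp
    by (intro in_C torsion_class_Int b left_perp_brick_torsion_class X) blast
  then have "Y \<notin> left_perp k A {X}"
    using XY Yb brick_not_in_left_perp[OF X] by blast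
  then have nz: "\<not> hom_zero A Y X" using brick_mod_cat[OF Y] by (simp add: left_perp_def)
  have "b \<inter> zero_or_surj k A X \<in> C"
    using above below below_perp perp_zs
    by (intro in_C torsion_class_Int b zero_or_surj_torsion_class brick_mod_cat[OF X]) blast
  then have "Y \<in> zero_or_surj k A X"
    using XY Xb brick_in_zero_or_surj[OF X] by blast
  then show ?thesis using nz unfolding zero_or_surj_def hom_zero_def by blast
qed

lemma acyclic_of_splitting_maximal_chain:
  assumes C: "maximal_chain (tors k A) C" and sp: "\<And>x. x \<in> C \<Longrightarrow> brick_splitting k A x"
  shows "acyclic (brick_arrows k A)"
  unfolding acyclic_def
proof (intro allI notI)
  fix X assume "(X, X) \<in> (brick_arrows k A)\<^sup>+"
  then obtain Y where Y: "(X, Y) \<in> brick_arrows k A" "(Y, X) \<in> (brick_arrows k A)\<^sup>*"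
    by (blast dest: tranclD)
  have br: "X \<in> bricks k A" "Y \<in> bricks k A" "\<not> isomorphic A X Y"
    using Y(1) by (auto simp: brick_arrows_def)
  have step: "W \<in> x" if "x \<in> C" "V \<in> x" "(V, W) \<in> brick_arrows k A" for x V W
    using brick_splittingD[OF sp[OF that(1)] that(2)] that(3) by (simp add: brick_arrows_def)
  have path: "W \<in> x" if "(V, W) \<in> (brick_arrows k A)\<^sup>*" "x \<in> C" "V \<in> x" for x V W
    using that by (induction rule: rtrancl_induct) (auto intro: step)
  have "X \<in> x \<longleftrightarrow> Y \<in> x" if "x \<in> C" for x
    using step[OF that _ Y(1)] path[OF Y(2) that] by blast
  then have "\<exists>f\<in>mod_hom A Y X. f ` carrier Y = carrier X" "\<exists>f\<in>mod_hom A X Y. f ` carrier X = carrier Y"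
    using maximal_splitting_chain_separates[OF C sp br(1,2)] maximal_splitting_chain_separates[OF C sp br(2,1)]
    by blast+
  then show False using bricks_isomorphic_of_surj[OF br(1,2)] br(3) by blast
qed

section \<open>The lattice of torsion classes\<close>

interpretation L: complete_lattice "tors k A"
  by (rule tors_complete_lattice[OF ring_A])

lemma tors_simps:
  "x \<in> carrier (tors k A) \<longleftrightarrow> torsion_class k A x"
  "x \<sqsubseteq>\<^bsub>tors k A\<^esub> y \<longleftrightarrow> x \<subseteq> y"
  "x \<sqsubset>\<^bsub>tors k A\<^esub> y \<longleftrightarrow> x \<subset> y"
  by (auto simp: tors_def lless_def)

lemma tors_meet:
  assumes "torsion_class k A x" "torsion_class k A y"
  shows "x \<sqinter>\<^bsub>tors k A\<^esub> y = x \<inter> y"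
proof
  show "x \<sqinter>\<^bsub>tors k A\<^esub> y \<subseteq> x \<inter> y"
    using assms L.meet_left[of x y] L.meet_right[of x y] by (simp add: tors_simps)
  show "x \<inter> y \<subseteq> x \<sqinter>\<^bsub>tors k A\<^esub> y"
    using assms L.meet_le[of "x \<inter> y" x y] torsion_class_Int by (simp add: tors_simps)
qed

lemma tors_join:
  assumes "torsion_class k A x" "torsion_class k A y"
  shows "torsion_class k A (x \<squnion>\<^bsub>tors k A\<^esub> y)" "x \<subseteq> x \<squnion>\<^bsub>tors k A\<^esub> y" "y \<subseteq> x \<squnion>\<^bsub>tors k A\<^esub> y"
    and "\<lbrakk>torsion_class k A z; x \<subseteq> z; y \<subseteq> z\<rbrakk> \<Longrightarrow> x \<squnion>\<^bsub>tors k A\<^esub> y \<subseteq> z"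
  using assms L.join_closed[of x y] L.join_left[of x y] L.join_right[of x y] L.join_le[of x z y]
  by (simp_all add: tors_simps)

lemma tors_sup:
  assumes "\<And>x. x \<in> S \<Longrightarrow> torsion_class k A x"
  shows "torsion_class k A (\<Squnion>\<^bsub>tors k A\<^esub>S)" "x \<in> S \<Longrightarrow> x \<subseteq> \<Squnion>\<^bsub>tors k A\<^esub>S"
    and "\<lbrakk>torsion_class k A z; \<And>x. x \<in> S \<Longrightarrow> x \<subseteq> z\<rbrakk> \<Longrightarrow> \<Squnion>\<^bsub>tors k A\<^esub>S \<subseteq> z"
proof -
  have S: "S \<subseteq> carrier (tors k A)" using assms by (auto simp: tors_simps)
  show "torsion_class k A (\<Squnion>\<^bsub>tors k A\<^esub>S)" using L.sup_closed[OF S] by (simp add: tors_simps)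
  show "x \<subseteq> \<Squnion>\<^bsub>tors k A\<^esub>S" if "x \<in> S" using L.sup_upper[OF S that] by (simp add: tors_simps)
  show "\<Squnion>\<^bsub>tors k A\<^esub>S \<subseteq> z" if "torsion_class k A z" "\<And>x. x \<in> S \<Longrightarrow> x \<subseteq> z"
    using L.sup_least[OF S, of z] that by (auto simp: tors_simps Upper_def)
qed

lemma tors_inf:
  assumes "\<And>x. x \<in> S \<Longrightarrow> torsion_class k A x"
  shows "torsion_class k A (\<Sqinter>\<^bsub>tors k A\<^esub>S)" "x \<in> S \<Longrightarrow> \<Sqinter>\<^bsub>tors k A\<^esub>S \<subseteq> x"
    and "\<lbrakk>torsion_class k A z; \<And>x. x \<in> S \<Longrightarrow> z \<subseteq> x\<rbrakk> \<Longrightarrow> z \<subseteq> \<Sqinter>\<^bsub>tors k A\<^esub>S"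
proof -
  have S: "S \<subseteq> carrier (tors k A)" using assms by (auto simp: tors_simps)
  show "torsion_class k A (\<Sqinter>\<^bsub>tors k A\<^esub>S)" using L.inf_closed[OF S] by (simp add: tors_simps)
  show "\<Sqinter>\<^bsub>tors k A\<^esub>S \<subseteq> x" if "x \<in> S" using L.inf_lower[OF S that] by (simp add: tors_simps)
  show "z \<subseteq> \<Sqinter>\<^bsub>tors k A\<^esub>S" if "torsion_class k A z" "\<And>x. x \<in> S \<Longrightarrow> z \<subseteq> x"
    using L.inf_greatest[OF S, of z] that by (auto simp: tors_simps Lower_def)
qed

lemma brick_lower_class:
  assumes B: "B \<in> bricks k A"
  shows "torsion_class k A (gen_torsion_class k A B \<inter> left_perp k A {B})"
    and "gen_torsion_class k A B \<inter> left_perp k A {B} \<subset> gen_torsion_class k A B"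
  using torsion_class_Int[OF torsion_class_gen[OF brick_mod_cat[OF B]] left_perp_brick_torsion_class[OF B]]
    brick_not_in_left_perp[OF B] mem_gen_torsion_class[of B] by blast+

lemma lower_star_gen:
  assumes B: "B \<in> bricks k A"
  shows "lower_star (tors k A) (gen_torsion_class k A B) = gen_torsion_class k A B \<inter> left_perp k A {B}"
proof -
  let ?S = "{y \<in> carrier (tors k A). y \<sqsubset>\<^bsub>tors k A\<^esub> gen_torsion_class k A B}"
  have S: "torsion_class k A x" "x \<subset> gen_torsion_class k A B" if "x \<in> ?S" for x
    using that by (simp_all add: tors_simps)
  note low = brick_lower_class[OF B]
  show ?thesis
    unfolding lower_star_def
  proof
    show "\<Squnion>\<^bsub>tors k A\<^esub>?S \<subseteq> gen_torsion_class k A B \<inter> left_perp k A {B}"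
      using S proper_subclass_in_left_perp[OF B] by (intro tors_sup(3) low) blast+
    show "gen_torsion_class k A B \<inter> left_perp k A {B} \<subseteq> \<Squnion>\<^bsub>tors k A\<^esub>?S"
      using low by (intro tors_sup(2) S(1)) (simp_all add: tors_simps)
  qed
qed

text \<open>
  A completely join-irreducible \<open>j\<close> is generated by any brick separating it from its largest proper
  subclass.
\<close>

lemma JIc_tors: "JIc (tors k A) = gen_torsion_class k A ` bricks k A"
proof (intro equalityI subsetI)
  fix j assume "j \<in> gen_torsion_class k A ` bricks k A"
  then obtain B where B: "B \<in> bricks k A" and j: "j = gen_torsion_class k A B" by blast
  have tc: "torsion_class k A j" unfolding j by (rule torsion_class_gen[OF brick_mod_cat[OF B]])
  have ne: "j \<noteq> \<Squnion>\<^bsub>tors k A\<^esub>S" if S: "S \<subseteq> {y \<in> carrier (tors k A). y \<sqsubset>\<^bsub>tors k A\<^esub> j}" for S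
  proof -
    have tS: "torsion_class k A x" "x \<subset> gen_torsion_class k A B" if "x \<in> S" for x
      using S that by (auto simp: tors_simps j)
    have "\<Squnion>\<^bsub>tors k A\<^esub>S \<subseteq> left_perp k A {B}"
      using tS proper_subclass_in_left_perp[OF B]
      by (intro tors_sup(3) left_perp_brick_torsion_class[OF B]) blast+
    then show ?thesis using brick_not_in_left_perp[OF B] mem_gen_torsion_class[of B] j by blast
  qed
  then show "j \<in> JIc (tors k A)"
    (* the empty S accounts for the condition that j is not the bottom element *)
    using tc ne[of "{}"] by (simp add: JIc_def tors_simps)
next
  fix j assume j: "j \<in> JIc (tors k A)"
  let ?S = "{y \<in> carrier (tors k A). y \<sqsubset>\<^bsub>tors k A\<^esub> j}"
  have tc: "torsion_class k A j" and ne: "j \<noteq> \<Squnion>\<^bsub>tors k A\<^esub>?S"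
    using j by (auto simp: JIc_def tors_simps)
  have S: "torsion_class k A x" "x \<subset> j" if "x \<in> ?S" for x
    using that by (simp_all add: tors_simps)
  have sup: "torsion_class k A (\<Squnion>\<^bsub>tors k A\<^esub>?S)" by (rule tors_sup(1)) (rule S(1))
  have "\<Squnion>\<^bsub>tors k A\<^esub>?S \<subseteq> j" using S by (intro tors_sup(3) tc) blast+
  then have "\<not> j \<subseteq> \<Squnion>\<^bsub>tors k A\<^esub>?S" using ne by blast
  then obtain B where B: "B \<in> bricks k A" "B \<in> j" "\<Squnion>\<^bsub>tors k A\<^esub>?S \<subseteq> left_perp k A {B}"
    by (rule separating_brick[OF tc sup])
  have g: "torsion_class k A (gen_torsion_class k A B)" by (rule torsion_class_gen[OF brick_mod_cat[OF B(1)]])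
  have "gen_torsion_class k A B \<subseteq> j" using gen_torsion_class_subset_iff[OF tc] B(2) by blast
  moreover have False if "gen_torsion_class k A B \<subset> j"
  proof -
    have "gen_torsion_class k A B \<subseteq> \<Squnion>\<^bsub>tors k A\<^esub>?S"
      using that g by (intro tors_sup(2) S(1)) (simp_all add: tors_simps)
    then show False using B(3) mem_gen_torsion_class[of B] brick_not_in_left_perp[OF B(1)] by blast
  qed
  ultimately show "j \<in> gen_torsion_class k A ` bricks k A" using B(1) by blast
qed

text \<open>
  A completely meet-irreducible \<open>m\<close> is cogenerated by any brick separating from it the intersection of
  all larger classes.
\<close>

lemma MIc_tors: "MIc (tors k A) = (\<lambda>B. left_perp k A {B}) ` bricks k A"
proof (intro equalityI subsetI)
  fix m assume "m \<in> (\<lambda>B. left_perp k A {B}) ` bricks k A"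
  then obtain B where B: "B \<in> bricks k A" and m: "m = left_perp k A {B}" by blast
  have tc: "torsion_class k A m" unfolding m by (rule left_perp_brick_torsion_class[OF B])
  have ne: "m \<noteq> \<Sqinter>\<^bsub>tors k A\<^esub>S" if S: "S \<subseteq> {y \<in> carrier (tors k A). m \<sqsubset>\<^bsub>tors k A\<^esub> y}" for S
  proof -
    have tS: "torsion_class k A x" "left_perp k A {B} \<subset> x" if "x \<in> S" for x
      using S that by (auto simp: tors_simps m)
    have "gen_torsion_class k A B \<subseteq> \<Sqinter>\<^bsub>tors k A\<^esub>S"
    proof (intro tors_inf(3) torsion_class_gen[OF brick_mod_cat[OF B]])
      fix x assume "x \<in> S"
      note x = tS[OF this]
      show "torsion_class k A x" by (fact x)
      show "gen_torsion_class k A B \<subseteq> x"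
        unfolding gen_torsion_class_subset_iff[OF x(1)] by (rule proper_superclass_contains_brick[OF B x])
    qed
    then show ?thesis using brick_not_in_left_perp[OF B] mem_gen_torsion_class[of B] m by blast
  qed
  then show "m \<in> MIc (tors k A)"
    using tc ne[of "{}"] by (simp add: MIc_def tors_simps)
next
  fix m assume m: "m \<in> MIc (tors k A)"
  let ?S = "{y \<in> carrier (tors k A). m \<sqsubset>\<^bsub>tors k A\<^esub> y}"
  have tc: "torsion_class k A m" and ne: "m \<noteq> \<Sqinter>\<^bsub>tors k A\<^esub>?S"
    using m by (auto simp: MIc_def tors_simps)
  have S: "torsion_class k A x" "m \<subset> x" if "x \<in> ?S" for x
    using that by (simp_all add: tors_simps)
  have inf: "torsion_class k A (\<Sqinter>\<^bsub>tors k A\<^esub>?S)" by (rule tors_inf(1)) (rule S(1))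
  have "m \<subseteq> \<Sqinter>\<^bsub>tors k A\<^esub>?S" using S by (intro tors_inf(3) tc) blast+
  then have "\<not> \<Sqinter>\<^bsub>tors k A\<^esub>?S \<subseteq> m" using ne by blast
  then obtain B where B: "B \<in> bricks k A" "B \<in> \<Sqinter>\<^bsub>tors k A\<^esub>?S" "m \<subseteq> left_perp k A {B}"
    by (rule separating_brick[OF inf tc])
  have False if "m \<subset> left_perp k A {B}"
  proof -
    have "\<Sqinter>\<^bsub>tors k A\<^esub>?S \<subseteq> left_perp k A {B}"
      using that left_perp_brick_torsion_class[OF B(1)]
      by (intro tors_inf(2) S(1)) (simp_all add: tors_simps)
    then show False using B(2) brick_not_in_left_perp[OF B(1)] by blast
  qed
  then show "m \<in> (\<lambda>B. left_perp k A {B}) ` bricks k A" using B(1,3) by blast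
qed

text \<open>
  The cokernel of a nonzero map from \<open>x\<close> to \<open>B\<close> is a proper quotient of \<open>B\<close>, so it lies in the largest
  proper subclass of \<open>T(B)\<close>, hence in \<open>x\<close>; then \<open>B\<close> itself would lie in \<open>x\<close>.
\<close>

lemma kappa_fibre_bound:
  assumes B: "B \<in> bricks k A" and x: "torsion_class k A x"
    and eq: "x \<inter> gen_torsion_class k A B = gen_torsion_class k A B \<inter> left_perp k A {B}"
  shows "x \<subseteq> left_perp k A {B}"
proof
  fix M assume M: "M \<in> x"
  have Mm: "M \<in> mod_cat k A" using M torsion_class_subset[OF x] by blast
  have "hom_zero A M B"
  proof (rule ccontr)
    assume "\<not> hom_zero A M B"
    then have "B \<in> x"
    proof (rule brick_mem_of_nonzero_hom[OF B x M])
      fix C q assume C: "C \<in> mod_cat k A" "q \<in> mod_hom A B C" "q ` carrier B = carrier C" "hom_zero A C B"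
      have "C \<in> gen_torsion_class k A B"
        by (rule torsion_classD(2)[OF torsion_class_gen[OF brick_mod_cat[OF B]] mem_gen_torsion_class C(1-3)])
      then have "C \<in> gen_torsion_class k A B \<inter> left_perp k A {B}"
        using C(1,4) by (simp add: left_perp_def)
      then show "C \<in> x" using eq by blast
    qed
    then show False using eq mem_gen_torsion_class[of B] brick_not_in_left_perp[OF B] by blast
  qed
  then show "M \<in> left_perp k A {B}" using Mm by (simp add: left_perp_def)
qed

lemma kappa_gen:
  assumes B: "B \<in> bricks k A"
  shows "kappa (tors k A) (gen_torsion_class k A B) = left_perp k A {B}"
proof -
  note g = torsion_class_gen[OF brick_mod_cat[OF B]]
  have set_eq: "{x \<in> carrier (tors k A). x \<sqinter>\<^bsub>tors k A\<^esub> gen_torsion_class k A B =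
      lower_star (tors k A) (gen_torsion_class k A B)} =
    {x. torsion_class k A x \<and> x \<inter> gen_torsion_class k A B = gen_torsion_class k A B \<inter> left_perp k A {B}}"
    (is "?F = ?G")
    unfolding lower_star_gen[OF B] using tors_meet[OF _ g] by (auto simp: tors_simps)
  have "greatest (tors k A) (left_perp k A {B}) ?G"
    unfolding greatest_def using left_perp_brick_torsion_class[OF B] kappa_fibre_bound[OF B]
    by (auto simp: tors_simps)
  then show ?thesis
    unfolding kappa_def set_eq by (metis (no_types, lifting) L.greatest_unique the_equality)
qed

text \<open>
  A brick separating the two sides of the modular law is orthogonal to \<open>y\<close> and not in \<open>x\<close>; being split,
  it is orthogonal to \<open>x\<close> as well, hence to \<open>y \<squnion> x\<close>, which contains it.
\<close>

lemma brick_splitting_imp_left_modular: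
  assumes x: "torsion_class k A x" "brick_splitting k A x"
  shows "left_modular (tors k A) x"
  unfolding left_modular_def
proof (intro ballI impI)
  fix y z assume "y \<in> carrier (tors k A)" "z \<in> carrier (tors k A)" "y \<sqsubseteq>\<^bsub>tors k A\<^esub> z"
  then have y: "torsion_class k A y" and z: "torsion_class k A z" and yz: "y \<subseteq> z"
    by (simp_all add: tors_simps)
  note yx = tors_join[OF y x(1)] and xz = torsion_class_Int[OF x(1) z]
  note yxz = tors_join[OF y xz]
  let ?l = "(y \<squnion>\<^bsub>tors k A\<^esub> x) \<inter> z" and ?r = "y \<squnion>\<^bsub>tors k A\<^esub> (x \<inter> z)"
  have l: "torsion_class k A ?l" by (rule torsion_class_Int[OF yx(1) z])
  have "?r \<subseteq> ?l" using yx(2,3) yz by (intro yxz(4) l) blast+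
  moreover have "?l \<subseteq> ?r"
  proof (rule ccontr)
    assume "\<not> ?l \<subseteq> ?r"
    then obtain B where B: "B \<in> bricks k A" "B \<in> ?l" "?r \<subseteq> left_perp k A {B}"
      by (rule separating_brick[OF l yxz(1)])
    have "B \<notin> x" using B yxz(3) brick_not_in_left_perp[OF B(1)] by blast
    then have "x \<subseteq> left_perp k A {B}" using x(2) B(1) by (auto simp: brick_splitting_def)
    moreover have "y \<subseteq> left_perp k A {B}" using yxz(2) B(3) by blast
    ultimately have "y \<squnion>\<^bsub>tors k A\<^esub> x \<subseteq> left_perp k A {B}"
      by (intro yx(4) left_perp_brick_torsion_class[OF B(1)])
    then show False using B(2) brick_not_in_left_perp[OF B(1)] by blast
  qed
  ultimately show "(y \<squnion>\<^bsub>tors k A\<^esub> x) \<sqinter>\<^bsub>tors k A\<^esub> z = y \<squnion>\<^bsub>tors k A\<^esub> (x \<sqinter>\<^bsub>tors k A\<^esub> z)"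
    unfolding tors_meet[OF yx(1) z] tors_meet[OF x(1) z] by blast
qed

text \<open>
  Apply the modular law to the pair \<open>T(B)\<^sub>* \<subseteq> T(B)\<close>.
\<close>

lemma left_modular_imp_brick_splitting:
  assumes x: "torsion_class k A x" "left_modular (tors k A) x"
  shows "brick_splitting k A x"
  unfolding brick_splitting_def
proof
  fix B assume B: "B \<in> bricks k A"
  note g = torsion_class_gen[OF brick_mod_cat[OF B]]
  let ?j = "gen_torsion_class k A B"
  let ?l = "?j \<inter> left_perp k A {B}"
  note low = brick_lower_class[OF B]
  note lx = tors_join[OF low(1) x(1)]
  show "B \<in> x \<or> x \<subseteq> left_perp k A {B}"
  proof (cases "B \<in> x")
    case False
    then have "x \<inter> ?j \<subset> ?j" using mem_gen_torsion_class[of B] by blast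
    then have sub: "x \<inter> ?j \<subseteq> ?l"
      using proper_subclass_in_left_perp[OF B torsion_class_Int[OF x(1) g]] by blast
    (* ?l is the largest proper subclass of ?j *)
    have "(?l \<squnion>\<^bsub>tors k A\<^esub> x) \<sqinter>\<^bsub>tors k A\<^esub> ?j = ?l \<squnion>\<^bsub>tors k A\<^esub> (x \<sqinter>\<^bsub>tors k A\<^esub> ?j)"
      using x(2) low g unfolding left_modular_def by (simp add: tors_simps)
    then have "(?l \<squnion>\<^bsub>tors k A\<^esub> x) \<inter> ?j = ?l \<squnion>\<^bsub>tors k A\<^esub> (x \<inter> ?j)"
      using tors_meet[OF lx(1) g] tors_meet[OF x(1) g] by simp
    also have "\<dots> = ?l"
      using tors_join(2,4)[OF low(1) torsion_class_Int[OF x(1) g]] low(1) sub by blast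
    finally have "?l \<squnion>\<^bsub>tors k A\<^esub> x \<subseteq> left_perp k A {B}"
      by (rule kappa_fibre_bound[OF B lx(1)])
    then show ?thesis using lx(3) by blast
  qed simp
qed

lemma left_modular_lattice_iff: "left_modular_lattice (tors k A) \<longleftrightarrow> acyclic (brick_arrows k A)"
proof
  assume "left_modular_lattice (tors k A)"
  then obtain C where C: "maximal_chain (tors k A) C" "\<And>x. x \<in> C \<Longrightarrow> left_modular (tors k A) x"
    unfolding left_modular_lattice_def by blast
  then have "brick_splitting k A x" if "x \<in> C" for x
    using that left_modular_imp_brick_splitting by (simp add: maximal_chain_tors)
  then show "acyclic (brick_arrows k A)" by (rule acyclic_of_splitting_maximal_chain[OF C(1)])
next
  assume "acyclic (brick_arrows k A)"
  then obtain C where C: "maximal_chain (tors k A) C" "\<And>x. x \<in> C \<Longrightarrow> brick_splitting k A x"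
    by (rule splitting_maximal_chain_exists) blast
  then have "left_modular (tors k A) x" if "x \<in> C" for x
    using that brick_splitting_imp_left_modular by (simp add: maximal_chain_tors)
  then show "left_modular_lattice (tors k A)" unfolding left_modular_lattice_def using C(1) by blast
qed

text \<open>
  On a chain of brick-splitting classes, \<open>j \<le> x\<close> fails iff \<open>x \<le> \<kappa>(j)\<close>.  So for a cover \<open>x < y\<close> the
  irreducibles \<open>j\<close> and \<open>m\<close> of the definition both correspond to the bricks in \<open>y\<close> but not in \<open>x\<close>, and
  there is only one such brick, since two non-isomorphic ones would allow a class strictly between.
\<close>

lemma extremal_lattice_iff: "extremal_lattice (tors k A) \<longleftrightarrow> acyclic (brick_arrows k A)"
proof
  assume "extremal_lattice (tors k A)"
  then obtain C where C: "maximal_chain (tors k A) C"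
    and kap: "\<forall>x\<in>C. \<forall>j\<in>JIc (tors k A). \<not> j \<sqsubseteq>\<^bsub>tors k A\<^esub> x \<longrightarrow> x \<sqsubseteq>\<^bsub>tors k A\<^esub> kappa (tors k A) j"
    unfolding extremal_lattice_def by (elim exE conjE)
  have "brick_splitting k A x" if x: "x \<in> C" for x
    unfolding brick_splitting_def
  proof
    fix B assume B: "B \<in> bricks k A"
    have tx: "torsion_class k A x" using C x by (simp add: maximal_chain_tors)
    have "gen_torsion_class k A B \<in> JIc (tors k A)" using B by (simp add: JIc_tors)
    with kap x have "gen_torsion_class k A B \<subseteq> x \<or> x \<subseteq> left_perp k A {B}"
      using kappa_gen[OF B] by (auto simp: tors_simps)
    then show "B \<in> x \<or> x \<subseteq> left_perp k A {B}" using gen_torsion_class_subset_iff[OF tx] by blast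
  qed
  then show "acyclic (brick_arrows k A)" by (rule acyclic_of_splitting_maximal_chain[OF C])
next
  assume ac: "acyclic (brick_arrows k A)"
  then obtain C where C: "maximal_chain (tors k A) C" and sp: "\<And>x. x \<in> C \<Longrightarrow> brick_splitting k A x"
    by (rule splitting_maximal_chain_exists) blast
  have tc: "torsion_class k A x" if "x \<in> C" for x using C that by (simp add: maximal_chain_tors)
  have perp_iff: "x \<subseteq> left_perp k A {B} \<longleftrightarrow> B \<notin> x" if "x \<in> C" "B \<in> bricks k A" for x B
    using sp[OF that(1)] that(2) brick_not_in_left_perp[OF that(2)] by (auto simp: brick_splitting_def)
  have gen_iff: "gen_torsion_class k A B \<subseteq> x \<longleftrightarrow> B \<in> x" if "x \<in> C" for x B
    by (rule gen_torsion_class_subset_iff[OF tc[OF that]])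
  have filter_image: "{j \<in> f ` S. P j} = f ` {B \<in> S. P (f B)}" for f :: "('k, 'a) object \<Rightarrow> ('k, 'a) object set" and S P
    by blast
  have image_eq_singleton: "f ` {B' \<in> S. P B'} = {f B}"
    if "B \<in> S" "P B" "\<And>B'. \<lbrakk>B' \<in> S; P B'\<rbrakk> \<Longrightarrow> f B = f B'"
    for f :: "('k, 'a) object \<Rightarrow> ('k, 'a) object set" and S P B
    using that by (intro equalityI subsetI) (blast, blast)
  have label: "\<exists>j m. {j' \<in> JIc (tors k A). j' \<sqsubseteq>\<^bsub>tors k A\<^esub> y \<and> \<not> j' \<sqsubseteq>\<^bsub>tors k A\<^esub> x} = {j} \<and>
      {m' \<in> MIc (tors k A). x \<sqsubseteq>\<^bsub>tors k A\<^esub> m' \<and> \<not> y \<sqsubseteq>\<^bsub>tors k A\<^esub> m'} = {m} \<and> kappa (tors k A) j = m"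
    if x: "x \<in> C" and y: "y \<in> C" and cov: "covers (tors k A) x y" for x y
  proof -
    have xy: "x \<subset> y" and no: "\<not> (torsion_class k A z \<and> x \<subset> z \<and> z \<subset> y)" for z
      using cov by (auto simp: covers_def tors_simps)
    then obtain B where B: "B \<in> bricks k A" "B \<in> y" "B \<notin> x"
      using subset_iff_bricks[OF tc[OF y] tc[OF x]] by blast
    have uniq: "isomorphic A B B'" if B': "B' \<in> bricks k A" "B' \<in> y" "B' \<notin> x" for B'
    proof (rule ccontr)
      assume n: "\<not> isomorphic A B B'"
      obtain c where "torsion_class k A c" "x \<subset> c" "c \<subset> y"
        by (rule splitting_strictly_between[OF ac tc[OF x] sp[OF x] tc[OF y] sp[OF y]
              psubset_imp_subset[OF xy] B B' n])
      then show False using no by blast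
    qed
    have "{j' \<in> JIc (tors k A). j' \<sqsubseteq>\<^bsub>tors k A\<^esub> y \<and> \<not> j' \<sqsubseteq>\<^bsub>tors k A\<^esub> x} =
        gen_torsion_class k A ` {B' \<in> bricks k A. B' \<in> y \<and> B' \<notin> x}"
      unfolding JIc_tors filter_image by (simp add: tors_simps gen_iff[OF x] gen_iff[OF y])
    also have "\<dots> = {gen_torsion_class k A B}"
      using B
      by (intro image_eq_singleton[where B = B and f = "gen_torsion_class k A"] isomorphic_bricks_same_classes(1) uniq conjI)
        simp_all
    finally have 1: "{j' \<in> JIc (tors k A). j' \<sqsubseteq>\<^bsub>tors k A\<^esub> y \<and> \<not> j' \<sqsubseteq>\<^bsub>tors k A\<^esub> x} = {gen_torsion_class k A B}" .
    have "{m' \<in> MIc (tors k A). x \<sqsubseteq>\<^bsub>tors k A\<^esub> m' \<and> \<not> y \<sqsubseteq>\<^bsub>tors k A\<^esub> m'} =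
        (\<lambda>B. left_perp k A {B}) ` {B' \<in> bricks k A. B' \<in> y \<and> B' \<notin> x}"
      unfolding MIc_tors filter_image
      by (rule arg_cong[where f = "(`) _"], rule Collect_cong, rule conj_cong[OF refl])
        (simp add: tors_simps perp_iff[OF x] perp_iff[OF y] conj_commute)
    also have "\<dots> = {left_perp k A {B}}"
      using B
      by (intro image_eq_singleton[where B = B and f = "\<lambda>B. left_perp k A {B}"] isomorphic_bricks_same_classes(2) uniq conjI)
        simp_all
    finally show ?thesis
      using 1 kappa_gen[OF B(1)]
      by (intro exI[of _ "gen_torsion_class k A B"] exI[of _ "left_perp k A {B}"] conjI)
  qed
  have "x \<sqsubseteq>\<^bsub>tors k A\<^esub> kappa (tors k A) j"
    if x: "x \<in> C" and "j \<in> JIc (tors k A)" and nj: "\<not> j \<sqsubseteq>\<^bsub>tors k A\<^esub> x" for x j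
  proof -
    obtain B where B: "B \<in> bricks k A" "j = gen_torsion_class k A B"
      using \<open>j \<in> _\<close> unfolding JIc_tors by blast
    then have "B \<notin> x" using nj gen_iff[OF x] by (simp add: tors_simps)
    then show ?thesis
      unfolding B(2) kappa_gen[OF B(1)] tors_simps perp_iff[OF x B(1)] .
  qed
  with C label show "extremal_lattice (tors k A)"
    unfolding extremal_lattice_def by (intro exI[of _ C] conjI ballI impI)
qed

end

theorem corollary1p6:
  fixes k :: "('k, 'r) ring_scheme" and A :: "('k, 'a) module"
  assumes "fin_dim_algebra k A" and "connected_algebra A"
  shows "(brick_directed k A \<longleftrightarrow> left_modular_lattice (tors k A)) \<and>
         (brick_directed k A \<longleftrightarrow> extremal_lattice (tors k A)) \<and>
         (brick_directed k A \<longleftrightarrow> acyclic (brick_quiver k A))"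
proof -
  have "brick_directed k A \<longleftrightarrow> acyclic (brick_arrows k A)"
    unfolding brick_directed_def using brick_cycle_iff by blast
  then show ?thesis
    using left_modular_lattice_iff[OF assms(1)] extremal_lattice_iff[OF assms(1)]
      acyclic_brick_quiver_iff by blast
qed

end
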